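(* For every Arveson system $E^\otimes=(E_t)_{t\in(0,\infty)}$ there exists a strongly continuous $E_0$-semigroup having $E^\otimes$ as associated Bhat system. Moreover, for every Arveson system $E^\otimes$ there also exists a strongly continuous $E_0$-semigroup having $E^\otimes$ as associated Arveson system.
   Context: **Arveson system.** Let $H_0$ be an infinite-dimensional separable Hilbert space. An Arveson system is the trivial bundle $(0,\infty)\times H_0$ with its natural Borel structure, equipped with a (jointly) measurable associative multiplication $((s,x),(t,y))\mapsto(s+t,xy)$ (where $xy\in H_0$ may depend on $s,t$) such that for all $s,t>0$ the assignment $x\otimes y\mapsto xy$ defines a unitary $H_0\otimes H_0\to H_0$. Put $E_t:=\{t\}\times H_0$ (a Hilbert space, identified with $H_0$) and let $u_{s,t}\colon E_s\otimes E_t\to E_{s+t}$ be the unitaries $u_{s,t}((s,x)\otimes(t,y)):=(s+t,xy)$; write $E^\otimes=(E_t)_{t\in(0,\infty)}$. Write $\mathrm{id}_t:=\mathrm{id}_{E_t}$. **$E_0$-semigroup.** Let $H$ be an infinite-dimensional separable Hilbert space and $\mathscr{B}(H)$ the algebra of bounded operators on $H$. An $E_0$-semigroup on $\mathscr{B}(H)$ is a semigroup $\vartheta=(\vartheta_t)_{t\in[0,\infty)}$ (with $\vartheta_0=\mathrm{id}$) of normal unital $*$-endomorphisms of $\mathscr{B}(H)$ that is proper, i.e. $\vartheta_t$ is not an automorphism for $t>0$. It is strongly continuous if $t\mapsto\vartheta_t(a)x$ is continuous for every $a\in\mathscr{B}(H)$ and every $x\in H$. **Left dilation and associated Bhat system.**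 A left dilation of $E^\otimes$ on a Hilbert space $H\neq\{0\}$ is a pair $(v,H)$ where $v=(v_t)_{t\in(0,\infty)}$ is a family of unitaries $v_t\colon H\otimes E_t\to H$ satisfying $v_t(v_s\otimes\mathrm{id}_t)=v_{s+t}(\mathrm{id}_H\otimes u_{s,t})$ for all $s,t>0$. An $E_0$-semigroup $\vartheta$ on $\mathscr{B}(H)$ has $E^\otimes$ as associated Bhat system if there is a left dilation $(v,H)$ of $E^\otimes$ on $H$ such that $\vartheta_t(a)=v_t(a\otimes\mathrm{id}_t)v_t^*$ for all $a\in\mathscr{B}(H)$ and $t>0$. **Right dilation and associated Arveson system.** A right dilation of $E^\otimes$ on a Hilbert space $H\ne\{0\}$ is a pair $(w,H)$ where $w=(w_t)_{t\in(0,\infty)}$ is a family of unitaries $w_t\colon E_t\otimes H\to H$ satisfying $w_t(\mathrm{id}_t\otimes w_s)=w_{s+t}(u_{t,s}\otimes\mathrm{id}_H)$ for all $s,t>0$. An $E_0$-semigroup $\vartheta$ on $\mathscr{B}(H)$ has $E^\otimes$ as associated Arveson system if there is a right dilation $(w,H)$ of $E^\otimes$ on $H$ such that $\vartheta_t(a)=w_t(\mathrm{id}_t\otimes a)w_t^*$ for all $a\in\mathscr{B}(H)$ and $t>0$. *)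

theory Defs
  imports "HOL-Analysis.Analysis"
begin


section \<open>Complex Hilbert spaces\<close>

class scaleC =
  fixes scaleC :: "complex \<Rightarrow> 'a \<Rightarrow> 'a" (infixr \<open>*\<^sub>C\<close> 75)

class complex_vector = real_vector + scaleC +
  assumes scaleC_add_right: "a *\<^sub>C (x + y) = a *\<^sub>C x + a *\<^sub>C y"
    and scaleC_add_left: "(a + b) *\<^sub>C x = a *\<^sub>C x + b *\<^sub>C x"
    and scaleC_scaleC: "a *\<^sub>C (b *\<^sub>C x) = (a * b) *\<^sub>C x"
    and scaleC_one: "1 *\<^sub>C x = x"
    and scaleR_scaleC: "r *\<^sub>R x = complex_of_real r *\<^sub>C x"

global_interpretation complex_vector: vector_space "scaleC :: complex \<Rightarrow> 'a \<Rightarrow> 'a::complex_vector"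
  defines cspan = complex_vector.span
  by unfold_locales (auto simp: scaleC_add_right scaleC_add_left scaleC_scaleC scaleC_one)

text \<open>The inner product is antilinear in the first argument. Its real part is the real inner
  product of the library, which provides norm, metric, topology and the Borel sets.\<close>

class complex_inner = complex_vector + real_inner +
  fixes cinner :: "'a \<Rightarrow> 'a \<Rightarrow> complex"
  assumes cinner_commute: "cinner x y = cnj (cinner y x)"
    and cinner_add_right: "cinner x (y + z) = cinner x y + cinner x z"
    and cinner_scaleC_right: "cinner x (c *\<^sub>C y) = c * cinner x y"
    and inner_eq_Re_cinner: "inner x y = Re (cinner x y)"

class chilbert_space = complex_inner + complete_space

text \<open>Class specifications cannot mention \<^const>\<open>closure\<close> and \<^const>\<open>cspan\<close>, hence the unfolded
  assumptions; the lemmas after the class restate them.\<close>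

class separable_infinite_chilbert = chilbert_space +
  assumes separable: "\<exists>D. countable D \<and> (\<forall>x. \<forall>e>0. \<exists>y\<in>D. dist y x < e)"
    and infinite_dimensional: "\<not> (\<exists>B. finite B \<and> (\<forall>x. \<exists>c. x = (\<Sum>b\<in>B. c b *\<^sub>C b)))"

lemma separable_closure:
  "\<exists>D :: 'a::separable_infinite_chilbert set. countable D \<and> closure D = UNIV"
proof -
  obtain D :: "'a set" where "countable D" "\<And>x e. e > 0 \<Longrightarrow> \<exists>y\<in>D. dist y x < e"
    using separable by blast
  then have "x \<in> closure D" for x
    unfolding closure_approachable by blast
  with \<open>countable D\<close> show ?thesis by blast
qed

lemma infinite_dimensional_cspan:
  assumes "finite (B :: 'a::separable_infinite_chilbert set)"
  shows "cspan B \<noteq> UNIV"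
proof
  assume *: "cspan B = UNIV"
  have "\<exists>c. x = (\<Sum>b\<in>B. c b *\<^sub>C b)" for x
  proof -
    have "x \<in> range (\<lambda>u. \<Sum>b\<in>B. u b *\<^sub>C b)"
      unfolding complex_vector.span_finite[OF assms, symmetric] * by simp
    then show ?thesis by blast
  qed
  with assms infinite_dimensional[where 'a='a] show False by blast
qed

instance separable_infinite_chilbert \<subseteq> second_countable_topology
proof
  obtain D :: "'a set" where D: "countable D" "\<And>x e. e > 0 \<Longrightarrow> \<exists>y\<in>D. dist y x < e"
    using separable by blast
  define B where "B = (\<lambda>(x, n). ball x (inverse (real (Suc n)))) ` (D \<times> (UNIV :: nat set))"
  have "countable B"
    unfolding B_def using D(1) by (intro countable_image countable_SIGMA) auto
  moreover have "open S \<longleftrightarrow> generate_topology B S" for S :: "'a set"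
  proof
    show "open S" if "generate_topology B S"
      using that by induction (auto simp: B_def)
    assume "open S"
    have *: "\<exists>b\<in>B. x \<in> b \<and> b \<subseteq> S" if "x \<in> S" for x
    proof -
      obtain e where e: "e > 0" "ball x e \<subseteq> S"
        using \<open>open S\<close> \<open>x \<in> S\<close> open_contains_ball by blast
      obtain n where n: "inverse (real (Suc n)) < e / 2"
        using e(1) reals_Archimedean[of "e/2"] by auto
      obtain d where d: "d \<in> D" "dist d x < inverse (real (Suc n))"
        using D(2)[of "inverse (real (Suc n))" x] by auto
      have "ball d (inverse (real (Suc n))) \<subseteq> S"
      proof (rule order_trans[OF _ e(2)], rule subsetI)
        fix y assume "y \<in> ball d (inverse (real (Suc n)))"
        then show "y \<in> ball x e"
          using d(2) n dist_triangle[of x y d] by (simp add: dist_commute)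
      qed
      moreover have "ball d (inverse (real (Suc n))) \<in> B"
        using d(1) by (auto simp: B_def)
      ultimately show ?thesis
        using d(2) by (intro bexI[of _ "ball d (inverse (real (Suc n)))"]) auto
    qed
    then have "S = \<Union>{b\<in>B. b \<subseteq> S}" by blast
    moreover have "generate_topology B (\<Union>{b\<in>B. b \<subseteq> S})"
      by (rule generate_topology.UN) (auto intro: generate_topology.Basis)
    ultimately show "generate_topology B S" by simp
  qed
  ultimately show "\<exists>B::'a set set. countable B \<and> open = generate_topology B"
    by blast
qed

lemma cinner_add_left: "cinner (x + y) z = cinner x z + cinner y z"
  using cinner_commute[of "x + y" z] cinner_commute[of x z] cinner_commute[of y z]
  by (simp add: cinner_add_right)

lemma cinner_scaleC_left: "cinner (c *\<^sub>C x) y = cnj c * cinner x y"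
  using cinner_commute[of "c *\<^sub>C x" y] cinner_commute[of x y]
  by (simp add: cinner_scaleC_right)

lemma cinner_zero_right [simp]: "cinner x 0 = 0"
  using cinner_add_right[of x 0 0] by simp

lemma cinner_zero_left [simp]: "cinner 0 x = 0"
  using cinner_add_left[of 0 0 x] by simp

lemma cinner_minus_right: "cinner x (- y) = - cinner x y"
  using cinner_add_right[of x y "-y"] by (simp add: add_eq_0_iff)

lemma cinner_minus_left: "cinner (- x) y = - cinner x y"
  using cinner_add_left[of x "-x" y] by (simp add: add_eq_0_iff)

lemma cinner_diff_right: "cinner x (y - z) = cinner x y - cinner x z"
  using cinner_add_right[of x y "-z"] by (simp add: cinner_minus_right)

lemma cinner_diff_left: "cinner (x - y) z = cinner x z - cinner y z"
  using cinner_add_left[of x "-y" z] by (simp add: cinner_minus_left)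

lemma cinner_sum_right: "cinner x (\<Sum>i\<in>A. f i) = (\<Sum>i\<in>A. cinner x (f i))"
  by (induction A rule: infinite_finite_induct) (auto simp: cinner_add_right)

lemma cinner_sum_left: "cinner (\<Sum>i\<in>A. f i) x = (\<Sum>i\<in>A. cinner (f i) x)"
  by (induction A rule: infinite_finite_induct) (auto simp: cinner_add_left)

lemma cinner_sum_list_right: "cinner x (\<Sum>i\<leftarrow>xs. f i) = (\<Sum>i\<leftarrow>xs. cinner x (f i))"
  by (induction xs) (auto simp: cinner_add_right)

lemma cinner_sum_list_left: "cinner (\<Sum>i\<leftarrow>xs. f i) x = (\<Sum>i\<leftarrow>xs. cinner (f i) x)"
  by (induction xs) (auto simp: cinner_add_left)

lemma cinner_self: "cinner x x = complex_of_real ((norm x)\<^sup>2)"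
proof (rule complex_eqI)
  show "Re (cinner x x) = Re (complex_of_real ((norm x)\<^sup>2))"
    by (simp add: inner_eq_Re_cinner[symmetric] power2_norm_eq_inner)
  have "Im (cinner x x) = Im (cnj (cinner x x))" by (rule arg_cong[OF cinner_commute])
  then show "Im (cinner x x) = Im (complex_of_real ((norm x)\<^sup>2))" by simp
qed

lemma norm_scaleC: "norm (c *\<^sub>C (x::'a::complex_inner)) = cmod c * norm x"
proof -
  have "complex_of_real ((norm (c *\<^sub>C x))\<^sup>2) = complex_of_real ((cmod c * norm x)\<^sup>2)"
    unfolding cinner_self[symmetric] cinner_scaleC_left cinner_scaleC_right
    by (simp add: cinner_self power_mult_distrib complex_norm_square[symmetric] mult.assoc[symmetric]
        mult.commute)
  then have "(norm (c *\<^sub>C x))\<^sup>2 = (cmod c * norm x)\<^sup>2"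
    by (simp only: of_real_eq_iff)
  then show ?thesis by simp
qed

lemma norm_cinner_le: "cmod (cinner x y) \<le> norm x * norm y"
proof (cases "cinner x y = 0")
  case False
  define c where "c = cnj (cinner x y) / cmod (cinner x y)"
  have "cmod c = 1" using False by (simp add: c_def norm_divide)
  have "cmod (cinner x y) = Re (cinner x (c *\<^sub>C y))"
    using False by (simp add: c_def cinner_scaleC_right complex_norm_square[symmetric] mult.commute[of "cnj _"]
        power2_eq_square flip: of_real_mult of_real_divide)
  also have "\<dots> = inner x (c *\<^sub>C y)" by (simp add: inner_eq_Re_cinner)
  also have "\<dots> \<le> norm x * norm (c *\<^sub>C y)" by (rule norm_cauchy_schwarz)
  finally show ?thesis by (simp add: norm_scaleC \<open>cmod c = 1\<close>)
qed simp

lemma bounded_bilinear_cinner: "bounded_bilinear cinner"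
proof
  show "\<exists>K. \<forall>(a::'a) b. norm (cinner a b) \<le> norm a * norm b * K"
    by (rule exI[of _ 1]) (simp add: norm_cinner_le)
qed (auto simp: cinner_add_left cinner_add_right scaleR_scaleC cinner_scaleC_left
      cinner_scaleC_right scaleR_conv_of_real)

lemma bounded_bilinear_scaleC: "bounded_bilinear (scaleC :: complex \<Rightarrow> 'a \<Rightarrow> 'a::complex_inner)"
proof
  show "\<exists>K. \<forall>a (b::'a). norm (a *\<^sub>C b) \<le> norm a * norm b * K"
    by (rule exI[of _ 1]) (simp add: norm_scaleC)
qed (auto simp: scaleC_add_left scaleC_add_right scaleR_scaleC scaleC_scaleC scaleR_conv_of_real
    mult.commute)

lemmas tendsto_cinner = bounded_bilinear.tendsto[OF bounded_bilinear_cinner]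
lemmas tendsto_scaleC = bounded_bilinear.tendsto[OF bounded_bilinear_scaleC]

lemma cinner_ext: "(\<And>z. cinner z x = cinner z y) \<Longrightarrow> x = y"
  by (metis cinner_diff_right cinner_self eq_iff_diff_eq_0 norm_eq_zero of_real_eq_0_iff
      power_eq_0_iff)

subsection \<open>Finite orthonormal systems\<close>

definition orthonormal :: "'a::complex_inner set \<Rightarrow> bool"
  where "orthonormal F \<longleftrightarrow> (\<forall>g\<in>F. \<forall>h\<in>F. cinner g h = (if g = h then 1 else 0))"

lemma Gram_Schmidt:
  fixes S :: "'a::complex_inner set"
  assumes "finite S"
  shows "\<exists>F. finite F \<and> orthonormal F \<and> (\<forall>x\<in>S. x = (\<Sum>g\<in>F. cinner g x *\<^sub>C g))"
  using assms
proof induction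
  case empty
  show ?case by (rule exI[of _ "{}"]) (simp add: orthonormal_def)
next
  case (insert x S)
  then obtain F where F: "finite F" "orthonormal F" "\<And>y. y \<in> S \<Longrightarrow> y = (\<Sum>g\<in>F. cinner g y *\<^sub>C g)"
    by blast
  define r where "r = x - (\<Sum>g\<in>F. cinner g x *\<^sub>C g)"
  have Fr: "cinner g r = 0" if "g \<in> F" for g
  proof -
    have "(\<Sum>h\<in>F. cinner h x * cinner g h) = (\<Sum>h\<in>F. if g = h then cinner g x else 0)"
      using F(2) that by (intro sum.cong) (auto simp: orthonormal_def)
    then show ?thesis
      using F(1) that by (simp add: r_def cinner_diff_right cinner_sum_right cinner_scaleC_right)
  qed
  show ?case
  proof (cases "r = 0")
    case True
    then have "x = (\<Sum>g\<in>F. cinner g x *\<^sub>C g)" by (simp add: r_def)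
    with F show ?thesis by blast
  next
    case False
    define e where "e = complex_of_real (inverse (norm r)) *\<^sub>C r"
    have ee: "cinner e e = 1"
      using False by (simp add: e_def cinner_self norm_scaleC norm_inverse)
    have Fe: "cinner g e = 0" "cinner e g = 0" if "g \<in> F" for g
      using Fr[OF that] cinner_commute[of e g] by (simp_all add: e_def cinner_scaleC_right)
    have eF: "e \<notin> F" using Fe ee by force
    have on: "orthonormal (insert e F)"
      using F(2) Fe ee eF by (auto simp: orthonormal_def)
    have "y = (\<Sum>g\<in>insert e F. cinner g y *\<^sub>C g)" if "y \<in> insert x S" for y
    proof (cases "y = x")
      case True
      have "cinner e x = cinner e (r + (\<Sum>g\<in>F. cinner g x *\<^sub>C g))" by (simp add: r_def)
      also have "\<dots> = cinner e r"
        using Fe by (simp add: cinner_add_right cinner_sum_right cinner_scaleC_right)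
      also have "\<dots> = complex_of_real (norm r)"
        using False by (simp add: e_def cinner_scaleC_left cinner_self power2_eq_square)
      finally have "cinner e x *\<^sub>C e = r"
        using False by (simp add: e_def scaleC_scaleC scaleC_one)
      then show ?thesis using F(1) eF True by (simp add: r_def)
    next
      case False
      then have y: "y = (\<Sum>g\<in>F. cinner g y *\<^sub>C g)" using that F(3) by blast
      have "cinner e y = 0"
        by (subst y) (use Fe in \<open>simp add: cinner_sum_right cinner_scaleC_right\<close>)
      then have "(\<Sum>g\<in>insert e F. cinner g y *\<^sub>C g) = (\<Sum>g\<in>F. cinner g y *\<^sub>C g)"
        using F(1) eF by simp
      with y show ?thesis by (rule trans[OF _ sym])
    qed
    with F(1) on show ?thesis by blast
  qed
qed



section \<open>Bounded operators\<close>

definition bounded_clinear :: "('a::complex_inner \<Rightarrow> 'b::complex_inner) \<Rightarrow> bool"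
  where "bounded_clinear f \<longleftrightarrow> bounded_linear f \<and> (\<forall>c x. f (c *\<^sub>C x) = c *\<^sub>C f x)"

typedef (overloaded) ('a, 'b) cblinfun (\<open>(_ \<Rightarrow>\<^sub>C\<^sub>L /_)\<close> [22, 21] 21) =
  "{f :: 'a::complex_inner \<Rightarrow> 'b::complex_inner. bounded_clinear f}"
  morphisms cblinfun_apply Abs_cblinfun
  by (rule exI[of _ "\<lambda>_. 0"])
     (metis bounded_clinear_def bounded_linear_zero complex_vector.scale_zero_right mem_Collect_eq)

notation cblinfun_apply (infixl \<open>*\<^sub>V\<close> 70)

setup_lifting type_definition_cblinfun

lemma cblinfun_eqI: "(\<And>x. a *\<^sub>V x = b *\<^sub>V x) \<Longrightarrow> a = b"
  by transfer blast

lemma bounded_clinear_cblinfun_apply: "bounded_clinear ((*\<^sub>V) a)"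
  using cblinfun_apply[of a] by simp

lemma bounded_linear_cblinfun_apply: "bounded_linear ((*\<^sub>V) a)"
  using bounded_clinear_cblinfun_apply[of a] by (simp add: bounded_clinear_def)

lemma cblinfun_add: "a *\<^sub>V (x + y) = a *\<^sub>V x + a *\<^sub>V y"
  by (rule linear_add[OF bounded_linear.linear[OF bounded_linear_cblinfun_apply]])

lemma cblinfun_zero [simp]: "a *\<^sub>V 0 = 0"
  by (rule linear_0[OF bounded_linear.linear[OF bounded_linear_cblinfun_apply]])

lemma cblinfun_diff: "a *\<^sub>V (x - y) = a *\<^sub>V x - a *\<^sub>V y"
  by (rule linear_diff[OF bounded_linear.linear[OF bounded_linear_cblinfun_apply]])

lemma cblinfun_minus: "a *\<^sub>V (- x) = - (a *\<^sub>V x)"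
  by (rule linear_neg[OF bounded_linear.linear[OF bounded_linear_cblinfun_apply]])

lemma cblinfun_scaleC: "a *\<^sub>V (c *\<^sub>C x) = c *\<^sub>C (a *\<^sub>V x)"
  using bounded_clinear_cblinfun_apply[of a] by (simp add: bounded_clinear_def)

lemma cblinfun_sum: "a *\<^sub>V (\<Sum>i\<in>A. f i) = (\<Sum>i\<in>A. a *\<^sub>V f i)"
  by (rule linear_sum[OF bounded_linear.linear[OF bounded_linear_cblinfun_apply]])

lemma cblinfun_sum_list: "a *\<^sub>V (\<Sum>i\<leftarrow>xs. f i) = (\<Sum>i\<leftarrow>xs. a *\<^sub>V f i)"
  by (induction xs) (auto simp: cblinfun_add)

lemma cblinfun_bound: "\<exists>K\<ge>0. \<forall>x. norm (a *\<^sub>V x) \<le> K * norm x"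
  using bounded_linear.nonneg_bounded[OF bounded_linear_cblinfun_apply]
  by (metis mult.commute)

lemma bounded_clinearI:
  assumes "\<And>x y. f (x + y) = f x + f y" "\<And>c x. f (c *\<^sub>C x) = c *\<^sub>C f x"
    and "\<And>x. norm (f x) \<le> K * norm x"
  shows "bounded_clinear f"
  unfolding bounded_clinear_def
proof
  show "bounded_linear f"
    using assms by (intro bounded_linear_intro[of _ K]) (auto simp: scaleR_scaleC mult.commute)
qed (use assms in blast)

instantiation cblinfun :: (complex_inner, complex_inner) complex_vector
begin

lift_definition zero_cblinfun :: "'a \<Rightarrow>\<^sub>C\<^sub>L 'b" is "\<lambda>_. 0"
  by (simp add: bounded_clinear_def)

lift_definition plus_cblinfun :: "'a \<Rightarrow>\<^sub>C\<^sub>L 'b \<Rightarrow> 'a \<Rightarrow>\<^sub>C\<^sub>L 'b \<Rightarrow> 'a \<Rightarrow>\<^sub>C\<^sub>L 'b" is "\<lambda>f g x. f x + g x"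
  by (auto simp: bounded_clinear_def bounded_linear_add scaleC_add_right)

lift_definition uminus_cblinfun :: "'a \<Rightarrow>\<^sub>C\<^sub>L 'b \<Rightarrow> 'a \<Rightarrow>\<^sub>C\<^sub>L 'b" is "\<lambda>f x. - f x"
  by (auto simp: bounded_clinear_def bounded_linear_minus)

lift_definition minus_cblinfun :: "'a \<Rightarrow>\<^sub>C\<^sub>L 'b \<Rightarrow> 'a \<Rightarrow>\<^sub>C\<^sub>L 'b \<Rightarrow> 'a \<Rightarrow>\<^sub>C\<^sub>L 'b" is "\<lambda>f g x. f x - g x"
  by (auto simp: bounded_clinear_def bounded_linear_sub complex_vector.scale_right_diff_distrib)

lift_definition scaleR_cblinfun :: "real \<Rightarrow> 'a \<Rightarrow>\<^sub>C\<^sub>L 'b \<Rightarrow> 'a \<Rightarrow>\<^sub>C\<^sub>L 'b" is "\<lambda>r f x. r *\<^sub>R f x"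
  by (auto simp: bounded_clinear_def bounded_linear_const_scaleR)
     (simp add: scaleR_scaleC scaleC_scaleC mult.commute)

lift_definition scaleC_cblinfun :: "complex \<Rightarrow> 'a \<Rightarrow>\<^sub>C\<^sub>L 'b \<Rightarrow> 'a \<Rightarrow>\<^sub>C\<^sub>L 'b" is "\<lambda>c f x. c *\<^sub>C f x"
  by (auto simp: bounded_clinear_def scaleC_scaleC mult.commute
      intro!: bounded_linear_compose[OF bounded_bilinear.bounded_linear_right[OF bounded_bilinear_scaleC], unfolded o_def])

instance
  by standard
     (transfer; auto simp: fun_eq_iff algebra_simps scaleC_add_right scaleC_add_left scaleC_scaleC
       scaleC_one scaleR_scaleC scaleR_add_right scaleR_add_left)+

end

lift_definition id_cblinfun :: "'a::complex_inner \<Rightarrow>\<^sub>C\<^sub>L 'a" is "\<lambda>x. x"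
  by (simp add: bounded_clinear_def)

lift_definition compose_cblinfun ::
  "'b::complex_inner \<Rightarrow>\<^sub>C\<^sub>L 'c::complex_inner \<Rightarrow> 'a::complex_inner \<Rightarrow>\<^sub>C\<^sub>L 'b \<Rightarrow> 'a \<Rightarrow>\<^sub>C\<^sub>L 'c"
  (infixl \<open>o\<^sub>C\<^sub>L\<close> 67) is "\<lambda>f g x. f (g x)"
  by (auto simp: bounded_clinear_def intro: bounded_linear_compose)

lemma compose_cblinfun_apply [simp]: "(a o\<^sub>C\<^sub>L b) *\<^sub>V x = a *\<^sub>V (b *\<^sub>V x)"
  by transfer simp

lemma id_cblinfun_apply [simp]: "id_cblinfun *\<^sub>V x = x"
  by transfer simp

lemma Riesz_real:
  fixes f :: "'a::{real_inner, complete_space} \<Rightarrow> real"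
  assumes "bounded_linear f"
  shows "\<exists>y. \<forall>x. f x = inner y x"
proof -
  interpret bounded_linear f by fact
  define J where "J = (\<lambda>x. inner x x - 2 * f x)"
  define m where "m = Inf (range J)"
  obtain K where K: "\<And>x. norm (f x) \<le> norm x * K" using bounded by blast
  have "J x \<ge> - K\<^sup>2" for x
  proof -
    have "f x \<le> norm x * K" using K[of x] by simp
    moreover have "0 \<le> (norm x - K)\<^sup>2" by simp
    ultimately show ?thesis
      by (simp add: J_def power2_norm_eq_inner[symmetric] power2_diff)
  qed
  then have bdd: "bdd_below (range J)" by (rule bdd_belowI2)
  have mJ: "m \<le> J x" for x unfolding m_def by (rule cINF_lower[OF bdd]) simp
  have "\<exists>x. J x < m + inverse (real (Suc n))" for n
  proof -
    have "Inf (range J) < m + inverse (real (Suc n))" by (simp add: m_def)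
    then show ?thesis using cINF_less_iff[OF _ bdd] by auto
  qed
  then obtain X where X: "\<And>n. J (X n) < m + inverse (real (Suc n))" by metis
  have par: "(norm (x - y))\<^sup>2 \<le> 2 * (J x - m) + 2 * (J y - m)" for x y
  proof -
    have "(norm (x - y))\<^sup>2 = 2 * J x + 2 * J y - 4 * J ((1/2) *\<^sub>R (x + y))"
      by (simp add: J_def power2_norm_eq_inner inner_diff_left inner_diff_right inner_add_left
          inner_add_right scaleR add inner_commute algebra_simps)
    then show ?thesis using mJ[of "(1/2) *\<^sub>R (x + y)"] by simp
  qed
  have "Cauchy X"
  proof (rule metric_CauchyI)
    fix e :: real assume "e > 0"
    then obtain N where N: "inverse (real (Suc N)) < e\<^sup>2 / 4"
      using reals_Archimedean[of "e\<^sup>2/4"] by auto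
    have small: "J (X k) - m < e\<^sup>2 / 4" if "k \<ge> N" for k
    proof -
      have "inverse (real (Suc k)) \<le> inverse (real (Suc N))" using that by simp
      then show ?thesis using X[of k] N by linarith
    qed
    have "(norm (X k - X l))\<^sup>2 < e\<^sup>2" if "k \<ge> N" "l \<ge> N" for k l
    proof -
      have "2 * (J (X k) - m) + 2 * (J (X l) - m) < 2 * (e\<^sup>2 / 4) + 2 * (e\<^sup>2 / 4)"
        using small[OF that(1)] small[OF that(2)] by (intro add_strict_mono mult_strict_left_mono) auto
      also have "\<dots> = e\<^sup>2" by simp
      finally show ?thesis using par[of "X k" "X l"] by (rule le_less_trans[rotated])
    qed
    then have "dist (X k) (X l) < e" if "k \<ge> N" "l \<ge> N" for k l
      using that \<open>e > 0\<close> by (simp add: dist_norm power2_less_imp_less)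
    then show "\<exists>M. \<forall>k\<ge>M. \<forall>l\<ge>M. dist (X k) (X l) < e" by blast
  qed
  then obtain y where y: "X \<longlonglongrightarrow> y" using Cauchy_convergent convergent_def by blast
  have "(\<lambda>n. J (X n)) \<longlonglongrightarrow> J y"
    unfolding J_def by (intro tendsto_intros tendsto y)
  moreover have "(\<lambda>n. m + inverse (real (Suc n))) \<longlonglongrightarrow> m + 0"
    by (intro tendsto_intros LIMSEQ_inverse_real_of_nat)
  ultimately have "J y \<le> m + 0"
    by (rule LIMSEQ_le) (use X in \<open>auto intro!: exI[of _ 0] less_imp_le\<close>)
  then have Jy: "J y \<le> J z" for z using mJ[of z] by simp
  have "f x = inner y x" for x
  proof (rule ccontr)
    assume ne: "f x \<noteq> inner y x"
    define d where "d = f x - inner y x"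
    have "x \<noteq> 0" using ne zero by auto
    define t where "t = d / inner x x"
    have pos: "inner x x > 0" using \<open>x \<noteq> 0\<close> by simp
    have "J (y + t *\<^sub>R x) = J y - 2 * t * d + t\<^sup>2 * inner x x"
      by (simp add: J_def d_def inner_add_left inner_add_right scaleR add inner_commute
          power2_eq_square algebra_simps)
    also have "\<dots> = J y - d\<^sup>2 / inner x x"
      using pos by (simp add: t_def power2_eq_square field_simps)
    finally have "d\<^sup>2 / inner x x \<le> 0" using Jy[of "y + t *\<^sub>R x"] by simp
    then show False using pos ne by (simp add: d_def divide_le_0_iff)
  qed
  then show ?thesis by blast
qed

definition adj :: "'a::chilbert_space \<Rightarrow>\<^sub>C\<^sub>L 'b::chilbert_space \<Rightarrow> 'b \<Rightarrow>\<^sub>C\<^sub>L 'a"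
  where "adj a = (THE b. \<forall>x y. cinner (b *\<^sub>V y) x = cinner y (a *\<^sub>V x))"

lemma adj_ex1:
  fixes a :: "'a::chilbert_space \<Rightarrow>\<^sub>C\<^sub>L 'b::chilbert_space"
  shows "\<exists>!b. \<forall>x y. cinner (b *\<^sub>V y) x = cinner y (a *\<^sub>V x)"
proof -
  have "\<exists>z. \<forall>x. cinner z x = cinner y (a *\<^sub>V x)" for y
  proof -
    have "bounded_linear (\<lambda>x. inner y (a *\<^sub>V x))"
      by (intro bounded_linear_compose[OF bounded_linear_inner_right, unfolded o_def]
          bounded_linear_cblinfun_apply)
    then obtain z where z: "\<And>x. inner y (a *\<^sub>V x) = inner z x"
      using Riesz_real[of "\<lambda>x. inner y (a *\<^sub>V x)"] by blast
    have "cinner z x = cinner y (a *\<^sub>V x)" for x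
    proof (rule complex_eqI)
      show "Re (cinner z x) = Re (cinner y (a *\<^sub>V x))"
        using z[of x] by (simp add: inner_eq_Re_cinner)
      show "Im (cinner z x) = Im (cinner y (a *\<^sub>V x))"
        using z[of "(- \<i>) *\<^sub>C x"]
        by (simp add: inner_eq_Re_cinner cinner_scaleC_right cblinfun_scaleC cblinfun_minus cinner_minus_right)
    qed
    then show ?thesis by blast
  qed
  then obtain b where b: "\<And>y x. cinner (b y) x = cinner y (a *\<^sub>V x)" by metis
  obtain K where K: "K \<ge> 0" "\<And>x. norm (a *\<^sub>V x) \<le> K * norm x" using cblinfun_bound by blast
  have ext: "u = v" if "\<And>x. cinner u x = cinner v x" for u v :: 'a
    by (rule cinner_ext) (metis cinner_commute that)
  have "bounded_clinear b"
  proof (rule bounded_clinearI)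
    show "b (x + y) = b x + b y" for x y
      by (rule ext) (simp add: b cinner_add_left)
    show "b (c *\<^sub>C x) = c *\<^sub>C b x" for c x
      by (rule ext) (simp add: b cinner_scaleC_left)
    show "norm (b y) \<le> K * norm y" for y
    proof (cases "b y = 0")
      case False
      have "(norm (b y))\<^sup>2 = cmod (cinner (b y) (b y))" by (simp add: cinner_self norm_power)
      also have "\<dots> \<le> norm y * norm (a *\<^sub>V b y)" unfolding b by (rule norm_cinner_le)
      also have "\<dots> \<le> norm y * (K * norm (b y))" by (intro mult_left_mono K) simp
      finally show ?thesis using False by (simp add: power2_eq_square mult.commute)
    qed (use K in simp)
  qed
  then have "cblinfun_apply (Abs_cblinfun b) = b" by (simp add: Abs_cblinfun_inverse)
  then have ex: "\<exists>b. \<forall>x y. cinner (b *\<^sub>V y) x = cinner y (a *\<^sub>V x)" using b by metis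
  then show ?thesis by (rule ex_ex1I) (metis cblinfun_eqI ext)
qed

lemma cinner_adj: "cinner (adj a *\<^sub>V y) x = cinner y (a *\<^sub>V x)"
  using theI'[OF adj_ex1[of a]] unfolding adj_def by blast

definition unitary :: "'a::chilbert_space \<Rightarrow>\<^sub>C\<^sub>L 'b::chilbert_space \<Rightarrow> bool"
  where "unitary u \<longleftrightarrow> adj u o\<^sub>C\<^sub>L u = id_cblinfun \<and> u o\<^sub>C\<^sub>L adj u = id_cblinfun"

lemma cblinfun_eq_total:
  assumes total: "closure (cspan E) = UNIV" and eq: "\<And>x. x \<in> E \<Longrightarrow> a *\<^sub>V x = b *\<^sub>V x"
  shows "a = b"
proof (rule cblinfun_eqI)
  fix x
  have "continuous_on UNIV (\<lambda>x. a *\<^sub>V x)" "continuous_on UNIV (\<lambda>x. b *\<^sub>V x)"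
    using linear_continuous_on[OF bounded_linear_cblinfun_apply] by blast+
  then have "closed {x. a *\<^sub>V x = b *\<^sub>V x}" by (rule closed_Collect_eq)
  moreover have "cspan E \<subseteq> {x. a *\<^sub>V x = b *\<^sub>V x}"
  proof
    fix x assume "x \<in> cspan E"
    then show "x \<in> {x. a *\<^sub>V x = b *\<^sub>V x}"
      by (induction rule: complex_vector.span_induct_alt)
         (auto simp: cblinfun_add cblinfun_scaleC eq)
  qed
  ultimately have "closure (cspan E) \<subseteq> {x. a *\<^sub>V x = b *\<^sub>V x}" by (simp add: closure_minimal)
  then show "a *\<^sub>V x = b *\<^sub>V x" using total by blast
qed

lemma cspan_range_sum_list:
  assumes "x \<in> cspan (range e)"
  shows "\<exists>ts. x = (\<Sum>(c, i)\<leftarrow>ts. c *\<^sub>C e i)"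
  using assms
proof (induction rule: complex_vector.span_induct_alt)
  case base
  show ?case by (rule exI[of _ "[]"]) simp
next
  case (step c x y)
  then obtain i ts where "x = e i" "y = (\<Sum>(c, i)\<leftarrow>ts. c *\<^sub>C e i)" by blast
  then show ?case by (intro exI[of _ "(c, i) # ts"]) simp
qed

lemma cblinfun_extension:
  fixes e :: "'i \<Rightarrow> 'v::complex_inner" and f :: "'i \<Rightarrow> 'w::chilbert_space"
  assumes total: "closure (cspan (range e)) = UNIV"
    and bound: "\<And>ts. norm (\<Sum>(c, i)\<leftarrow>ts. c *\<^sub>C f i) \<le> M * norm (\<Sum>(c, i)\<leftarrow>ts. c *\<^sub>C e i)"
  shows "\<exists>!T. \<forall>i. T *\<^sub>V e i = f i"
proof -
  define S where "S = (\<lambda>ts. \<Sum>(c, i)\<leftarrow>ts. c *\<^sub>C e i)"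
  define P where "P = (\<lambda>ts. \<Sum>(c, i)\<leftarrow>ts. c *\<^sub>C f i)"
  define sc where "sc = (\<lambda>d ts. map (\<lambda>(c::complex, i::'i). (d * c, i)) ts)"
  have app: "S (ts @ us) = S ts + S us" "P (ts @ us) = P ts + P us" for ts us
    by (simp_all add: S_def P_def)
  have sc: "S (sc d ts) = d *\<^sub>C S ts" "P (sc d ts) = d *\<^sub>C P ts" for d ts
    by (induction ts) (auto simp: S_def P_def sc_def scaleC_add_right scaleC_scaleC)
  have bd: "norm (P ts) \<le> M * norm (S ts)" for ts
    using bound[of ts] by (simp add: S_def P_def)
  have bd': "norm (P ts - P us) \<le> M * norm (S ts - S us)" for ts us
    using bd[of "ts @ sc (-1) us"] by (simp add: app sc scaleC_one)
  define Q where "Q = (\<lambda>x y. \<exists>X. (\<lambda>n. S (X n)) \<longlonglongrightarrow> x \<and> (\<lambda>n. P (X n)) \<longlonglongrightarrow> y)"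
  have Qex: "\<exists>y. Q x y" for x
  proof -
    have "x \<in> closure (cspan (range e))" using total by simp
    then obtain s where s: "\<And>n. s n \<in> cspan (range e)" "s \<longlonglongrightarrow> x"
      unfolding closure_sequential by blast
    then have "\<forall>n. \<exists>ts. s n = S ts" unfolding S_def using cspan_range_sum_list by blast
    then obtain X where X: "\<And>n. s n = S (X n)" by metis
    have "Cauchy (\<lambda>n. P (X n))"
    proof (rule metric_CauchyI)
      fix d :: real assume "d > 0"
      then have "d / (\<bar>M\<bar> + 1) > 0" by simp
      then obtain N where N: "\<And>m n. m \<ge> N \<Longrightarrow> n \<ge> N \<Longrightarrow> dist (s m) (s n) < d / (\<bar>M\<bar> + 1)"
        using LIMSEQ_imp_Cauchy[OF s(2)] metric_CauchyD by blast
      have "dist (P (X m)) (P (X n)) < d" if "m \<ge> N" "n \<ge> N" for m n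
      proof -
        have "dist (P (X m)) (P (X n)) \<le> M * dist (s m) (s n)"
          using bd' by (simp add: dist_norm X)
        also have "\<dots> \<le> (\<bar>M\<bar> + 1) * dist (s m) (s n)" by (intro mult_right_mono) auto
        also have "\<dots> < d" using N[OF that] by (simp add: field_simps)
        finally show ?thesis .
      qed
      then show "\<exists>N. \<forall>m\<ge>N. \<forall>n\<ge>N. dist (P (X m)) (P (X n)) < d" by blast
    qed
    then obtain y where "(\<lambda>n. P (X n)) \<longlonglongrightarrow> y"
      using Cauchy_convergent convergent_def by blast
    moreover have "(\<lambda>n. S (X n)) \<longlonglongrightarrow> x" using s(2) by (simp add: X[symmetric])
    ultimately show ?thesis unfolding Q_def by blast
  qed
  have Qadd: "Q (x + x') (y + y')" if Q: "Q x y" "Q x' y'" for x x' y y'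
  proof -
    obtain X where X: "(\<lambda>n. S (X n)) \<longlonglongrightarrow> x \<and> (\<lambda>n. P (X n)) \<longlonglongrightarrow> y"
      using Q(1) unfolding Q_def ..
    obtain X' where "(\<lambda>n. S (X' n)) \<longlonglongrightarrow> x' \<and> (\<lambda>n. P (X' n)) \<longlonglongrightarrow> y'"
      using Q(2) unfolding Q_def ..
    with X show ?thesis
      unfolding Q_def by (intro exI[of _ "\<lambda>n. X n @ X' n"]) (auto simp: app intro!: tendsto_intros)
  qed
  have Qsc: "Q (c *\<^sub>C x) (c *\<^sub>C y)" if Q: "Q x y" for c x y
  proof -
    obtain X where "(\<lambda>n. S (X n)) \<longlonglongrightarrow> x \<and> (\<lambda>n. P (X n)) \<longlonglongrightarrow> y"
      using Q unfolding Q_def ..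
    then show ?thesis
      unfolding Q_def by (intro exI[of _ "\<lambda>n. sc c (X n)"]) (auto simp: sc intro!: tendsto_scaleC)
  qed
  have Qbd: "norm y \<le> M * norm x" if Q: "Q x y" for x y
  proof -
    obtain X where "(\<lambda>n. S (X n)) \<longlonglongrightarrow> x \<and> (\<lambda>n. P (X n)) \<longlonglongrightarrow> y"
      using Q unfolding Q_def ..
    then have X: "(\<lambda>n. S (X n)) \<longlonglongrightarrow> x" "(\<lambda>n. P (X n)) \<longlonglongrightarrow> y" by simp_all
    have "(\<lambda>n. norm (P (X n))) \<longlonglongrightarrow> norm y" by (intro tendsto_intros X)
    moreover have "(\<lambda>n. M * norm (S (X n))) \<longlonglongrightarrow> M * norm x" by (intro tendsto_intros X)
    ultimately show ?thesis by (rule LIMSEQ_le) (use bd in auto)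
  qed
  have Quniq: "y = z" if "Q x y" "Q x z" for x y z
    using Qbd[OF Qadd[OF that(1) Qsc[OF that(2), of "-1"]]]
    by (simp add: complex_vector.scale_minus_left scaleC_one)
  define T where "T = (\<lambda>x. SOME y. Q x y)"
  have QT: "Q x (T x)" for x unfolding T_def by (rule someI_ex[OF Qex])
  have "bounded_clinear T"
  proof (rule bounded_clinearI)
    show "T (x + y) = T x + T y" for x y by (rule Quniq[OF QT Qadd[OF QT QT]])
    show "T (c *\<^sub>C x) = c *\<^sub>C T x" for c x by (rule Quniq[OF QT Qsc[OF QT]])
    show "norm (T x) \<le> M * norm x" for x by (rule Qbd[OF QT])
  qed
  then have T: "Abs_cblinfun T *\<^sub>V x = T x" for x by (simp add: Abs_cblinfun_inverse)
  have "Q (e i) (f i)" for i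
    unfolding Q_def by (intro exI[of _ "\<lambda>_. [(1, i)]"]) (simp add: S_def P_def scaleC_one)
  then have "Abs_cblinfun T *\<^sub>V e i = f i" for i unfolding T by (rule Quniq[OF QT])
  then have "\<exists>T. \<forall>i. T *\<^sub>V e i = f i" by blast
  then show ?thesis
  proof (rule ex_ex1I)
    fix T T' assume *: "\<forall>i. T *\<^sub>V e i = f i" "\<forall>i. T' *\<^sub>V e i = f i"
    show "T = T'" by (rule cblinfun_eq_total[OF total]) (use * in auto)
  qed
qed



section \<open>The completion of a complex inner product space\<close>

definition completion_rel :: "(nat \<Rightarrow> 'a::complex_inner) \<Rightarrow> (nat \<Rightarrow> 'a) \<Rightarrow> bool"
  where "completion_rel X Y \<longleftrightarrow> Cauchy X \<and> Cauchy Y \<and> (\<lambda>n. X n - Y n) \<longlonglongrightarrow> 0"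

lemma completion_rel_self [simp]: "completion_rel X X \<longleftrightarrow> Cauchy X"
  by (simp add: completion_rel_def)

quotient_type (overloaded) 'a completion = "nat \<Rightarrow> 'a::complex_inner" / partial: completion_rel
proof (rule part_equivpI)
  show "\<exists>X :: nat \<Rightarrow> 'a. completion_rel X X"
    by (rule exI[of _ "\<lambda>_. 0"]) (simp add: Cauchy_def)
  show "symp (completion_rel :: (nat \<Rightarrow> 'a) \<Rightarrow> _)"
  proof (rule sympI)
    fix X Y :: "nat \<Rightarrow> 'a" assume "completion_rel X Y"
    then show "completion_rel Y X"
      unfolding completion_rel_def using tendsto_minus[of "\<lambda>n. X n - Y n" 0] by simp
  qed
  show "transp (completion_rel :: (nat \<Rightarrow> 'a) \<Rightarrow> _)"
  proof (rule transpI)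
    fix X Y Z :: "nat \<Rightarrow> 'a" assume "completion_rel X Y" "completion_rel Y Z"
    then show "completion_rel X Z"
      unfolding completion_rel_def using tendsto_add[of "\<lambda>n. X n - Y n" 0 _ "\<lambda>n. Y n - Z n" 0] by simp
  qed
qed

lemma Cauchy_bound:
  fixes X :: "nat \<Rightarrow> 'a::complex_inner"
  assumes "Cauchy X"
  shows "\<exists>K>0. \<forall>n. norm (X n) \<le> K"
  using Cauchy_Bseq[OF assms] by (auto simp: Bseq_def)

lemma Cauchy_scaleC: "Cauchy X \<Longrightarrow> Cauchy (\<lambda>n. c *\<^sub>C X n)" for X :: "nat \<Rightarrow> 'a::complex_inner"
  by (rule bounded_linear.Cauchy[OF bounded_bilinear.bounded_linear_right[OF bounded_bilinear_scaleC]])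

lemma Cauchy_uminus: "Cauchy X \<Longrightarrow> Cauchy (\<lambda>n. - X n)" for X :: "nat \<Rightarrow> 'a::complex_inner"
  by (rule bounded_linear.Cauchy[OF bounded_linear_minus[OF bounded_linear_ident]])

lemma Cauchy_plus: "Cauchy X \<Longrightarrow> Cauchy Y \<Longrightarrow> Cauchy (\<lambda>n. X n + Y n)"
  for X Y :: "nat \<Rightarrow> 'a::complex_inner"
proof (rule metric_CauchyI)
  fix e :: real assume *: "Cauchy X" "Cauchy Y" "e > 0"
  obtain M where M: "\<And>m n. m \<ge> M \<Longrightarrow> n \<ge> M \<Longrightarrow> dist (X m) (X n) < e / 2"
    using metric_CauchyD[OF *(1), of "e/2"] *(3) by auto
  obtain N where N: "\<And>m n. m \<ge> N \<Longrightarrow> n \<ge> N \<Longrightarrow> dist (Y m) (Y n) < e / 2"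
    using metric_CauchyD[OF *(2), of "e/2"] *(3) by auto
  have "dist (X m + Y m) (X n + Y n) < e" if "m \<ge> max M N" "n \<ge> max M N" for m n
    using M[of m n] N[of m n] that dist_triangle_add[of "X m" "Y m" "X n" "Y n"] by simp
  then show "\<exists>K. \<forall>m\<ge>K. \<forall>n\<ge>K. dist (X m + Y m) (X n + Y n) < e" by blast
qed

lemma Cauchy_cinner:
  fixes X Y :: "nat \<Rightarrow> 'a::complex_inner"
  assumes "Cauchy X" "Cauchy Y"
  shows "convergent (\<lambda>n. cinner (X n) (Y n))"
proof -
  obtain K where K: "K > 0" "\<And>n. norm (X n) \<le> K" using Cauchy_bound[OF assms(1)] by blast
  obtain L where L: "L > 0" "\<And>n. norm (Y n) \<le> L" using Cauchy_bound[OF assms(2)] by blast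
  have "Cauchy (\<lambda>n. cinner (X n) (Y n))"
  proof (rule metric_CauchyI)
    fix e :: real assume "e > 0"
    have "e / (2 * L) > 0" "e / (2 * K) > 0" using \<open>e > 0\<close> K(1) L(1) by simp_all
    then obtain M N where M: "\<And>m n. m \<ge> M \<Longrightarrow> n \<ge> M \<Longrightarrow> dist (X m) (X n) < e / (2 * L)"
      and N: "\<And>m n. m \<ge> N \<Longrightarrow> n \<ge> N \<Longrightarrow> dist (Y m) (Y n) < e / (2 * K)"
      using metric_CauchyD[OF assms(1)] metric_CauchyD[OF assms(2)] by metis
    have "dist (cinner (X m) (Y m)) (cinner (X n) (Y n)) < e"
      if "m \<ge> max M N" "n \<ge> max M N" for m n
    proof -
      have "cinner (X m) (Y m) - cinner (X n) (Y n) = cinner (X m - X n) (Y m) + cinner (X n) (Y m - Y n)"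
        by (simp add: cinner_diff_left cinner_diff_right)
      then have "dist (cinner (X m) (Y m)) (cinner (X n) (Y n)) \<le>
          cmod (cinner (X m - X n) (Y m)) + cmod (cinner (X n) (Y m - Y n))"
        by (simp add: dist_norm norm_triangle_ineq)
      also have "\<dots> \<le> norm (X m - X n) * norm (Y m) + norm (X n) * norm (Y m - Y n)"
        by (intro add_mono norm_cinner_le)
      also have "\<dots> \<le> norm (X m - X n) * L + K * norm (Y m - Y n)"
        by (intro add_mono mult_mono K L) (use K in auto)
      also have "\<dots> < e / (2 * L) * L + K * (e / (2 * K))"
        using M[of m n] N[of m n] that K(1) L(1)
        by (intro add_strict_mono mult_strict_left_mono mult_strict_right_mono) (auto simp: dist_norm)
      also have "\<dots> = e" using K(1) L(1) by simp
      finally show ?thesis .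
    qed
    then show "\<exists>K. \<forall>m\<ge>K. \<forall>n\<ge>K. dist (cinner (X m) (Y m)) (cinner (X n) (Y n)) < e" by blast
  qed
  then show ?thesis by (rule Cauchy_convergent)
qed

instantiation completion :: (complex_inner) complex_inner
begin

lift_definition zero_completion :: "'a completion" is "\<lambda>_. 0"
  by (simp add: Cauchy_def)

lift_definition plus_completion :: "'a completion \<Rightarrow> 'a completion \<Rightarrow> 'a completion"
  is "\<lambda>X Y n. X n + Y n"
  unfolding completion_rel_def
  by (auto intro: Cauchy_plus) (drule (1) tendsto_add, simp add: algebra_simps)

lift_definition scaleC_completion :: "complex \<Rightarrow> 'a completion \<Rightarrow> 'a completion"
  is "\<lambda>c X n. c *\<^sub>C X n"
  unfolding completion_rel_def
  using tendsto_scaleC[OF tendsto_const]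
  by (fastforce intro: Cauchy_scaleC simp: complex_vector.scale_right_diff_distrib[symmetric])

lift_definition uminus_completion :: "'a completion \<Rightarrow> 'a completion" is "\<lambda>X n. - X n"
  unfolding completion_rel_def
  by (auto intro: Cauchy_uminus) (drule tendsto_minus, simp)

definition minus_completion :: "'a completion \<Rightarrow> 'a completion \<Rightarrow> 'a completion"
  where "minus_completion x y = x + (- y)"

definition scaleR_completion :: "real \<Rightarrow> 'a completion \<Rightarrow> 'a completion"
  where "scaleR_completion r x = complex_of_real r *\<^sub>C x"

lift_definition cinner_completion :: "'a completion \<Rightarrow> 'a completion \<Rightarrow> complex"
  is "\<lambda>X Y. lim (\<lambda>n. cinner (X n) (Y n))"
proof -
  fix X X' Y Y' :: "nat \<Rightarrow> 'a"
  assume X: "completion_rel X X'" and Y: "completion_rel Y Y'"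
  have C: "Cauchy X" "Cauchy X'" "Cauchy Y" "Cauchy Y'"
    using X Y by (simp_all add: completion_rel_def)
  have z: "(\<lambda>n. X n - X' n) \<longlonglongrightarrow> 0" "(\<lambda>n. Y n - Y' n) \<longlonglongrightarrow> 0"
    using X Y by (simp_all add: completion_rel_def)
  obtain K where K: "\<And>n. norm (X' n) \<le> K" using Cauchy_bound[OF C(2)] by blast
  obtain L where L: "\<And>n. norm (Y n) \<le> L" using Cauchy_bound[OF C(3)] by blast
  have "(\<lambda>n. cinner (X n) (Y n) - cinner (X' n) (Y' n)) \<longlonglongrightarrow> 0"
  proof (rule Lim_null_comparison)
    show "\<forall>\<^sub>F n in sequentially. norm (cinner (X n) (Y n) - cinner (X' n) (Y' n))
        \<le> norm (X n - X' n) * L + K * norm (Y n - Y' n)"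
    proof (rule always_eventually, rule allI)
      fix n
      have "cinner (X n) (Y n) - cinner (X' n) (Y' n) = cinner (X n - X' n) (Y n) + cinner (X' n) (Y n - Y' n)"
        by (simp add: cinner_diff_left cinner_diff_right)
      then have "norm (cinner (X n) (Y n) - cinner (X' n) (Y' n)) \<le>
          cmod (cinner (X n - X' n) (Y n)) + cmod (cinner (X' n) (Y n - Y' n))"
        by (simp add: norm_triangle_ineq)
      also have "\<dots> \<le> norm (X n - X' n) * norm (Y n) + norm (X' n) * norm (Y n - Y' n)"
        by (intro add_mono norm_cinner_le)
      also have "\<dots> \<le> norm (X n - X' n) * L + K * norm (Y n - Y' n)"
        by (intro add_mono mult_left_mono mult_right_mono K L) auto
      finally show "norm (cinner (X n) (Y n) - cinner (X' n) (Y' n))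
          \<le> norm (X n - X' n) * L + K * norm (Y n - Y' n)" .
    qed
    have "(\<lambda>n. norm (X n - X' n) * L + K * norm (Y n - Y' n)) \<longlonglongrightarrow> norm (0::'a) * L + K * norm (0::'a)"
      by (intro tendsto_intros z)
    then show "(\<lambda>n. norm (X n - X' n) * L + K * norm (Y n - Y' n)) \<longlonglongrightarrow> 0" by simp
  qed
  moreover have "(\<lambda>n. cinner (X' n) (Y' n)) \<longlonglongrightarrow> lim (\<lambda>n. cinner (X' n) (Y' n))"
    using Cauchy_cinner[OF C(2,4)] convergent_LIMSEQ_iff by blast
  ultimately have "(\<lambda>n. cinner (X n) (Y n)) \<longlonglongrightarrow> lim (\<lambda>n. cinner (X' n) (Y' n))"
    using tendsto_add[of "\<lambda>n. cinner (X n) (Y n) - cinner (X' n) (Y' n)" 0] by fastforce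
  then show "lim (\<lambda>n. cinner (X n) (Y n)) = lim (\<lambda>n. cinner (X' n) (Y' n))" by (rule limI)
qed

definition inner_completion :: "'a completion \<Rightarrow> 'a completion \<Rightarrow> real"
  where "inner_completion x y = Re (cinner x y)"

definition norm_completion :: "'a completion \<Rightarrow> real"
  where "norm_completion x = sqrt (inner x x)"

definition dist_completion :: "'a completion \<Rightarrow> 'a completion \<Rightarrow> real"
  where "dist_completion x y = norm (x - y)"

definition sgn_completion :: "'a completion \<Rightarrow> 'a completion"
  where "sgn_completion x = inverse (norm x) *\<^sub>R x"

definition uniformity_completion :: "('a completion \<times> 'a completion) filter"
  where "uniformity_completion = (INF e\<in>{0<..}. principal {(x, y). dist x y < e})"

definition open_completion :: "'a completion set \<Rightarrow> bool"
  where "open_completion U \<longleftrightarrow> (\<forall>x\<in>U. \<forall>\<^sub>F (x', y) in uniformity. x' = x \<longrightarrow> y \<in> U)"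

lemma completion_cases:
  obtains X :: "nat \<Rightarrow> 'a" where "Cauchy X" "x = abs_completion X"
proof
  show "Cauchy (rep_completion x)"
    using Quotient_rep_reflp[OF Quotient_completion, of x] by simp
  show "x = abs_completion (rep_completion x)"
    by (rule Quotient_abs_rep[OF Quotient_completion, symmetric])
qed

lemma plus_abs: "Cauchy X \<Longrightarrow> Cauchy Y \<Longrightarrow>
    abs_completion X + abs_completion Y = abs_completion (\<lambda>n. X n + Y n :: 'a)"
  by (rule plus_completion.abs_eq) simp_all

lemma uminus_abs: "Cauchy X \<Longrightarrow> - abs_completion X = abs_completion (\<lambda>n. - X n :: 'a)"
  by (rule uminus_completion.abs_eq) simp_all

lemma scaleC_abs: "Cauchy X \<Longrightarrow> c *\<^sub>C abs_completion X = abs_completion (\<lambda>n. c *\<^sub>C X n :: 'a)"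
  by (rule scaleC_completion.abs_eq) simp_all

lemma cinner_abs:
  assumes "Cauchy X" "Cauchy Y"
  shows "(\<lambda>n. cinner (X n :: 'a) (Y n)) \<longlonglongrightarrow> cinner (abs_completion X) (abs_completion Y)"
  using assms Cauchy_cinner[OF assms] by (simp add: cinner_completion.abs_eq convergent_LIMSEQ_iff)

instance
proof
  fix x y z :: "'a completion" and a b :: complex and r s :: real
  obtain X where X: "Cauchy X" "x = abs_completion X" by (rule completion_cases)
  obtain Y where Y: "Cauchy Y" "y = abs_completion Y" by (rule completion_cases)
  obtain Z where Z: "Cauchy Z" "z = abs_completion Z" by (rule completion_cases)
  note abs = plus_abs uminus_abs scaleC_abs zero_completion_def Cauchy_plus Cauchy_uminus Cauchy_scaleC
  have C0: "Cauchy (\<lambda>_. 0::'a)" by (simp add: Cauchy_def)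
  show "x + y + z = x + (y + z)" using X Y Z by (simp add: abs add.assoc)
  show "x + y = y + x" using X Y by (simp add: abs add.commute)
  show "0 + x = x" using X C0 by (simp add: abs)
  show "- x + x = 0" using X by (simp add: abs)
  show "x - y = x + - y" by (rule minus_completion_def)
  show scR: "r *\<^sub>R x = complex_of_real r *\<^sub>C x" for r and x :: "'a completion"
    by (rule scaleR_completion_def)
  show A1: "a *\<^sub>C (x + y) = a *\<^sub>C x + a *\<^sub>C y" for a
    using X Y by (simp add: abs scaleC_add_right)
  show A2: "(a + b) *\<^sub>C x = a *\<^sub>C x + b *\<^sub>C x" for a b
    using X by (simp add: abs scaleC_add_left)
  show A3: "a *\<^sub>C (b *\<^sub>C x) = (a * b) *\<^sub>C x" for a b
    using X by (simp add: abs scaleC_scaleC)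
  show A4: "1 *\<^sub>C x = x"
    using X by (simp add: abs scaleC_one)
  show "r *\<^sub>R (x + y) = r *\<^sub>R x + r *\<^sub>R y" by (simp add: scR A1)
  show "(r + s) *\<^sub>R x = r *\<^sub>R x + s *\<^sub>R x" by (simp add: scR A2)
  show "r *\<^sub>R s *\<^sub>R x = (r * s) *\<^sub>R x" by (simp add: scR A3)
  show "1 *\<^sub>R x = x" by (simp add: scR A4)
  show "dist x y = norm (x - y)" by (rule dist_completion_def)
  show "sgn x = inverse (norm x) *\<^sub>R x" by (rule sgn_completion_def)
  show "uniformity = (INF e\<in>{0<..}. principal {(x, y). dist (x::'a completion) y < e})"
    by (rule uniformity_completion_def)
  show "open U \<longleftrightarrow> (\<forall>x\<in>U. \<forall>\<^sub>F (x', y) in uniformity. x' = x \<longrightarrow> y \<in> U)" for U :: "'a completion set"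
    by (rule open_completion_def)
  show "norm x = sqrt (inner x x)" by (rule norm_completion_def)
  show inn: "inner x y = Re (cinner x y)" for x y :: "'a completion" by (rule inner_completion_def)
  show comm: "cinner x y = cnj (cinner y x)"
  proof -
    have "(\<lambda>n. cnj (cinner (Y n) (X n))) \<longlonglongrightarrow> cnj (cinner y x)"
      unfolding X(2) Y(2) by (intro tendsto_cnj cinner_abs X Y)
    then have "(\<lambda>n. cinner (X n) (Y n)) \<longlonglongrightarrow> cnj (cinner y x)"
      by (subst (asm) cinner_commute[symmetric])
    with cinner_abs[OF X(1) Y(1)] show ?thesis
      unfolding X(2) Y(2) by (rule LIMSEQ_unique)
  qed
  show add: "cinner x (y + z) = cinner x y + cinner x z"
  proof -
    have "(\<lambda>n. cinner (X n) (Y n) + cinner (X n) (Z n)) \<longlonglongrightarrow> cinner x y + cinner x z"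
      unfolding X(2) Y(2) Z(2) by (intro tendsto_add cinner_abs X Y Z)
    then have "(\<lambda>n. cinner (X n) (Y n + Z n)) \<longlonglongrightarrow> cinner x y + cinner x z"
      by (simp add: cinner_add_right)
    with cinner_abs[OF X(1) Cauchy_plus[OF Y(1) Z(1)]] show ?thesis
      unfolding X(2) Y(2) Z(2) plus_abs[OF Y(1) Z(1)] by (rule LIMSEQ_unique)
  qed
  show sc: "cinner x (c *\<^sub>C y) = c * cinner x y" for c
  proof -
    have "(\<lambda>n. c * cinner (X n) (Y n)) \<longlonglongrightarrow> c * cinner x y"
      unfolding X(2) Y(2) by (intro tendsto_mult_left cinner_abs X Y)
    then have "(\<lambda>n. cinner (X n) (c *\<^sub>C Y n)) \<longlonglongrightarrow> c * cinner x y"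
      by (simp add: cinner_scaleC_right)
    with cinner_abs[OF X(1) Cauchy_scaleC[OF Y(1)]] show ?thesis
      unfolding X(2) Y(2) scaleC_abs[OF Y(1)] by (rule LIMSEQ_unique)
  qed
  have self: "(\<lambda>n. complex_of_real ((norm (X n))\<^sup>2)) \<longlonglongrightarrow> cinner x x"
    using cinner_abs[OF X(1) X(1)] unfolding cinner_self X(2) .
  have selfR: "(\<lambda>n. (norm (X n))\<^sup>2) \<longlonglongrightarrow> inner x x"
    using tendsto_Re[OF self] by (simp add: inn)
  show "0 \<le> inner x x"
    by (rule LIMSEQ_le_const[OF selfR]) simp
  show "inner x x = 0 \<longleftrightarrow> x = 0"
  proof
    assume "inner x x = 0"
    then have "(\<lambda>n. (norm (X n))\<^sup>2) \<longlonglongrightarrow> 0" using selfR by simp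
    then have "(\<lambda>n. sqrt ((norm (X n))\<^sup>2)) \<longlonglongrightarrow> sqrt 0" by (rule tendsto_real_sqrt)
    then have "X \<longlonglongrightarrow> 0" by (simp add: tendsto_norm_zero_iff)
    then have "completion_rel X (\<lambda>_. 0)" using X(1) C0 by (simp add: completion_rel_def)
    then show "x = 0" unfolding X(2) zero_completion_def
      using Quotient_rel_abs[OF Quotient_completion] by blast
  next
    assume "x = 0"
    then have "cinner x x = lim (\<lambda>n. cinner (0::'a) 0)"
      by (simp only: zero_completion_def cinner_completion.abs_eq[of "\<lambda>_. 0" "\<lambda>_. 0"]
          completion_rel_self C0)
    then show "inner x x = 0" by (simp add: inn)
  qed
  have commR: "inner x y = inner y x" for x y :: "'a completion"
  proof -
    obtain X where X: "Cauchy X" "x = abs_completion X" by (rule completion_cases)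
    obtain Y where Y: "Cauchy Y" "y = abs_completion Y" by (rule completion_cases)
    have "(\<lambda>n. Re (cinner (X n) (Y n))) \<longlonglongrightarrow> inner x y"
      unfolding X(2) Y(2) inn by (intro tendsto_Re cinner_abs X Y)
    moreover have "(\<lambda>n. Re (cinner (Y n) (X n))) \<longlonglongrightarrow> inner y x"
      unfolding X(2) Y(2) inn by (intro tendsto_Re cinner_abs X Y)
    ultimately show ?thesis
      unfolding inner_eq_Re_cinner[symmetric] by (simp add: inner_commute LIMSEQ_unique)
  qed
  show "inner x y = inner y x" by (rule commR)
  show "inner (x + y) z = inner x z + inner y z"
  proof -
    have "(\<lambda>n. Re (cinner (X n) (Z n)) + Re (cinner (Y n) (Z n))) \<longlonglongrightarrow> inner x z + inner y z"
      unfolding X(2) Y(2) Z(2) inn by (intro tendsto_add tendsto_Re cinner_abs X Y Z)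
    then have "(\<lambda>n. Re (cinner (X n + Y n) (Z n))) \<longlonglongrightarrow> inner x z + inner y z"
      by (simp add: cinner_add_left)
    moreover have "(\<lambda>n. Re (cinner (X n + Y n) (Z n))) \<longlonglongrightarrow> inner (x + y) z"
      unfolding X(2) Y(2) Z(2) inn plus_abs[OF X(1) Y(1)]
      by (intro tendsto_Re cinner_abs X Y Z Cauchy_plus)
    ultimately show ?thesis by (rule LIMSEQ_unique[symmetric])
  qed
  show "inner (r *\<^sub>R x) y = r * inner x y"
  proof -
    have "(\<lambda>n. r * Re (cinner (X n) (Y n))) \<longlonglongrightarrow> r * inner x y"
      unfolding X(2) Y(2) inn by (intro tendsto_mult_left tendsto_Re cinner_abs X Y)
    then have "(\<lambda>n. Re (cinner (complex_of_real r *\<^sub>C X n) (Y n))) \<longlonglongrightarrow> r * inner x y"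
      by (simp add: cinner_scaleC_left)
    moreover have "(\<lambda>n. Re (cinner (complex_of_real r *\<^sub>C X n) (Y n))) \<longlonglongrightarrow> inner (r *\<^sub>R x) y"
      unfolding X(2) Y(2) inn scR scaleC_abs[OF X(1)]
      by (intro tendsto_Re cinner_abs X Y Cauchy_scaleC)
    ultimately show ?thesis by (rule LIMSEQ_unique[symmetric])
  qed
qed

end

lift_definition completion_of :: "'a::complex_inner \<Rightarrow> 'a completion" is "\<lambda>x n. x"
  by (simp add: Cauchy_def)

lemma Cauchy_const [simp]: "Cauchy (\<lambda>_. x :: 'a::metric_space)"
  by (simp add: Cauchy_def)

lemma completion_of_add: "completion_of (x + y) = completion_of x + completion_of y"
  by (simp add: completion_of_def plus_abs)

lemma completion_of_scaleC: "completion_of (c *\<^sub>C x) = c *\<^sub>C completion_of x"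
  by (simp add: completion_of_def scaleC_abs)

lemma cinner_completion_of: "cinner (completion_of x) (completion_of y) = cinner x y"
  using cinner_abs[of "\<lambda>_. x" "\<lambda>_. y"]
  by (simp add: completion_of_def LIMSEQ_const_iff)

lemma norm_completion_of: "norm (completion_of x) = norm x"
  by (simp add: norm_eq_sqrt_inner inner_eq_Re_cinner cinner_completion_of)

lemma completion_of_diff: "completion_of (x - y) = completion_of x - completion_of y"
  using completion_of_add[of "x - y" y] by simp

lemma completion_of_LIMSEQ:
  fixes X :: "nat \<Rightarrow> 'a::complex_inner"
  assumes "Cauchy X"
  shows "(\<lambda>n. completion_of (X n)) \<longlonglongrightarrow> abs_completion X"
proof (rule LIMSEQ_I)
  fix e :: real assume "e > 0"
  then obtain N where N: "\<And>m n. m \<ge> N \<Longrightarrow> n \<ge> N \<Longrightarrow> dist (X m) (X n) < e / 2"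
    using metric_CauchyD[OF assms, of "e/2"] by auto
  have "norm (completion_of (X n) - abs_completion X) < e" if "n \<ge> N" for n
  proof -
    have C: "Cauchy (\<lambda>m. X n + - X m)" by (intro Cauchy_plus Cauchy_uminus assms) simp
    have eq: "completion_of (X n) - abs_completion X = abs_completion (\<lambda>m. X n + - X m)"
      unfolding diff_conv_add_uminus uminus_abs[OF assms] completion_of_def map_fun_def id_def comp_def
      by (intro plus_abs Cauchy_uminus assms) simp
    have "(\<lambda>m. Re (cinner (X n + - X m) (X n + - X m))) \<longlonglongrightarrow>
        Re (cinner (completion_of (X n) - abs_completion X) (completion_of (X n) - abs_completion X))"
      unfolding eq by (intro tendsto_Re cinner_abs C)
    then have "(\<lambda>m. (dist (X n) (X m))\<^sup>2) \<longlonglongrightarrow> (norm (completion_of (X n) - abs_completion X))\<^sup>2"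
      by (simp add: cinner_self dist_norm)
    then have "(norm (completion_of (X n) - abs_completion X))\<^sup>2 \<le> (e / 2)\<^sup>2"
    proof (rule LIMSEQ_le_const2)
      show "\<exists>M. \<forall>m\<ge>M. (dist (X n) (X m))\<^sup>2 \<le> (e / 2)\<^sup>2"
        by (intro exI[of _ N] allI impI power_mono less_imp_le[OF N] that) simp_all
    qed
    then have "norm (completion_of (X n) - abs_completion X) \<le> e / 2"
      by (rule power2_le_imp_le) (use \<open>e > 0\<close> in linarith)
    then show ?thesis using \<open>e > 0\<close> by linarith
  qed
  then show "\<exists>N. \<forall>n\<ge>N. norm (completion_of (X n) - abs_completion X) < e" by blast
qed

lemma completion_of_dense: "closure (range completion_of) = UNIV"
proof -
  have "x \<in> closure (range completion_of)" for x :: "'a completion"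
  proof -
    obtain X where X: "Cauchy X" "x = abs_completion X" by (rule completion_cases)
    show ?thesis
      unfolding closure_sequential X(2)
      by (intro exI[of _ "\<lambda>n. completion_of (X n)"] conjI allI rangeI completion_of_LIMSEQ X)
  qed
  then show ?thesis by blast
qed

instance completion :: (complex_inner) chilbert_space
proof
  fix F :: "nat \<Rightarrow> 'a completion" assume F: "Cauchy F"
  have "\<exists>x. dist (completion_of x) (F n) < inverse (real (Suc n))" for n
  proof -
    have "F n \<in> closure (range completion_of)" by (simp add: completion_of_dense)
    then show ?thesis
      unfolding closure_approachable by (metis inverse_positive_iff_positive of_nat_0_less_iff
          rangeE zero_less_Suc)
  qed
  then obtain X where X: "\<And>n. dist (completion_of (X n)) (F n) < inverse (real (Suc n))" by metis
  have d: "(\<lambda>n. completion_of (X n) - F n) \<longlonglongrightarrow> 0"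
  proof (rule Lim_null_comparison)
    show "\<forall>\<^sub>F n in sequentially. norm (completion_of (X n) - F n) \<le> inverse (real (Suc n))"
      using X by (intro always_eventually allI less_imp_le) (simp add: dist_norm)
    show "(\<lambda>n. inverse (real (Suc n))) \<longlonglongrightarrow> 0" by (rule LIMSEQ_inverse_real_of_nat)
  qed
  have "Cauchy (\<lambda>n. (completion_of (X n) - F n) + F n)"
    by (rule Cauchy_plus[OF LIMSEQ_imp_Cauchy[OF d] F])
  then have "Cauchy X"
    by (simp add: Cauchy_def dist_norm completion_of_diff[symmetric] norm_completion_of)
  from tendsto_diff[OF completion_of_LIMSEQ[OF this] d]
  have "F \<longlonglongrightarrow> abs_completion X" by simp
  then show "convergent F" by (auto simp: convergent_def)
qed



section \<open>The Hilbert space tensor product\<close>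

text \<open>An algebraic tensor, the sum of \<open>x \<otimes> y\<close> over the pairs \<open>(x, y)\<close> in a list, is
  represented by the function \<open>(p, q) \<mapsto> \<Sum> \<langle>p, x\<rangle> \<langle>q, y\<rangle>\<close>. Two such sums denote the same algebraic tensor
  if and only if these functions agree.\<close>

definition tensor_fun :: "('a::complex_inner \<times> 'b::complex_inner) list \<Rightarrow> 'a \<Rightarrow> 'b \<Rightarrow> complex"
  where "tensor_fun ts p q = (\<Sum>(x, y)\<leftarrow>ts. cinner p x * cinner q y)"

typedef (overloaded) ('a, 'b) atensor = "range (tensor_fun :: ('a::complex_inner \<times> 'b::complex_inner) list \<Rightarrow> _)"
  morphisms fun_of_atensor Abs_atensor
  by blast

setup_lifting type_definition_atensor

lemma tensor_fun_append: "tensor_fun (ts @ us) p q = tensor_fun ts p q + tensor_fun us p q"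
  by (simp add: tensor_fun_def)

lemma tensor_fun_scale: "tensor_fun (map (\<lambda>(x, y). (c *\<^sub>C x, y)) ts) p q = c * tensor_fun ts p q"
  by (induction ts) (auto simp: tensor_fun_def cinner_scaleC_right algebra_simps)

lemma tensor_fun_swap:
  "(\<Sum>(x, y)\<leftarrow>ts. tensor_fun us x y) = cnj (\<Sum>(x, y)\<leftarrow>us. tensor_fun ts x y)"
proof (induction ts)
  case Nil
  show ?case by (simp add: tensor_fun_def case_prod_unfold)
next
  case (Cons t ts)
  have "cnj (\<Sum>(x, y)\<leftarrow>us. tensor_fun [t] x y) = tensor_fun us (fst t) (snd t)"
  proof (induction us)
    case (Cons u us)
    then show ?case
      using cinner_commute[of "fst t" "fst u"] cinner_commute[of "snd t" "snd u"]
      by (simp add: tensor_fun_def case_prod_unfold)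
  qed (simp add: tensor_fun_def)
  moreover have "(\<Sum>(x, y)\<leftarrow>us. tensor_fun (t # ts) x y) =
      (\<Sum>(x, y)\<leftarrow>us. tensor_fun [t] x y) + (\<Sum>(x, y)\<leftarrow>us. tensor_fun ts x y)"
    by (simp add: tensor_fun_def case_prod_unfold sum_list_addf)
  ultimately show ?case using Cons.IH by (simp add: case_prod_unfold)
qed

lemma sum_list_set_swap:
  "finite F \<Longrightarrow> (\<Sum>g\<in>F. \<Sum>t\<leftarrow>ts. f g t) = (\<Sum>t\<leftarrow>ts. \<Sum>g\<in>F. f g t :: 'z::comm_monoid_add)"
  by (induction ts) (auto simp: sum.distrib)

lemma tensor_fun_orthonormal:
  fixes ts :: "('a::complex_inner \<times> 'b::complex_inner) list"
  obtains F and z :: "'a \<Rightarrow> 'b" where "finite F" "orthonormal F"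
    "\<And>p q. tensor_fun ts p q = (\<Sum>g\<in>F. cinner p g * cinner q (z g))"
proof -
  obtain F where F: "finite F" "orthonormal F" "\<And>x. x \<in> fst ` set ts \<Longrightarrow> x = (\<Sum>g\<in>F. cinner g x *\<^sub>C g)"
    using Gram_Schmidt[of "fst ` set ts"] by blast
  define z where "z g = (\<Sum>(x, y)\<leftarrow>ts. cinner g x *\<^sub>C y)" for g
  have "tensor_fun ts p q = (\<Sum>g\<in>F. cinner p g * cinner q (z g))" for p q
  proof -
    have "cinner p x = (\<Sum>g\<in>F. cinner g x * cinner p g)" if "(x, y) \<in> set ts" for x y
    proof -
      have "x = (\<Sum>g\<in>F. cinner g x *\<^sub>C g)" using F(3) that by force
      then have "cinner p x = cinner p (\<Sum>g\<in>F. cinner g x *\<^sub>C g)" by (rule arg_cong)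
      then show ?thesis by (simp add: cinner_sum_right cinner_scaleC_right)
    qed
    then have "tensor_fun ts p q = (\<Sum>t\<leftarrow>ts. \<Sum>g\<in>F. cinner p g * (cinner g (fst t) * cinner q (snd t)))"
      unfolding tensor_fun_def
      by (intro arg_cong[of _ _ sum_list] map_cong refl)
         (auto simp: sum_distrib_left mult_ac intro!: sum.cong)
    also have "\<dots> = (\<Sum>g\<in>F. \<Sum>t\<leftarrow>ts. cinner p g * (cinner g (fst t) * cinner q (snd t)))"
      by (rule sum_list_set_swap[OF F(1), symmetric])
    also have "\<dots> = (\<Sum>g\<in>F. cinner p g * cinner q (z g))"
      by (intro sum.cong refl)
         (simp add: z_def cinner_sum_list_right case_prod_unfold cinner_scaleC_right sum_list_const_mult)
    finally show ?thesis .
  qed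
  with F(1,2) show ?thesis by (rule that)
qed

instantiation atensor :: (complex_inner, complex_inner) complex_inner
begin

lift_definition zero_atensor :: "('a, 'b) atensor" is "\<lambda>_ _. 0"
  by (rule range_eqI[of _ _ "[]"]) (simp add: fun_eq_iff tensor_fun_def)

lift_definition plus_atensor :: "('a, 'b) atensor \<Rightarrow> ('a, 'b) atensor \<Rightarrow> ('a, 'b) atensor"
  is "\<lambda>f g p q. f p q + g p q"
proof (elim rangeE, hypsubst)
  fix ts us :: "('a \<times> 'b) list"
  show "(\<lambda>p q. tensor_fun ts p q + tensor_fun us p q) \<in> range tensor_fun"
    by (rule range_eqI[of _ _ "ts @ us"]) (simp add: fun_eq_iff tensor_fun_append)
qed

lift_definition scaleC_atensor :: "complex \<Rightarrow> ('a, 'b) atensor \<Rightarrow> ('a, 'b) atensor"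
  is "\<lambda>c f p q. c * f p q"
proof (elim rangeE, hypsubst)
  fix c and ts :: "('a \<times> 'b) list"
  show "(\<lambda>p q. c * tensor_fun ts p q) \<in> range tensor_fun"
    by (rule range_eqI[of _ _ "map (\<lambda>(x, y). (c *\<^sub>C x, y)) ts"]) (simp add: fun_eq_iff tensor_fun_scale)
qed

definition uminus_atensor :: "('a, 'b) atensor \<Rightarrow> ('a, 'b) atensor"
  where "uminus_atensor f = (-1) *\<^sub>C f"

definition minus_atensor :: "('a, 'b) atensor \<Rightarrow> ('a, 'b) atensor \<Rightarrow> ('a, 'b) atensor"
  where "minus_atensor f g = f + (- g)"

definition scaleR_atensor :: "real \<Rightarrow> ('a, 'b) atensor \<Rightarrow> ('a, 'b) atensor"
  where "scaleR_atensor r f = complex_of_real r *\<^sub>C f"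

text \<open>Since \<open>\<langle>x \<otimes> y, x' \<otimes> y'\<rangle> = \<langle>x, x'\<rangle> \<langle>y, y'\<rangle>\<close>, the inner product of a sum of tensors \<open>x \<otimes> y\<close> with
  \<open>g\<close> is the sum of the values of \<open>g\<close> at the pairs \<open>(x, y)\<close>; by \<open>cinner_atensor_eq\<close> it does not depend on
  the chosen representation.\<close>

definition cinner_atensor :: "('a, 'b) atensor \<Rightarrow> ('a, 'b) atensor \<Rightarrow> complex"
  where "cinner_atensor f g =
    (\<Sum>(x, y)\<leftarrow>(SOME ts. fun_of_atensor f = tensor_fun ts). fun_of_atensor g x y)"

definition inner_atensor :: "('a, 'b) atensor \<Rightarrow> ('a, 'b) atensor \<Rightarrow> real"
  where "inner_atensor x y = Re (cinner x y)"

definition norm_atensor :: "('a, 'b) atensor \<Rightarrow> real"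
  where "norm_atensor x = sqrt (inner x x)"

definition dist_atensor :: "('a, 'b) atensor \<Rightarrow> ('a, 'b) atensor \<Rightarrow> real"
  where "dist_atensor x y = norm (x - y)"

definition sgn_atensor :: "('a, 'b) atensor \<Rightarrow> ('a, 'b) atensor"
  where "sgn_atensor x = inverse (norm x) *\<^sub>R x"

definition uniformity_atensor :: "(('a, 'b) atensor \<times> ('a, 'b) atensor) filter"
  where "uniformity_atensor = (INF e\<in>{0<..}. principal {(x, y). dist x y < e})"

definition open_atensor :: "('a, 'b) atensor set \<Rightarrow> bool"
  where "open_atensor U \<longleftrightarrow> (\<forall>x\<in>U. \<forall>\<^sub>F (x', y) in uniformity. x' = x \<longrightarrow> y \<in> U)"

lemma atensor_cases:
  obtains ts where "fun_of_atensor (f :: ('a, 'b) atensor) = tensor_fun ts"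
  using fun_of_atensor[of f] by blast

lemma cinner_atensor_eq:
  fixes f g :: "('a, 'b) atensor"
  assumes "fun_of_atensor f = tensor_fun ts"
  shows "cinner f g = (\<Sum>(x, y)\<leftarrow>ts. fun_of_atensor g x y)"
proof -
  obtain us where us: "fun_of_atensor g = tensor_fun us" by (rule atensor_cases)
  define ts' where "ts' = (SOME ts. fun_of_atensor f = tensor_fun ts)"
  have ts': "tensor_fun ts' = tensor_fun ts"
    using someI[of "\<lambda>ts. fun_of_atensor f = tensor_fun ts" ts] assms by (simp add: ts'_def)
  have "cinner f g = (\<Sum>(x, y)\<leftarrow>ts'. tensor_fun us x y)"
    by (simp add: cinner_atensor_def us ts'_def)
  also have "\<dots> = (\<Sum>(x, y)\<leftarrow>ts. tensor_fun us x y)"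
    by (subst (1 2) tensor_fun_swap) (simp add: ts')
  finally show ?thesis by (simp add: us)
qed

lemma cinner_atensor_self:
  fixes f :: "('a, 'b) atensor"
  obtains F and z :: "'a \<Rightarrow> 'b" where "finite F"
    "\<And>p q. fun_of_atensor f p q = (\<Sum>g\<in>F. cinner p g * cinner q (z g))"
    "cinner f f = complex_of_real (\<Sum>g\<in>F. (norm (z g))\<^sup>2)"
proof -
  obtain ts where ts: "fun_of_atensor f = tensor_fun ts" by (rule atensor_cases)
  obtain F and z :: "'a \<Rightarrow> 'b" where F: "finite F" "orthonormal F"
    and z: "\<And>p q. tensor_fun ts p q = (\<Sum>g\<in>F. cinner p g * cinner q (z g))"
    by (rule tensor_fun_orthonormal[of ts]) blast
  obtain gs where gs: "set gs = F" "distinct gs" using finite_distinct_list[OF F(1)] by blast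
  have "fun_of_atensor f = tensor_fun (map (\<lambda>g. (g, z g)) gs)"
    unfolding ts fun_eq_iff z by (simp add: tensor_fun_def comp_def sum_list_distinct_conv_sum_set gs)
  then have "cinner f f = (\<Sum>(x, y)\<leftarrow>map (\<lambda>g. (g, z g)) gs. fun_of_atensor f x y)"
    by (rule cinner_atensor_eq)
  also have "\<dots> = (\<Sum>h\<in>F. \<Sum>g\<in>F. cinner h g * cinner (z h) (z g))"
    by (simp add: ts z comp_def sum_list_distinct_conv_sum_set gs)
  also have "\<dots> = (\<Sum>h\<in>F. \<Sum>g\<in>F. if h = g then cinner (z h) (z h) else 0)"
    using F(2) by (intro sum.cong refl) (auto simp: orthonormal_def)
  also have "\<dots> = complex_of_real (\<Sum>g\<in>F. (norm (z g))\<^sup>2)"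
    using F(1) by (simp add: cinner_self)
  finally show ?thesis by (intro that[OF F(1)]) (simp_all add: ts z)
qed

instance
proof
  fix f g h :: "('a, 'b) atensor" and a b :: complex and r s :: real
  show "f + g + h = f + (g + h)" by transfer (simp add: fun_eq_iff)
  show "f + g = g + f" by transfer (simp add: fun_eq_iff)
  show "0 + f = f" by transfer (simp add: fun_eq_iff)
  show "- f + f = 0" unfolding uminus_atensor_def by transfer (simp add: fun_eq_iff)
  show "f - g = f + - g" by (rule minus_atensor_def)
  show scR: "r *\<^sub>R f = complex_of_real r *\<^sub>C f" for r and f :: "('a, 'b) atensor"
    by (rule scaleR_atensor_def)
  show A1: "a *\<^sub>C (f + g) = a *\<^sub>C f + a *\<^sub>C g" for a by transfer (simp add: fun_eq_iff algebra_simps)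
  show A2: "(a + b) *\<^sub>C f = a *\<^sub>C f + b *\<^sub>C f" for a b by transfer (simp add: fun_eq_iff algebra_simps)
  show A3: "a *\<^sub>C (b *\<^sub>C f) = (a * b) *\<^sub>C f" for a b by transfer (simp add: fun_eq_iff algebra_simps)
  show A4: "1 *\<^sub>C f = f" by transfer (simp add: fun_eq_iff)
  show "r *\<^sub>R (f + g) = r *\<^sub>R f + r *\<^sub>R g" by (simp add: scR A1)
  show "(r + s) *\<^sub>R f = r *\<^sub>R f + s *\<^sub>R f" by (simp add: scR A2)
  show "r *\<^sub>R s *\<^sub>R f = (r * s) *\<^sub>R f" by (simp add: scR A3)
  show "1 *\<^sub>R f = f" by (simp add: scR A4)
  show "dist f g = norm (f - g)" by (rule dist_atensor_def)
  show "sgn f = inverse (norm f) *\<^sub>R f" by (rule sgn_atensor_def)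
  show "uniformity = (INF e\<in>{0<..}. principal {(x, y). dist (x::('a, 'b) atensor) y < e})"
    by (rule uniformity_atensor_def)
  show "open U \<longleftrightarrow> (\<forall>x\<in>U. \<forall>\<^sub>F (x', y) in uniformity. x' = x \<longrightarrow> y \<in> U)" for U :: "('a, 'b) atensor set"
    by (rule open_atensor_def)
  show "norm f = sqrt (inner f f)" by (rule norm_atensor_def)
  show inn: "inner f g = Re (cinner f g)" for f g :: "('a, 'b) atensor" by (rule inner_atensor_def)
  show comm: "cinner f g = cnj (cinner g f)" for f g :: "('a, 'b) atensor"
  proof -
    obtain ts where ts: "fun_of_atensor f = tensor_fun ts" by (rule atensor_cases)
    obtain us where us: "fun_of_atensor g = tensor_fun us" by (rule atensor_cases)
    show ?thesis
      unfolding cinner_atensor_eq[OF ts] cinner_atensor_eq[OF us] unfolding ts us by (rule tensor_fun_swap)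
  qed
  have add: "cinner f (g + h) = cinner f g + cinner f h" for f g h :: "('a, 'b) atensor"
  proof -
    obtain ts where ts: "fun_of_atensor f = tensor_fun ts" by (rule atensor_cases)
    show ?thesis
      by (simp add: cinner_atensor_eq[OF ts] plus_atensor.rep_eq case_prod_unfold sum_list_addf)
  qed
  show "cinner f (g + h) = cinner f g + cinner f h" by (rule add)
  have sc: "cinner f (c *\<^sub>C g) = c * cinner f g" for c and f g :: "('a, 'b) atensor"
  proof -
    obtain ts where ts: "fun_of_atensor f = tensor_fun ts" by (rule atensor_cases)
    show ?thesis
      by (simp add: cinner_atensor_eq[OF ts] scaleC_atensor.rep_eq case_prod_unfold sum_list_const_mult)
  qed
  show "cinner f (a *\<^sub>C g) = a * cinner f g" by (rule sc)
  have commR: "inner f g = inner g f" for f g :: "('a, 'b) atensor"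
    unfolding inn by (subst comm) simp
  show "inner f g = inner g f" by (rule commR)
  show "inner (f + g) h = inner f h + inner g h"
    unfolding commR[of _ h] by (simp add: inn add)
  show "inner (r *\<^sub>R f) g = r * inner f g"
    unfolding commR[of _ g] by (simp add: inn scR sc)
  obtain F and z :: "'a \<Rightarrow> 'b" where F: "finite F"
    "\<And>p q. fun_of_atensor f p q = (\<Sum>g\<in>F. cinner p g * cinner q (z g))"
    "cinner f f = complex_of_real (\<Sum>g\<in>F. (norm (z g))\<^sup>2)"
    using cinner_atensor_self[of f] by blast
  show "0 \<le> inner f f" unfolding inn F(3) by (simp add: sum_nonneg)
  show "inner f f = 0 \<longleftrightarrow> f = 0"
  proof
    assume "inner f f = 0"
    then have "(\<Sum>g\<in>F. (norm (z g))\<^sup>2) = 0" unfolding inn F(3) by simp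
    then have "\<forall>g\<in>F. z g = 0" using F(1) by (simp add: sum_nonneg_eq_0_iff)
    then have "fun_of_atensor f p q = 0" for p q unfolding F(2) by simp
    then show "f = 0" by transfer (simp add: fun_eq_iff)
  next
    assume "f = 0"
    then have "fun_of_atensor f = tensor_fun []"
      by (simp add: zero_atensor.rep_eq fun_eq_iff tensor_fun_def)
    then show "inner f f = 0" by (simp add: inn cinner_atensor_eq)
  qed
qed

end

lift_definition atensor_of :: "'a::complex_inner \<Rightarrow> 'b::complex_inner \<Rightarrow> ('a, 'b) atensor"
  is "\<lambda>x y p q. cinner p x * cinner q y"
proof -
  fix x :: 'a and y :: 'b
  show "(\<lambda>p q. cinner p x * cinner q y) \<in> range tensor_fun"
    by (rule range_eqI[of _ _ "[(x, y)]"]) (simp add: tensor_fun_def fun_eq_iff)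
qed

type_synonym ('a, 'b) htensor = "('a, 'b) atensor completion"

definition tensor :: "'a::complex_inner \<Rightarrow> 'b::complex_inner \<Rightarrow> ('a, 'b) htensor" (infixr \<open>\<otimes>\<^sub>H\<close> 71)
  where "x \<otimes>\<^sub>H y = completion_of (atensor_of x y)"

lemma tensor_add_left: "(x + x') \<otimes>\<^sub>H y = x \<otimes>\<^sub>H y + x' \<otimes>\<^sub>H y"
proof -
  have "atensor_of (x + x') y = atensor_of x y + atensor_of x' y"
    by transfer (simp add: fun_eq_iff cinner_add_right algebra_simps)
  then show ?thesis by (simp add: tensor_def completion_of_add)
qed

lemma tensor_add_right: "x \<otimes>\<^sub>H (y + y') = x \<otimes>\<^sub>H y + x \<otimes>\<^sub>H y'"
proof -
  have "atensor_of x (y + y') = atensor_of x y + atensor_of x y'"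
    by transfer (simp add: fun_eq_iff cinner_add_right algebra_simps)
  then show ?thesis by (simp add: tensor_def completion_of_add)
qed

lemma tensor_scaleC_left: "(c *\<^sub>C x) \<otimes>\<^sub>H y = c *\<^sub>C (x \<otimes>\<^sub>H y)"
proof -
  have "atensor_of (c *\<^sub>C x) y = c *\<^sub>C atensor_of x y"
    by transfer (simp add: fun_eq_iff cinner_scaleC_right algebra_simps)
  then show ?thesis by (simp add: tensor_def completion_of_scaleC)
qed

lemma tensor_scaleC_right: "x \<otimes>\<^sub>H (c *\<^sub>C y) = c *\<^sub>C (x \<otimes>\<^sub>H y)"
proof -
  have "atensor_of x (c *\<^sub>C y) = c *\<^sub>C atensor_of x y"
    by transfer (simp add: fun_eq_iff cinner_scaleC_right algebra_simps)
  then show ?thesis by (simp add: tensor_def completion_of_scaleC)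
qed

lemma cinner_tensor: "cinner (x \<otimes>\<^sub>H y) (x' \<otimes>\<^sub>H y') = cinner x x' * cinner y y'"
proof -
  have "fun_of_atensor (atensor_of x y) = tensor_fun [(x, y)]"
    by (simp add: fun_eq_iff atensor_of.rep_eq tensor_fun_def)
  then show ?thesis
    by (simp add: tensor_def cinner_completion_of cinner_atensor_eq atensor_of.rep_eq)
qed

lemma norm_tensor: "norm (x \<otimes>\<^sub>H y) = norm x * norm y"
proof -
  have "complex_of_real ((norm (x \<otimes>\<^sub>H y))\<^sup>2) = complex_of_real ((norm x * norm y)\<^sup>2)"
    unfolding cinner_self[symmetric] cinner_tensor by (simp add: cinner_self power_mult_distrib)
  then have "(norm (x \<otimes>\<^sub>H y))\<^sup>2 = (norm x * norm y)\<^sup>2" by (simp only: of_real_eq_iff)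
  then show ?thesis by simp
qed

lemma tensor_total:
  "closure (cspan (range (\<lambda>(x, y). (x::'a::complex_inner) \<otimes>\<^sub>H (y::'b::complex_inner)))) = UNIV"
proof -
  have "completion_of f \<in> cspan (range (\<lambda>(x, y). x \<otimes>\<^sub>H y))" for f :: "('a, 'b) atensor"
  proof -
    obtain ts where "fun_of_atensor f = tensor_fun ts" by (rule atensor_cases)
    then show ?thesis
    proof (induction ts arbitrary: f)
      case Nil
      then have "f = 0" by (simp add: fun_of_atensor_inject[symmetric] zero_atensor.rep_eq fun_eq_iff tensor_fun_def)
      then have "completion_of f = 0" using completion_of_add[of 0 "0::('a, 'b) atensor"] by simp
      then show ?case by (simp add: complex_vector.span_zero)
    next
      case (Cons t ts)
      obtain x y where t: "t = (x, y)" by fastforce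
      define f' :: "('a, 'b) atensor" where "f' = Abs_atensor (tensor_fun ts)"
      have f': "fun_of_atensor f' = tensor_fun ts" by (simp add: f'_def Abs_atensor_inverse)
      have "f = atensor_of x y + f'"
        using Cons.prems
        by (simp add: fun_of_atensor_inject[symmetric] plus_atensor.rep_eq atensor_of.rep_eq f' t
            tensor_fun_def fun_eq_iff)
      then have "completion_of f = x \<otimes>\<^sub>H y + completion_of f'"
        by (simp add: tensor_def completion_of_add)
      moreover have "x \<otimes>\<^sub>H y \<in> cspan (range (\<lambda>(x, y). x \<otimes>\<^sub>H y))"
        by (rule complex_vector.span_base) (rule range_eqI[of _ _ "(x, y)"], simp)
      ultimately show ?case using Cons.IH[OF f'] by (simp add: complex_vector.span_add)
    qed
  qed
  then have "range completion_of \<subseteq> cspan (range (\<lambda>(x, y). (x::'a) \<otimes>\<^sub>H (y::'b)))" by blast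
  from closure_mono[OF this] show ?thesis unfolding completion_of_dense by blast
qed



subsection \<open>Tensor products of operators and the associator\<close>

lemma norm_tensor_sum_orthonormal:
  assumes "finite F" "orthonormal F"
  shows "(norm (\<Sum>g\<in>F. g \<otimes>\<^sub>H z g))\<^sup>2 = (\<Sum>g\<in>F. (norm (z g))\<^sup>2)"
    and "(norm (\<Sum>g\<in>F. z g \<otimes>\<^sub>H g))\<^sup>2 = (\<Sum>g\<in>F. (norm (z g))\<^sup>2)"
proof -
  have "(\<Sum>g\<in>F. \<Sum>h\<in>F. cinner g h * cinner (z g) (z h)) = (\<Sum>g\<in>F. \<Sum>h\<in>F. if g = h then cinner (z g) (z g) else 0)"
    using assms(2) by (intro sum.cong refl) (auto simp: orthonormal_def)
  also have "\<dots> = complex_of_real (\<Sum>g\<in>F. (norm (z g))\<^sup>2)"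
    using assms(1) by (simp add: cinner_self)
  finally have *: "(\<Sum>g\<in>F. \<Sum>h\<in>F. cinner g h * cinner (z g) (z h)) = \<dots>" .
  have "complex_of_real ((norm (\<Sum>g\<in>F. g \<otimes>\<^sub>H z g))\<^sup>2) = complex_of_real (\<Sum>g\<in>F. (norm (z g))\<^sup>2)"
    unfolding cinner_self[symmetric] cinner_sum_left cinner_sum_right cinner_tensor
    using * by (subst sum.swap) (simp add: cinner_self)
  then show "(norm (\<Sum>g\<in>F. g \<otimes>\<^sub>H z g))\<^sup>2 = (\<Sum>g\<in>F. (norm (z g))\<^sup>2)"
    by (simp only: of_real_eq_iff)
  have "complex_of_real ((norm (\<Sum>g\<in>F. z g \<otimes>\<^sub>H g))\<^sup>2) = complex_of_real (\<Sum>g\<in>F. (norm (z g))\<^sup>2)"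
    unfolding cinner_self[symmetric] cinner_sum_left cinner_sum_right cinner_tensor
    using * by (subst sum.swap) (simp add: cinner_self mult.commute)
  then show "(norm (\<Sum>g\<in>F. z g \<otimes>\<^sub>H g))\<^sup>2 = (\<Sum>g\<in>F. (norm (z g))\<^sup>2)"
    by (simp only: of_real_eq_iff)
qed

lemma tensor_zero [simp]: "0 \<otimes>\<^sub>H y = 0" "x \<otimes>\<^sub>H 0 = 0"
  using tensor_add_left[of 0 0 y] tensor_add_right[of x 0 0] by simp_all

lemma tensor_sum_left: "(\<Sum>i\<in>A. f i) \<otimes>\<^sub>H y = (\<Sum>i\<in>A. f i \<otimes>\<^sub>H y)"
  by (induction A rule: infinite_finite_induct) (auto simp: tensor_add_left)

lemma tensor_sum_right: "x \<otimes>\<^sub>H (\<Sum>i\<in>A. f i) = (\<Sum>i\<in>A. x \<otimes>\<^sub>H f i)"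
  by (induction A rule: infinite_finite_induct) (auto simp: tensor_add_right)

lemma tensor_sum_list_left: "(\<Sum>i\<leftarrow>xs. f i) \<otimes>\<^sub>H y = (\<Sum>i\<leftarrow>xs. f i \<otimes>\<^sub>H y)"
  by (induction xs) (auto simp: tensor_add_left)

lemma tensor_sum_list_right: "x \<otimes>\<^sub>H (\<Sum>i\<leftarrow>xs. f i) = (\<Sum>i\<leftarrow>xs. x \<otimes>\<^sub>H f i)"
  by (induction xs) (auto simp: tensor_add_right)

lemma orthonormal_sum_bound:
  assumes "\<And>g. norm (b *\<^sub>V z g) \<le> K * norm (z g)"
  shows "(\<Sum>g\<in>F. (norm (b *\<^sub>V z g))\<^sup>2) \<le> K\<^sup>2 * (\<Sum>g\<in>F. (norm (z g))\<^sup>2)"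
  unfolding sum_distrib_left power_mult_distrib[symmetric]
  by (intro sum_mono power_mono assms) simp

lemma tensor_sum_bound_right:
  fixes ts :: "('a::complex_inner \<times> 'b::complex_inner) list" and b :: "'b \<Rightarrow>\<^sub>C\<^sub>L 'c::complex_inner"
  assumes K: "K \<ge> 0" "\<And>y. norm (b *\<^sub>V y) \<le> K * norm y"
  shows "norm (\<Sum>(x, y)\<leftarrow>ts. x \<otimes>\<^sub>H (b *\<^sub>V y)) \<le> K * norm (\<Sum>(x, y)\<leftarrow>ts. x \<otimes>\<^sub>H y)"
proof -
  obtain F where F: "finite F" "orthonormal F" "\<And>x. x \<in> fst ` set ts \<Longrightarrow> x = (\<Sum>g\<in>F. cinner g x *\<^sub>C g)"
    using Gram_Schmidt[of "fst ` set ts"] by blast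
  define z where "z g = (\<Sum>(x, y)\<leftarrow>ts. cinner g x *\<^sub>C y)" for g
  have expand: "(\<Sum>(x, y)\<leftarrow>ts. x \<otimes>\<^sub>H f y) = (\<Sum>g\<in>F. g \<otimes>\<^sub>H (\<Sum>(x, y)\<leftarrow>ts. cinner g x *\<^sub>C f y))"
    for f :: "'b \<Rightarrow> 'd::complex_inner"
  proof -
    have "fst t \<otimes>\<^sub>H f (snd t) = (\<Sum>g\<in>F. g \<otimes>\<^sub>H (cinner g (fst t) *\<^sub>C f (snd t)))" if "t \<in> set ts" for t
    proof -
      have "fst t = (\<Sum>g\<in>F. cinner g (fst t) *\<^sub>C g)" using F(3) that by blast
      then have "fst t \<otimes>\<^sub>H f (snd t) = (\<Sum>g\<in>F. cinner g (fst t) *\<^sub>C g) \<otimes>\<^sub>H f (snd t)"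
        by (rule arg_cong)
      then show ?thesis by (simp add: tensor_sum_left tensor_scaleC_left tensor_scaleC_right)
    qed
    then have "(\<Sum>t\<leftarrow>ts. fst t \<otimes>\<^sub>H f (snd t)) =
        (\<Sum>t\<leftarrow>ts. \<Sum>g\<in>F. g \<otimes>\<^sub>H (cinner g (fst t) *\<^sub>C f (snd t)))"
      by (intro arg_cong[of _ _ sum_list] map_cong refl)
    also have "\<dots> = (\<Sum>g\<in>F. g \<otimes>\<^sub>H (\<Sum>t\<leftarrow>ts. cinner g (fst t) *\<^sub>C f (snd t)))"
      by (simp add: tensor_sum_list_right sum_list_set_swap[OF F(1)])
    finally show ?thesis by (simp add: case_prod_unfold)
  qed
  have "(\<Sum>(x, y)\<leftarrow>ts. cinner g x *\<^sub>C (b *\<^sub>V y)) = b *\<^sub>V z g" for g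
    by (simp add: z_def cblinfun_sum_list cblinfun_scaleC case_prod_unfold)
  then have "(norm (\<Sum>(x, y)\<leftarrow>ts. x \<otimes>\<^sub>H (b *\<^sub>V y)))\<^sup>2 = (\<Sum>g\<in>F. (norm (b *\<^sub>V z g))\<^sup>2)"
    unfolding expand[of "\<lambda>y. b *\<^sub>V y"] by (simp add: norm_tensor_sum_orthonormal(1)[OF F(1,2)])
  also have "\<dots> \<le> K\<^sup>2 * (\<Sum>g\<in>F. (norm (z g))\<^sup>2)" by (intro orthonormal_sum_bound K)
  also have "\<dots> = (K * norm (\<Sum>(x, y)\<leftarrow>ts. x \<otimes>\<^sub>H y))\<^sup>2"
    unfolding expand[of "\<lambda>y. y"] power_mult_distrib norm_tensor_sum_orthonormal(1)[OF F(1,2)] z_def ..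
  finally show ?thesis by (rule power2_le_imp_le) (simp add: K)
qed

lemma tensor_sum_bound_left:
  fixes ts :: "('a::complex_inner \<times> 'b::complex_inner) list" and a :: "'a \<Rightarrow>\<^sub>C\<^sub>L 'c::complex_inner"
  assumes K: "K \<ge> 0" "\<And>x. norm (a *\<^sub>V x) \<le> K * norm x"
  shows "norm (\<Sum>(x, y)\<leftarrow>ts. (a *\<^sub>V x) \<otimes>\<^sub>H y) \<le> K * norm (\<Sum>(x, y)\<leftarrow>ts. x \<otimes>\<^sub>H y)"
proof -
  obtain F where F: "finite F" "orthonormal F" "\<And>x. x \<in> snd ` set ts \<Longrightarrow> x = (\<Sum>g\<in>F. cinner g x *\<^sub>C g)"
    using Gram_Schmidt[of "snd ` set ts"] by blast
  define z where "z g = (\<Sum>(x, y)\<leftarrow>ts. cinner g y *\<^sub>C x)" for g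
  have expand: "(\<Sum>(x, y)\<leftarrow>ts. f x \<otimes>\<^sub>H y) = (\<Sum>g\<in>F. (\<Sum>(x, y)\<leftarrow>ts. cinner g y *\<^sub>C f x) \<otimes>\<^sub>H g)"
    for f :: "'a \<Rightarrow> 'd::complex_inner"
  proof -
    have "f (fst t) \<otimes>\<^sub>H snd t = (\<Sum>g\<in>F. (cinner g (snd t) *\<^sub>C f (fst t)) \<otimes>\<^sub>H g)" if "t \<in> set ts" for t
    proof -
      have "snd t = (\<Sum>g\<in>F. cinner g (snd t) *\<^sub>C g)" using F(3) that by blast
      then have "f (fst t) \<otimes>\<^sub>H snd t = f (fst t) \<otimes>\<^sub>H (\<Sum>g\<in>F. cinner g (snd t) *\<^sub>C g)"
        by (rule arg_cong)
      then show ?thesis by (simp add: tensor_sum_right tensor_scaleC_left tensor_scaleC_right)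
    qed
    then have "(\<Sum>t\<leftarrow>ts. f (fst t) \<otimes>\<^sub>H snd t) =
        (\<Sum>t\<leftarrow>ts. \<Sum>g\<in>F. (cinner g (snd t) *\<^sub>C f (fst t)) \<otimes>\<^sub>H g)"
      by (intro arg_cong[of _ _ sum_list] map_cong refl)
    also have "\<dots> = (\<Sum>g\<in>F. (\<Sum>t\<leftarrow>ts. cinner g (snd t) *\<^sub>C f (fst t)) \<otimes>\<^sub>H g)"
      by (simp add: tensor_sum_list_left sum_list_set_swap[OF F(1)])
    finally show ?thesis by (simp add: case_prod_unfold)
  qed
  have "(\<Sum>(x, y)\<leftarrow>ts. cinner g y *\<^sub>C (a *\<^sub>V x)) = a *\<^sub>V z g" for g
    by (simp add: z_def cblinfun_sum_list cblinfun_scaleC case_prod_unfold)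
  then have "(norm (\<Sum>(x, y)\<leftarrow>ts. (a *\<^sub>V x) \<otimes>\<^sub>H y))\<^sup>2 = (\<Sum>g\<in>F. (norm (a *\<^sub>V z g))\<^sup>2)"
    unfolding expand[of "\<lambda>x. a *\<^sub>V x"] by (simp add: norm_tensor_sum_orthonormal(2)[OF F(1,2)])
  also have "\<dots> \<le> K\<^sup>2 * (\<Sum>g\<in>F. (norm (z g))\<^sup>2)" by (intro orthonormal_sum_bound K)
  also have "\<dots> = (K * norm (\<Sum>(x, y)\<leftarrow>ts. x \<otimes>\<^sub>H y))\<^sup>2"
    unfolding expand[of "\<lambda>y. y"] power_mult_distrib norm_tensor_sum_orthonormal(2)[OF F(1,2)] z_def ..
  finally show ?thesis by (rule power2_le_imp_le) (simp add: K)
qed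

definition tensor_op :: "'a::complex_inner \<Rightarrow>\<^sub>C\<^sub>L 'c::complex_inner \<Rightarrow> 'b::complex_inner \<Rightarrow>\<^sub>C\<^sub>L 'd::complex_inner \<Rightarrow>
    ('a, 'b) htensor \<Rightarrow>\<^sub>C\<^sub>L ('c, 'd) htensor" (infixr \<open>\<otimes>\<^sub>O\<close> 71)
  where "a \<otimes>\<^sub>O b = (THE c. \<forall>x y. c *\<^sub>V (x \<otimes>\<^sub>H y) = (a *\<^sub>V x) \<otimes>\<^sub>H (b *\<^sub>V y))"

lemma tensor_op_ex1:
  fixes a :: "'a::complex_inner \<Rightarrow>\<^sub>C\<^sub>L 'c::complex_inner" and b :: "'b::complex_inner \<Rightarrow>\<^sub>C\<^sub>L 'd::complex_inner"
  shows "\<exists>!c. \<forall>x y. c *\<^sub>V (x \<otimes>\<^sub>H y) = (a *\<^sub>V x) \<otimes>\<^sub>H (b *\<^sub>V y)"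
proof -
  obtain K where K: "K \<ge> 0" "\<And>x. norm (a *\<^sub>V x) \<le> K * norm x" using cblinfun_bound by blast
  obtain L where L: "L \<ge> 0" "\<And>x. norm (b *\<^sub>V x) \<le> L * norm x" using cblinfun_bound by blast
  have "\<exists>!c. \<forall>i. c *\<^sub>V (case i of (x, y) \<Rightarrow> x \<otimes>\<^sub>H y) = (case i of (x, y) \<Rightarrow> (a *\<^sub>V x) \<otimes>\<^sub>H (b *\<^sub>V y))"
  proof (rule cblinfun_extension[OF tensor_total])
    fix ts :: "(complex \<times> 'a \<times> 'b) list"
    define us where "us = map (\<lambda>(c, x, y). (c *\<^sub>C x, y)) ts"
    define vs where "vs = map (\<lambda>(x, y). (x, b *\<^sub>V y)) us"
    have "(\<Sum>(c, i)\<leftarrow>ts. c *\<^sub>C (case i of (x, y) \<Rightarrow> (a *\<^sub>V x) \<otimes>\<^sub>H (b *\<^sub>V y))) = (\<Sum>(x, y)\<leftarrow>vs. (a *\<^sub>V x) \<otimes>\<^sub>H y)"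
      by (simp add: us_def vs_def comp_def case_prod_unfold cblinfun_scaleC tensor_scaleC_left)
    also have "norm \<dots> \<le> K * norm (\<Sum>(x, y)\<leftarrow>vs. x \<otimes>\<^sub>H y)" by (intro tensor_sum_bound_left K)
    also have "(\<Sum>(x, y)\<leftarrow>vs. x \<otimes>\<^sub>H y) = (\<Sum>(x, y)\<leftarrow>us. x \<otimes>\<^sub>H (b *\<^sub>V y))"
      by (simp add: vs_def comp_def case_prod_unfold)
    also have "K * norm \<dots> \<le> K * (L * norm (\<Sum>(x, y)\<leftarrow>us. x \<otimes>\<^sub>H y))"
      by (intro mult_left_mono tensor_sum_bound_right L K)
    also have "(\<Sum>(x, y)\<leftarrow>us. x \<otimes>\<^sub>H y) = (\<Sum>(c, i)\<leftarrow>ts. c *\<^sub>C (case i of (x, y) \<Rightarrow> x \<otimes>\<^sub>H y))"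
      by (simp add: us_def comp_def case_prod_unfold tensor_scaleC_left)
    finally show "norm (\<Sum>(c, i)\<leftarrow>ts. c *\<^sub>C (case i of (x, y) \<Rightarrow> (a *\<^sub>V x) \<otimes>\<^sub>H (b *\<^sub>V y)))
        \<le> (K * L) * norm (\<Sum>(c, i)\<leftarrow>ts. c *\<^sub>C (case i of (x, y) \<Rightarrow> x \<otimes>\<^sub>H y))"
      by (simp add: mult.assoc)
  qed
  then show ?thesis by simp
qed

lemma tensor_op_tensor: "(a \<otimes>\<^sub>O b) *\<^sub>V (x \<otimes>\<^sub>H y) = (a *\<^sub>V x) \<otimes>\<^sub>H (b *\<^sub>V y)"
  using theI'[OF tensor_op_ex1[of a b]] unfolding tensor_op_def by blast

lemma csubspace_closure:
  fixes C :: "'a::complex_inner set"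
  assumes "complex_vector.subspace C"
  shows "complex_vector.subspace (closure C)"
proof (rule complex_vector.subspaceI)
  show "0 \<in> closure C" using complex_vector.subspace_0[OF assms] closure_subset by blast
  show "x + y \<in> closure C" if xy: "x \<in> closure C" "y \<in> closure C" for x y
  proof -
    obtain X Y where XY: "\<And>n. X n \<in> C" "X \<longlonglongrightarrow> x" "\<And>n. Y n \<in> C" "Y \<longlonglongrightarrow> y"
      using xy unfolding closure_sequential by blast
    then show ?thesis
      unfolding closure_sequential
      by (intro exI[of _ "\<lambda>n. X n + Y n"] conjI allI tendsto_add complex_vector.subspace_add[OF assms])
  qed
  show "c *\<^sub>C x \<in> closure C" if x: "x \<in> closure C" for c x
  proof -
    obtain X where X: "\<And>n. X n \<in> C" "X \<longlonglongrightarrow> x"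
      using x unfolding closure_sequential by blast
    then show ?thesis
      unfolding closure_sequential
      by (intro exI[of _ "\<lambda>n. c *\<^sub>C X n"] conjI allI tendsto_scaleC tendsto_const
          complex_vector.subspace_scale[OF assms])
  qed
qed

lemma tensor3_total:
  "closure (cspan (range (\<lambda>(x, y, z).
    ((x::'a::complex_inner) \<otimes>\<^sub>H (y::'b::complex_inner)) \<otimes>\<^sub>H (z::'c::complex_inner)))) = UNIV"
  (is "closure (cspan ?E) = UNIV")
proof -
  let ?C = "closure (cspan ?E)"
  have sub: "complex_vector.subspace ?C"
    by (intro csubspace_closure complex_vector.subspace_span)
  have "u \<otimes>\<^sub>H z \<in> ?C" for u :: "('a, 'b) htensor" and z :: 'c
  proof -
    have "bounded_linear (\<lambda>u :: ('a, 'b) htensor. u \<otimes>\<^sub>H z)"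
      by (rule bounded_linear_intro[of _ "norm z"])
         (simp_all add: tensor_add_left scaleR_scaleC tensor_scaleC_left norm_tensor)
    then have "continuous_on UNIV (\<lambda>u :: ('a, 'b) htensor. u \<otimes>\<^sub>H z)"
      by (rule linear_continuous_on)
    then have "closed ((\<lambda>u :: ('a, 'b) htensor. u \<otimes>\<^sub>H z) -` ?C)"
      by (intro closed_vimage closed_closure)
    moreover have "cspan (range (\<lambda>(x, y). (x::'a) \<otimes>\<^sub>H (y::'b))) \<subseteq> (\<lambda>u. u \<otimes>\<^sub>H z) -` ?C"
    proof (rule complex_vector.span_minimal)
      show "range (\<lambda>(x, y). (x::'a) \<otimes>\<^sub>H (y::'b)) \<subseteq> (\<lambda>u. u \<otimes>\<^sub>H z) -` ?C"
      proof (clarsimp)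
        fix x :: 'a and y :: 'b
        have "(x \<otimes>\<^sub>H y) \<otimes>\<^sub>H z \<in> ?E" by (rule range_eqI[of _ _ "(x, y, z)"]) simp
        then show "(x \<otimes>\<^sub>H y) \<otimes>\<^sub>H z \<in> ?C"
          by (rule subsetD[OF closure_subset, OF complex_vector.span_base])
      qed
      show "complex_vector.subspace ((\<lambda>u :: ('a, 'b) htensor. u \<otimes>\<^sub>H z) -` ?C)"
        using complex_vector.subspace_0[OF sub] complex_vector.subspace_add[OF sub]
          complex_vector.subspace_scale[OF sub]
        by (intro complex_vector.subspaceI) (simp_all add: tensor_add_left tensor_scaleC_left)
    qed
    ultimately have "closure (cspan (range (\<lambda>(x, y). (x::'a) \<otimes>\<^sub>H (y::'b)))) \<subseteq> (\<lambda>u. u \<otimes>\<^sub>H z) -` ?C"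
      by (simp add: closure_minimal)
    then show ?thesis unfolding tensor_total by blast
  qed
  then have "range (\<lambda>(u, z). (u :: ('a, 'b) htensor) \<otimes>\<^sub>H (z::'c)) \<subseteq> ?C" by auto
  then have "cspan (range (\<lambda>(u, z). (u :: ('a, 'b) htensor) \<otimes>\<^sub>H (z::'c))) \<subseteq> ?C"
    using sub by (rule complex_vector.span_minimal)
  then have "closure (cspan (range (\<lambda>(u, z). (u :: ('a, 'b) htensor) \<otimes>\<^sub>H (z::'c)))) \<subseteq> ?C"
    by (rule closure_minimal) simp
  then show ?thesis unfolding tensor_total by blast
qed

lemma norm_sum_isometric:
  assumes "\<And>i j. cinner (f i) (f j) = cinner (e i) (e j)"
  shows "norm (\<Sum>(c, i)\<leftarrow>ts. c *\<^sub>C f i) = norm (\<Sum>(c, i)\<leftarrow>ts. c *\<^sub>C e i)"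
proof -
  have "complex_of_real ((norm (\<Sum>(c, i)\<leftarrow>ts. c *\<^sub>C f i))\<^sup>2) = complex_of_real ((norm (\<Sum>(c, i)\<leftarrow>ts. c *\<^sub>C e i))\<^sup>2)"
    unfolding cinner_self[symmetric]
    by (simp add: cinner_sum_list_left cinner_sum_list_right case_prod_unfold cinner_scaleC_left
        cinner_scaleC_right assms)
  then have "(norm (\<Sum>(c, i)\<leftarrow>ts. c *\<^sub>C f i))\<^sup>2 = (norm (\<Sum>(c, i)\<leftarrow>ts. c *\<^sub>C e i))\<^sup>2"
    by (simp only: of_real_eq_iff)
  then show ?thesis by simp
qed

definition tensor_assoc ::
  "(('a::complex_inner, 'b::complex_inner) htensor, 'c::complex_inner) htensor \<Rightarrow>\<^sub>C\<^sub>L ('a, ('b, 'c) htensor) htensor"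
  where "tensor_assoc = (THE \<alpha>. \<forall>x y z. \<alpha> *\<^sub>V ((x \<otimes>\<^sub>H y) \<otimes>\<^sub>H z) = x \<otimes>\<^sub>H (y \<otimes>\<^sub>H z))"

lemma tensor_assoc_ex1:
  "\<exists>!\<alpha> :: (('a::complex_inner, 'b::complex_inner) htensor, 'c::complex_inner) htensor \<Rightarrow>\<^sub>C\<^sub>L ('a, ('b, 'c) htensor) htensor.
    \<forall>x y z. \<alpha> *\<^sub>V ((x \<otimes>\<^sub>H y) \<otimes>\<^sub>H z) = x \<otimes>\<^sub>H (y \<otimes>\<^sub>H z)"
proof -
  let ?e = "\<lambda>(x::'a, y::'b, z::'c). (x \<otimes>\<^sub>H y) \<otimes>\<^sub>H z"
  let ?f = "\<lambda>(x::'a, y::'b, z::'c). x \<otimes>\<^sub>H (y \<otimes>\<^sub>H z)"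
  have "norm (\<Sum>(c, i)\<leftarrow>ts. c *\<^sub>C ?f i) \<le> 1 * norm (\<Sum>(c, i)\<leftarrow>ts. c *\<^sub>C ?e i)" for ts
    using norm_sum_isometric[of ?f ?e ts] by (simp add: case_prod_unfold cinner_tensor mult.assoc)
  then have "\<exists>!\<alpha>. \<forall>i. \<alpha> *\<^sub>V ?e i = ?f i"
    by (rule cblinfun_extension[OF tensor3_total])
  then show ?thesis by simp
qed

lemma tensor_assoc_tensor: "tensor_assoc *\<^sub>V ((x \<otimes>\<^sub>H y) \<otimes>\<^sub>H z) = x \<otimes>\<^sub>H (y \<otimes>\<^sub>H z)"
  using theI'[OF tensor_assoc_ex1] unfolding tensor_assoc_def by blast


section \<open>Arveson systems\<close>

definition bundle_borel :: "(real \<times> 'a::chilbert_space) measure"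
  where "bundle_borel = restrict_space borel ({0<..} \<times> UNIV)"

text \<open>The multiplication maps \<open>((s, x), (t, y))\<close> to \<open>(s + t, m s t x y)\<close>; its values outside of
  \<open>s, t > 0\<close> are irrelevant.\<close>

definition arveson_system ::
  "(real \<Rightarrow> real \<Rightarrow> 'a \<Rightarrow> 'a \<Rightarrow> 'a::separable_infinite_chilbert) \<Rightarrow> bool"
  where "arveson_system m \<longleftrightarrow>
    (\<lambda>((s, x), (t, y)). (s + t, m s t x y)) \<in> bundle_borel \<Otimes>\<^sub>M bundle_borel \<rightarrow>\<^sub>M bundle_borel \<and>
    (\<forall>r>0. \<forall>s>0. \<forall>t>0. \<forall>x y z. m (r + s) t (m r s x y) z = m r (s + t) x (m s t y z)) \<and>
    (\<forall>s>0. \<forall>t>0. \<exists>u. unitary u \<and> (\<forall>x y. u *\<^sub>V (x \<otimes>\<^sub>H y) = m s t x y))"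

definition system_unitary ::
  "(real \<Rightarrow> real \<Rightarrow> 'a \<Rightarrow> 'a \<Rightarrow> 'a::separable_infinite_chilbert) \<Rightarrow> real \<Rightarrow> real \<Rightarrow> ('a, 'a) htensor \<Rightarrow>\<^sub>C\<^sub>L 'a"
  where "system_unitary m s t = (THE u. \<forall>x y. u *\<^sub>V (x \<otimes>\<^sub>H y) = m s t x y)"

lemma cblinfun_eq_tensor:
  assumes "\<And>x y. u *\<^sub>V (x \<otimes>\<^sub>H y) = v *\<^sub>V (x \<otimes>\<^sub>H y)"
  shows "u = v"
  by (rule cblinfun_eq_total[OF tensor_total]) (use assms in auto)

lemma system_unitary:
  assumes "arveson_system m" "s > 0" "t > 0"
  shows "unitary (system_unitary m s t)" "system_unitary m s t *\<^sub>V (x \<otimes>\<^sub>H y) = m s t x y"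
proof -
  have "\<forall>s>0. \<forall>t>0. \<exists>u. unitary u \<and> (\<forall>x y. u *\<^sub>V (x \<otimes>\<^sub>H y) = m s t x y)"
    using assms(1) by (simp add: arveson_system_def)
  then obtain u where u: "unitary u" "\<And>x y. u *\<^sub>V (x \<otimes>\<^sub>H y) = m s t x y"
    using assms(2,3) by metis
  have "system_unitary m s t = u"
    unfolding system_unitary_def
    by (rule the_equality) (simp_all add: u cblinfun_eq_tensor)
  with u show "unitary (system_unitary m s t)" "system_unitary m s t *\<^sub>V (x \<otimes>\<^sub>H y) = m s t x y"
    by simp_all
qed

definition left_dilation ::
  "(real \<Rightarrow> real \<Rightarrow> 'a \<Rightarrow> 'a \<Rightarrow> 'a::separable_infinite_chilbert) \<Rightarrow>
    (real \<Rightarrow> ('h::chilbert_space, 'a) htensor \<Rightarrow>\<^sub>C\<^sub>L 'h) \<Rightarrow> bool"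
  where "left_dilation m v \<longleftrightarrow>
    (UNIV :: 'h set) \<noteq> {0} \<and>
    (\<forall>t>0. unitary (v t)) \<and>
    (\<forall>s>0. \<forall>t>0. v t o\<^sub>C\<^sub>L (v s \<otimes>\<^sub>O id_cblinfun) =
      v (s + t) o\<^sub>C\<^sub>L (id_cblinfun \<otimes>\<^sub>O system_unitary m s t) o\<^sub>C\<^sub>L tensor_assoc)"

definition right_dilation ::
  "(real \<Rightarrow> real \<Rightarrow> 'a \<Rightarrow> 'a \<Rightarrow> 'a::separable_infinite_chilbert) \<Rightarrow>
    (real \<Rightarrow> ('a, 'h::chilbert_space) htensor \<Rightarrow>\<^sub>C\<^sub>L 'h) \<Rightarrow> bool"
  where "right_dilation m w \<longleftrightarrow>
    (UNIV :: 'h set) \<noteq> {0} \<and>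
    (\<forall>t>0. unitary (w t)) \<and>
    (\<forall>s>0. \<forall>t>0. w t o\<^sub>C\<^sub>L (id_cblinfun \<otimes>\<^sub>O w s) o\<^sub>C\<^sub>L tensor_assoc =
      w (s + t) o\<^sub>C\<^sub>L (system_unitary m t s \<otimes>\<^sub>O id_cblinfun))"


section \<open>\<open>E\<^sub>0\<close>-semigroups\<close>

definition self_adjoint :: "('h::chilbert_space \<Rightarrow>\<^sub>C\<^sub>L 'h) \<Rightarrow> bool"
  where "self_adjoint a \<longleftrightarrow> adj a = a"

definition positive_op :: "('h::chilbert_space \<Rightarrow>\<^sub>C\<^sub>L 'h) \<Rightarrow> bool"
  where "positive_op a \<longleftrightarrow> (\<forall>x. cinner x (a *\<^sub>V x) \<in> \<real>\<^sub>\<ge>\<^sub>0)"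

definition op_le :: "('h::chilbert_space \<Rightarrow>\<^sub>C\<^sub>L 'h) \<Rightarrow> ('h \<Rightarrow>\<^sub>C\<^sub>L 'h) \<Rightarrow> bool"
  where "op_le a b \<longleftrightarrow> positive_op (b - a)"

definition is_op_sup :: "('h::chilbert_space \<Rightarrow>\<^sub>C\<^sub>L 'h) set \<Rightarrow> ('h \<Rightarrow>\<^sub>C\<^sub>L 'h) \<Rightarrow> bool"
  where "is_op_sup A s \<longleftrightarrow> self_adjoint s \<and> (\<forall>a\<in>A. op_le a s) \<and>
    (\<forall>b. self_adjoint b \<and> (\<forall>a\<in>A. op_le a b) \<longrightarrow> op_le s b)"

text \<open>Normality: suprema of bounded increasing nets of self-adjoint operators are preserved.\<close>

definition normal_map :: "(('h::chilbert_space \<Rightarrow>\<^sub>C\<^sub>L 'h) \<Rightarrow> ('h \<Rightarrow>\<^sub>C\<^sub>L 'h)) \<Rightarrow> bool"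
  where "normal_map \<phi> \<longleftrightarrow>
    (\<forall>A s. A \<noteq> {} \<and> (\<forall>a\<in>A. self_adjoint a) \<and> (\<forall>a\<in>A. \<forall>b\<in>A. \<exists>c\<in>A. op_le a c \<and> op_le b c) \<and>
      is_op_sup A s \<longrightarrow> is_op_sup (\<phi> ` A) (\<phi> s))"

definition unital_star_endomorphism :: "(('h::chilbert_space \<Rightarrow>\<^sub>C\<^sub>L 'h) \<Rightarrow> ('h \<Rightarrow>\<^sub>C\<^sub>L 'h)) \<Rightarrow> bool"
  where "unital_star_endomorphism \<phi> \<longleftrightarrow>
    (\<forall>a b. \<phi> (a + b) = \<phi> a + \<phi> b) \<and> (\<forall>c a. \<phi> (c *\<^sub>C a) = c *\<^sub>C \<phi> a) \<and>
    (\<forall>a b. \<phi> (a o\<^sub>C\<^sub>L b) = \<phi> a o\<^sub>C\<^sub>L \<phi> b) \<and> (\<forall>a. \<phi> (adj a) = adj (\<phi> a)) \<and>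
    \<phi> id_cblinfun = id_cblinfun"

text \<open>Semigroups are indexed by \<open>[0, \<infinity>)\<close>; the values at negative \<open>t\<close> are irrelevant. A unital
  \<open>*\<close>-endomorphism is an automorphism if and only if it is bijective.\<close>

definition E0_semigroup ::
  "(real \<Rightarrow> ('h::separable_infinite_chilbert \<Rightarrow>\<^sub>C\<^sub>L 'h) \<Rightarrow> ('h \<Rightarrow>\<^sub>C\<^sub>L 'h)) \<Rightarrow> bool"
  where "E0_semigroup \<theta> \<longleftrightarrow>
    \<theta> 0 = id \<and> (\<forall>s\<ge>0. \<forall>t\<ge>0. \<theta> (s + t) = \<theta> s \<circ> \<theta> t) \<and>
    (\<forall>t\<ge>0. unital_star_endomorphism (\<theta> t) \<and> normal_map (\<theta> t)) \<and>
    (\<forall>t>0. \<not> bij (\<theta> t))"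

definition strongly_continuous ::
  "(real \<Rightarrow> ('h::chilbert_space \<Rightarrow>\<^sub>C\<^sub>L 'h) \<Rightarrow> ('h \<Rightarrow>\<^sub>C\<^sub>L 'h)) \<Rightarrow> bool"
  where "strongly_continuous \<theta> \<longleftrightarrow> (\<forall>a x. continuous_on {0..} (\<lambda>t. \<theta> t a *\<^sub>V x))"

definition has_Bhat_system ::
  "(real \<Rightarrow> ('h::chilbert_space \<Rightarrow>\<^sub>C\<^sub>L 'h) \<Rightarrow> ('h \<Rightarrow>\<^sub>C\<^sub>L 'h)) \<Rightarrow>
    (real \<Rightarrow> real \<Rightarrow> 'a \<Rightarrow> 'a \<Rightarrow> 'a::separable_infinite_chilbert) \<Rightarrow> bool"
  where "has_Bhat_system \<theta> m \<longleftrightarrow>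
    (\<exists>v. left_dilation m v \<and>
      (\<forall>a. \<forall>t>0. \<theta> t a = v t o\<^sub>C\<^sub>L (a \<otimes>\<^sub>O id_cblinfun) o\<^sub>C\<^sub>L adj (v t)))"

definition has_Arveson_system ::
  "(real \<Rightarrow> ('h::chilbert_space \<Rightarrow>\<^sub>C\<^sub>L 'h) \<Rightarrow> ('h \<Rightarrow>\<^sub>C\<^sub>L 'h)) \<Rightarrow>
    (real \<Rightarrow> real \<Rightarrow> 'a \<Rightarrow> 'a \<Rightarrow> 'a::separable_infinite_chilbert) \<Rightarrow> bool"
  where "has_Arveson_system \<theta> m \<longleftrightarrow>
    (\<exists>w. right_dilation m w \<and>
      (\<forall>a. \<forall>t>0. \<theta> t a = w t o\<^sub>C\<^sub>L (id_cblinfun \<otimes>\<^sub>O a) o\<^sub>C\<^sub>L adj (w t)))"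

end

theory Submission
  imports Defs "HOL-Library.Function_Algebras"
begin

text \<open>
  The semigroup is obtained by letting the system act by left multiplication on its own sections
  (Arveson's construction). Fix a unit vector \<open>e\<close> of \<open>E\<^sub>1\<close> and consider the measurable sections \<open>f\<close>
  with \<open>f (r + 1) = f r \<cdot> e\<close> for all large \<open>r\<close>. Multiplication by \<open>e\<close> is isometric, so
  \<open>r \<mapsto> \<langle>f r, g r\<rangle>\<close> is eventually periodic, and its integral over a far unit interval defines a
  semi-inner product \<open>B\<close>. For \<open>y\<close> in \<open>E\<^sub>t\<close> the translate \<open>(y f) r = y \<cdot> f (r - t)\<close> is again stable, by
  associativity, and \<open>B (y f) (z g) = \<langle>y, z\<rangle> B f g\<close>. Hence \<open>y \<otimes> f \<mapsto> y f\<close> is an isometry \<open>w\<^sub>t\<close> of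
  \<open>E\<^sub>t \<otimes> H\<close> into \<open>H\<close>, where \<open>H\<close> is the Hilbert space of stable sections, and associativity is exactly the
  equation of a right dilation. It is onto (\<open>translate_total\<close>): since \<open>E\<^sub>r\<close> is \<open>E\<^sub>t \<otimes> E\<^bsub>r - t\<^esub>\<close>, expanding
  \<open>f r\<close> along an orthonormal basis of \<open>E\<^sub>t\<close> writes \<open>f\<close> as a series of translates of its coefficients, and
  these are stable sections.

  The Hilbert space is prescribed by the type \<open>'h\<close>. So \<open>H\<close> is not built as a completion; instead
  \<open>isometric_realization\<close> maps a separable, infinite-dimensional semi-inner product space isometrically
  onto a dense subset of \<open>'h\<close>, by Gram-Schmidt along a dense sequence. Separability of the stable
  sections (\<open>sections_separable\<close>) comes from sections that are step functions on a unit interval.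

  Put \<open>\<theta>\<^sub>t a = w\<^sub>t (1 \<otimes> a) w\<^sub>t\<^sup>*\<close>. Normality (\<open>amplify_normal\<close>) holds because a bounded increasing net
  converges weakly to its supremum and \<open>a \<mapsto> 1 \<otimes> a\<close> preserves weak limits of bounded nets; \<open>\<theta>\<^sub>t\<close> is not
  onto, as \<open>p \<otimes> 1\<close> is not of the form \<open>1 \<otimes> a\<close> for a projection \<open>p\<close> of rank one.

  Strong continuity needs only that matrix coefficients of \<open>w\<close> are measurable. The vectors
  \<open>\<xi>\<^sub>r = w\<^sub>r\<^sup>* x\<close> lie in a separable space, so they stay within a small ball for \<open>r\<close> in a set of positive
  measure in \<open>(0, t)\<close>. By Steinhaus' theorem this set meets all its small shifts: for every small \<open>h\<close>
  there is \<open>r < t\<close> with \<open>\<xi>\<^bsub>r + h\<^esub>\<close> close to \<open>\<xi>\<^sub>r\<close>. As \<open>\<theta>\<^sub>t = \<theta>\<^sub>r \<theta>\<^bsub>t - r\<^esub>\<close> and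
  \<open>\<theta>\<^bsub>t + h\<^esub> = \<theta>\<^bsub>r + h\<^esub> \<theta>\<^bsub>t - r\<^esub>\<close>, the numbers \<open>\<langle>x, \<theta>\<^bsub>t + h\<^esub>(a) x\<rangle>\<close> and \<open>\<langle>x, \<theta>\<^sub>t(a) x\<rangle>\<close> are close. Weak
  continuity on \<open>(0, \<infinity>)\<close> becomes strong because \<open>\<theta>\<^sub>t\<close> is multiplicative, and it reaches \<open>0\<close> because the
  isometry \<open>h \<mapsto> w\<^sub>1 (y \<otimes> h)\<close> intertwines \<open>\<theta>\<^sub>t\<close> with \<open>\<theta>\<^bsub>1 + t\<^esub>\<close>.

  Finally, the reversed multiplication \<open>(x, y) \<mapsto> y x\<close> is again an Arveson system, and exchanging the
  tensor factors turns its right dilations into left dilations of the given system.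
\<close>

section \<open>Orthonormalization in semi-inner product spaces\<close>

text \<open>Series that satisfy the Cauchy criterion converge in Hilbert spaces.\<close>

instance chilbert_space \<subseteq> banach ..

text \<open>Sections are functions; with the pointwise operations they form a complex vector space, so that
  spans and finite sums of sections are available.\<close>

instantiation "fun" :: (type, scaleR) scaleR
begin
definition "scaleR_fun r f = (\<lambda>x. r *\<^sub>R f x)"
instance ..
end

instantiation "fun" :: (type, scaleC) scaleC
begin
definition "scaleC_fun c f = (\<lambda>x. c *\<^sub>C f x)"
instance ..
end

lemma scaleC_fun_apply [simp]: "(c *\<^sub>C f) x = c *\<^sub>C f x"
  by (simp add: scaleC_fun_def)

instance "fun" :: (type, real_vector) real_vector
  by standard (simp_all add: fun_eq_iff scaleR_fun_def scaleR_add_right scaleR_add_left)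

instance "fun" :: (type, complex_vector) complex_vector
  by standard (simp_all add: fun_eq_iff scaleR_fun_def scaleC_add_right scaleC_add_left
      scaleC_scaleC scaleC_one scaleR_scaleC)

lemma sum_fun_apply: "(\<Sum>i\<in>A. f i) x = (\<Sum>i\<in>A. f i x)" for f :: "'i \<Rightarrow> 'r \<Rightarrow> 'w::comm_monoid_add"
  by (induction A rule: infinite_finite_induct) auto

text \<open>The form is positive semidefinite on a subspace of the ambient type only: stable sections are a
  subspace of all functions, and sections that vanish eventually have length zero.\<close>

locale semi_inner_space =
  fixes S :: "'v::complex_vector set" and B :: "'v \<Rightarrow> 'v \<Rightarrow> complex"
  assumes subspace: "complex_vector.subspace S"
    and add_right: "x \<in> S \<Longrightarrow> y \<in> S \<Longrightarrow> z \<in> S \<Longrightarrow> B x (y + z) = B x y + B x z"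
    and scaleC_right: "x \<in> S \<Longrightarrow> y \<in> S \<Longrightarrow> B x (c *\<^sub>C y) = c * B x y"
    and commute: "x \<in> S \<Longrightarrow> y \<in> S \<Longrightarrow> B x y = cnj (B y x)"
    and nonneg: "x \<in> S \<Longrightarrow> 0 \<le> Re (B x x)"
begin

definition sq :: "'v \<Rightarrow> real"
  where "sq x = Re (B x x)"

definition proj :: "'v set \<Rightarrow> 'v \<Rightarrow> 'v"
  where "proj F x = (\<Sum>g\<in>F. B g x *\<^sub>C g)"

definition ortho :: "'v set \<Rightarrow> bool"
  where "ortho F \<longleftrightarrow> F \<subseteq> S \<and> (\<forall>g\<in>F. \<forall>h\<in>F. B g h = (if g = h then 1 else 0))"

text \<open>The squared distance from the span of a finite orthonormal set.\<close>

definition res :: "'v set \<Rightarrow> 'v \<Rightarrow> real"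
  where "res F x = sq (x - proj F x)"

text \<open>The closure of the span of \<open>D\<close> with respect to the seminorm.\<close>

definition approximable :: "'v set \<Rightarrow> 'v set"
  where "approximable D = {f \<in> S. \<forall>e>0. \<exists>g\<in>cspan D. sq (f - g) < e}"

lemma mem_zero [simp]: "0 \<in> S"
  by (rule complex_vector.subspace_0[OF subspace])

lemma mem_add [simp]: "x \<in> S \<Longrightarrow> y \<in> S \<Longrightarrow> x + y \<in> S"
  by (rule complex_vector.subspace_add[OF subspace])

lemma mem_scale [simp]: "x \<in> S \<Longrightarrow> c *\<^sub>C x \<in> S"
  by (rule complex_vector.subspace_scale[OF subspace])

lemma mem_diff [simp]: "x \<in> S \<Longrightarrow> y \<in> S \<Longrightarrow> x - y \<in> S"
  by (rule complex_vector.subspace_diff[OF subspace])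

lemma mem_sum: "(\<And>i. i \<in> A \<Longrightarrow> f i \<in> S) \<Longrightarrow> (\<Sum>i\<in>A. f i) \<in> S"
  by (rule complex_vector.subspace_sum[OF subspace])

lemma mem_proj: "ortho F \<Longrightarrow> proj F x \<in> S"
  unfolding proj_def by (rule mem_sum) (auto simp: ortho_def)

lemma zero_right [simp]: "x \<in> S \<Longrightarrow> B x 0 = 0"
  using add_right[of x 0 0] by simp

lemma diff_right: "x \<in> S \<Longrightarrow> y \<in> S \<Longrightarrow> z \<in> S \<Longrightarrow> B x (y - z) = B x y - B x z"
  using add_right[of x "y - z" z] by (simp add: algebra_simps)

lemma sum_right: "x \<in> S \<Longrightarrow> (\<And>i. i \<in> A \<Longrightarrow> f i \<in> S) \<Longrightarrow> B x (\<Sum>i\<in>A. f i) = (\<Sum>i\<in>A. B x (f i))"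
  by (induction A rule: infinite_finite_induct) (auto simp: add_right mem_sum)

lemma add_left: "x \<in> S \<Longrightarrow> y \<in> S \<Longrightarrow> z \<in> S \<Longrightarrow> B (x + y) z = B x z + B y z"
  using commute[of "x + y" z] commute[of x z] commute[of y z] by (simp add: add_right)

lemma scaleC_left: "x \<in> S \<Longrightarrow> y \<in> S \<Longrightarrow> B (c *\<^sub>C x) y = cnj c * B x y"
  using commute[of "c *\<^sub>C x" y] commute[of x y] by (simp add: scaleC_right)

lemma diff_left: "x \<in> S \<Longrightarrow> y \<in> S \<Longrightarrow> z \<in> S \<Longrightarrow> B (x - y) z = B x z - B y z"
  using commute[of "x - y" z] commute[of x z] commute[of y z] by (simp add: diff_right)

lemma self_eq: "x \<in> S \<Longrightarrow> B x x = complex_of_real (sq x)"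
  using arg_cong[OF commute[of x x], of Im] by (simp add: sq_def complex_eq_iff)

lemma sq_nonneg: "x \<in> S \<Longrightarrow> 0 \<le> sq x"
  by (simp add: sq_def nonneg)

lemma sq_zero [simp]: "sq 0 = 0"
  by (simp add: sq_def)

lemma sq_add: "x \<in> S \<Longrightarrow> y \<in> S \<Longrightarrow> sq (x + y) = sq x + sq y + 2 * Re (B x y)"
  using arg_cong[OF commute[of x y], of Re] by (simp add: sq_def add_right add_left)

lemma sq_diff: "x \<in> S \<Longrightarrow> y \<in> S \<Longrightarrow> sq (x - y) = sq x + sq y - 2 * Re (B x y)"
  using arg_cong[OF commute[of x y], of Re] by (simp add: sq_def diff_right diff_left)

lemma sq_scaleC:
  assumes "x \<in> S"
  shows "sq (c *\<^sub>C x) = (cmod c)\<^sup>2 * sq x"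
proof -
  have "B (c *\<^sub>C x) (c *\<^sub>C x) = cnj c * (c * complex_of_real (sq x))"
    using assms by (simp add: scaleC_left scaleC_right) (simp add: self_eq)
  also have "\<dots> = complex_of_real ((cmod c)\<^sup>2 * sq x)"
    unfolding of_real_mult complex_norm_square by (simp only: mult_ac)
  finally show ?thesis by (simp only: sq_def Re_complex_of_real)
qed

lemma sq_add_le: "x \<in> S \<Longrightarrow> y \<in> S \<Longrightarrow> sq (x + y) \<le> 2 * sq x + 2 * sq y"
  using sq_add[of x y] sq_diff[of x y] sq_nonneg[of "x - y"] by simp

lemma B_proj:
  assumes "finite F" "ortho F" "g \<in> F"
  shows "B g (proj F x) = B g x"
proof -
  have "B g (proj F x) = (\<Sum>h\<in>F. B h x * B g h)"
    unfolding proj_def using assms by (subst sum_right) (auto simp: ortho_def scaleC_right subset_iff)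
  also have "\<dots> = (\<Sum>h\<in>F. if g = h then B g x else 0)"
    using assms by (intro sum.cong) (auto simp: ortho_def)
  finally show ?thesis using assms by simp
qed

lemma res_eq:
  assumes "finite F" "ortho F" "x \<in> S"
  shows "res F x = sq x - (\<Sum>g\<in>F. (cmod (B g x))\<^sup>2)"
proof -
  have FS: "g \<in> S" if "g \<in> F" for g using assms(2) that by (auto simp: ortho_def)
  have B: "B y (proj F x) = (\<Sum>g\<in>F. B g x * B y g)" if "y \<in> S" for y
    unfolding proj_def using that FS by (subst sum_right) (auto simp: scaleC_right)
  have p: "B x (proj F x) = complex_of_real (\<Sum>g\<in>F. (cmod (B g x))\<^sup>2)"
    unfolding B[OF assms(3)] of_real_sum
    using commute[OF assms(3) FS] by (intro sum.cong) (simp_all add: complex_norm_square del: of_real_power)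
  have "B (proj F x) (proj F x) = (\<Sum>g\<in>F. B g x * B (proj F x) g)"
    by (rule B[OF mem_proj[OF assms(2)]])
  also have "\<dots> = (\<Sum>g\<in>F. B g x * cnj (B g (proj F x)))"
    using commute[OF mem_proj[OF assms(2)] FS] by (intro sum.cong) simp_all
  also have "\<dots> = B x (proj F x)"
    unfolding p of_real_sum by (intro sum.cong) (simp_all add: B_proj assms complex_norm_square del: of_real_power)
  finally show ?thesis
    unfolding res_def using assms(3) mem_proj[OF assms(2)] p
    by (simp add: sq_diff) (simp add: sq_def)
qed

lemma res_nonneg: "ortho F \<Longrightarrow> x \<in> S \<Longrightarrow> 0 \<le> res F x"
  unfolding res_def by (intro sq_nonneg mem_diff mem_proj)

lemma res_mono:
  assumes "finite G" "ortho G" "F \<subseteq> G" "x \<in> S"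
  shows "res G x \<le> res F x"
proof -
  have "finite F" "ortho F" using assms finite_subset by (auto simp: ortho_def subset_iff)
  moreover have "(\<Sum>g\<in>F. (cmod (B g x))\<^sup>2) \<le> (\<Sum>g\<in>G. (cmod (B g x))\<^sup>2)"
    by (rule sum_mono2) (use assms in auto)
  ultimately show ?thesis using assms by (simp add: res_eq)
qed

lemma res_le_sq: "finite F \<Longrightarrow> ortho F \<Longrightarrow> x \<in> S \<Longrightarrow> res F x \<le> sq x"
  by (simp add: res_eq sum_nonneg)

text \<open>The projection is linear, so the distance from the span is a seminorm whose square satisfies this
  weak form of the parallelogram law; this makes sets of well approximated vectors into subspaces.\<close>

lemma res_add:
  assumes "ortho F" "x \<in> S" "y \<in> S"
  shows "res F (x + y) \<le> 2 * res F x + 2 * res F y"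
proof -
  have "proj F (x + y) = proj F x + proj F y"
    using assms by (simp add: proj_def sum.distrib[symmetric] ortho_def subset_iff add_right
        scaleC_add_left cong: sum.cong)
  then have "x + y - proj F (x + y) = (x - proj F x) + (y - proj F y)" by simp
  then show ?thesis unfolding res_def using assms by (simp only: sq_add_le mem_diff mem_proj)
qed

lemma res_scaleC:
  assumes "ortho F" "x \<in> S"
  shows "res F (c *\<^sub>C x) = (cmod c)\<^sup>2 * res F x"
proof -
  have "proj F (c *\<^sub>C x) = c *\<^sub>C proj F x"
    using assms by (simp add: proj_def complex_vector.scale_sum_right ortho_def subset_iff scaleC_right
        scaleC_scaleC cong: sum.cong)
  then have "c *\<^sub>C x - proj F (c *\<^sub>C x) = c *\<^sub>C (x - proj F x)"
    by (simp add: complex_vector.scale_right_diff_distrib)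
  then show ?thesis unfolding res_def using assms by (simp add: sq_scaleC mem_proj)
qed

text \<open>One step of Gram-Schmidt: normalize \<open>x - proj F x\<close>. If this vector has length zero, \<open>F\<close> already
  approximates \<open>x\<close>.\<close>

lemma ortho_extend:
  assumes "finite F" "ortho F" "x \<in> S"
  obtains G where "finite G" "ortho G" "F \<subseteq> G" "res G x = 0"
proof (cases "res F x = 0")
  case True
  show ?thesis using assms(1,2) subset_refl True by (rule that)
next
  case False
  define r where "r = x - proj F x"
  define n where "n = sqrt (sq r)"
  define e where "e = complex_of_real (inverse n) *\<^sub>C r"
  have FS: "g \<in> S" if "g \<in> F" for g using assms(2) that by (auto simp: ortho_def)
  have r: "r \<in> S" using assms by (simp add: r_def mem_proj)
  then have e: "e \<in> S" by (simp add: e_def)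
  have pos: "n > 0" "sq r = n\<^sup>2" using False sq_nonneg[OF r] by (simp_all add: res_def r_def n_def)
  have Fr: "B g r = 0" if "g \<in> F" for g
    using assms that FS by (simp add: r_def diff_right mem_proj B_proj)
  have Fe1: "B g e = 0" if "g \<in> F" for g
    unfolding e_def using Fr[OF that] FS[OF that] r by (subst scaleC_right) auto
  have Fe2: "B e g = 0" if "g \<in> F" for g
    by (subst commute[OF e FS[OF that]]) (simp add: Fe1 that)
  note Fe = Fe1 Fe2
  have "B e r = cnj (complex_of_real (inverse n)) * complex_of_real (n\<^sup>2)"
    unfolding e_def scaleC_left[OF r r] self_eq[OF r] pos(2) ..
  then have er: "B e r = of_real n"
    using pos(1) by (simp add: power2_eq_square)
  have "B e e = complex_of_real (inverse n) * B e r"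
    by (subst (2) e_def) (rule scaleC_right[OF e r])
  then have ee: "B e e = 1" using er pos(1) by simp
  have "e \<notin> F" using Fe ee by force
  have on: "ortho (insert e F)"
    using assms(2) Fe ee e by (auto simp: ortho_def)
  have "B e (proj F x) = 0"
    unfolding proj_def using e FS Fe by (subst sum_right) (auto simp: scaleC_right)
  moreover have "B e x = B e (r + proj F x)" by (simp add: r_def)
  ultimately have "B e x = of_real n" using add_right[OF e r mem_proj[OF assms(2), of x]] er by simp
  then have "res (insert e F) x = res F x - n\<^sup>2"
    using assms on \<open>e \<notin> F\<close> by (simp add: res_eq)
  also have "\<dots> = 0" using pos(2) by (simp add: res_def r_def)
  finally have "res (insert e F) x = 0" .
  then show ?thesis by (intro that[of "insert e F"]) (use assms on in auto)
qed

lemma approximable_mem: "x \<in> approximable D \<Longrightarrow> x \<in> S"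
  by (simp add: approximable_def)

lemma approximable_subspace:
  assumes "D \<subseteq> S"
  shows "complex_vector.subspace (approximable D)"
proof (rule complex_vector.subspaceI)
  have sp: "cspan D \<subseteq> S" by (rule complex_vector.span_minimal[OF assms subspace])
  show "0 \<in> approximable D"
    by (auto simp: approximable_def intro!: bexI[of _ 0] complex_vector.span_zero)
  show "x + y \<in> approximable D" if xy: "x \<in> approximable D" "y \<in> approximable D" for x y
    unfolding approximable_def
  proof (intro CollectI conjI allI impI)
    show "x + y \<in> S" using that approximable_mem by simp
    fix e :: real assume "e > 0"
    then have "e / 4 > 0" by simp
    obtain g where g: "g \<in> cspan D" "sq (x - g) < e / 4"
      using xy(1) \<open>e / 4 > 0\<close> unfolding approximable_def by blast
    obtain h where h: "h \<in> cspan D" "sq (y - h) < e / 4"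
      using xy(2) \<open>e / 4 > 0\<close> unfolding approximable_def by blast
    note gh = g(1) h(1) g(2) h(2)
    have "x - g \<in> S" "y - h \<in> S" using xy[THEN approximable_mem] g(1) h(1) sp by auto
    from sq_add_le[OF this] have "sq (x + y - (g + h)) \<le> 2 * sq (x - g) + 2 * sq (y - h)"
      by (simp add: algebra_simps)
    with gh show "\<exists>g\<in>cspan D. sq (x + y - g) < e"
      by (intro bexI[of _ "g + h"] complex_vector.span_add) auto
  qed
  show "c *\<^sub>C x \<in> approximable D" if x: "x \<in> approximable D" for c x
    unfolding approximable_def
  proof (intro CollectI conjI allI impI)
    show "c *\<^sub>C x \<in> S" using that approximable_mem by simp
    fix e :: real assume "e > 0"
    then have "e / ((cmod c)\<^sup>2 + 1) > 0" by (simp add: add_nonneg_pos)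
    then obtain g where g: "g \<in> cspan D" "sq (x - g) < e / ((cmod c)\<^sup>2 + 1)"
      using x unfolding approximable_def by blast
    have xg: "x - g \<in> S" using approximable_mem[OF x] g(1) sp by auto
    have "sq (c *\<^sub>C x - c *\<^sub>C g) = (cmod c)\<^sup>2 * sq (x - g)"
      unfolding complex_vector.scale_right_diff_distrib[symmetric] by (rule sq_scaleC[OF xg])
    also have "\<dots> \<le> ((cmod c)\<^sup>2 + 1) * sq (x - g)"
      by (rule mult_right_mono) (simp_all add: sq_nonneg[OF xg])
    also have "\<dots> < e" using g(2) by (simp add: pos_less_divide_eq add_nonneg_pos mult.commute)
    finally show "\<exists>g\<in>cspan D. sq (c *\<^sub>C x - g) < e"
      using g by (intro bexI[of _ "c *\<^sub>C g"] complex_vector.span_scale) auto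
  qed
qed

lemma approximable_closed:
  assumes "D \<subseteq> S" "f \<in> S" and appr: "\<And>e. e > 0 \<Longrightarrow> \<exists>g\<in>approximable D. sq (f - g) < e"
  shows "f \<in> approximable D"
  unfolding approximable_def
proof (intro CollectI conjI allI impI)
  have sp: "cspan D \<subseteq> S" by (rule complex_vector.span_minimal[OF assms(1) subspace])
  fix e :: real assume "e > 0"
  then have "e / 4 > 0" by simp
  with appr obtain g where g: "g \<in> approximable D" "sq (f - g) < e / 4" by blast
  obtain h where h: "h \<in> cspan D" "sq (g - h) < e / 4"
    using g(1) \<open>e / 4 > 0\<close> unfolding approximable_def by blast
  have "f - g \<in> S" "g - h \<in> S" using assms(2) approximable_mem[OF g(1)] h(1) sp by auto
  from sq_add_le[OF this] have "sq (f - h) \<le> 2 * sq (f - g) + 2 * sq (g - h)" by simp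
  with g h show "\<exists>g\<in>cspan D. sq (f - g) < e" by (intro bexI[of _ h]) auto
qed (rule assms)

lemma ortho_subset: "ortho G \<Longrightarrow> F \<subseteq> G \<Longrightarrow> ortho F"
  unfolding ortho_def by blast

text \<open>Gram-Schmidt along a dense sequence. In every step one more vector outside of the current span is
  added, which forces the resulting orthonormal system to be infinite, hence enumerable by \<open>\<nat>\<close>. The
  conclusion is Parseval's identity; it is stated through squared coefficients because the space is
  not complete.\<close>

theorem total_orthonormal_sequence:
  assumes D: "countable D" "D \<subseteq> S" "S \<subseteq> approximable D"
    and inf: "\<And>F. finite F \<Longrightarrow> ortho F \<Longrightarrow> \<exists>x\<in>S. res F x \<noteq> 0"
  shows "\<exists>g :: nat \<Rightarrow> 'v. (\<forall>i. g i \<in> S) \<and> (\<forall>i j. B (g i) (g j) = (if i = j then 1 else 0)) \<and>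
    (\<forall>x\<in>S. (\<lambda>n. (cmod (B (g n) x))\<^sup>2) sums sq x)"
proof -
  define d where "d = from_nat_into (insert 0 D)"
  have d: "range d = insert 0 D" unfolding d_def by (rule range_from_nat_into) (use D in auto)
  have dS: "d n \<in> S" for n using d D(2) by (metis insert_iff mem_zero rangeI subsetD)
  have "\<exists>F. \<forall>n. (finite (F n) \<and> ortho (F n)) \<and> (F n \<subset> F (Suc n) \<and> res (F (Suc n)) (d n) = 0)"
  proof (rule dependent_nat_choice)
    show "\<exists>F. finite F \<and> ortho F" by (rule exI[of _ "{}"]) (simp add: ortho_def)
    fix F n assume F: "finite F \<and> ortho F"
    then obtain x where x: "x \<in> S" "res F x \<noteq> 0" using inf by blast
    obtain G where G: "finite G" "ortho G" "F \<subseteq> G" "res G x = 0"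
      by (rule ortho_extend[OF conjunct1[OF F] conjunct2[OF F] x(1)])
    obtain G' where G': "finite G'" "ortho G'" "G \<subseteq> G'" "res G' (d n) = 0"
      by (rule ortho_extend[OF G(1,2) dS])
    have "F \<noteq> G" using G(4) x(2) by auto
    then have "F \<subset> G'" using G(3) G'(3) by blast
    with G' show "\<exists>G. (finite G \<and> ortho G) \<and> F \<subset> G \<and> res G (d n) = 0"
      by (intro exI[of _ G'] conjI)
  qed
  then obtain F where "\<forall>n. (finite (F n) \<and> ortho (F n)) \<and> (F n \<subset> F (Suc n) \<and> res (F (Suc n)) (d n) = 0)" ..
  then have F: "\<And>n. finite (F n)" "\<And>n. ortho (F n)" "\<And>n. F n \<subset> F (Suc n)"
    "\<And>n. res (F (Suc n)) (d n) = 0" by simp_all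
  have Fmono: "F i \<subseteq> F j" if "i \<le> j" for i j
    by (rule lift_Suc_mono_le[of F, OF psubset_imp_subset[OF F(3)] that])
  have Fcard: "n \<le> card (F n)" for n
  proof (induction n)
    case (Suc n)
    then show ?case using psubset_card_mono[OF F(1) F(3), of n] by linarith
  qed simp
  define U where "U = (\<Union>n. F n)"
  have "infinite U"
  proof
    assume "finite U"
    then have "card (F (Suc (card U))) \<le> card U" by (intro card_mono) (auto simp: U_def)
    then show False using Fcard[of "Suc (card U)"] by simp
  qed
  have "countable U" unfolding U_def using F(1) by (intro countable_UN) (auto intro: countable_finite)
  define g where "g = from_nat_into U"
  have bij: "bij_betw g UNIV U"
    unfolding g_def using \<open>countable U\<close> \<open>infinite U\<close> by (rule bij_betw_from_nat_into)
  have oU: "ortho U"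
    unfolding ortho_def
  proof (intro conjI ballI)
    show "U \<subseteq> S" using F(2) by (auto simp: U_def ortho_def)
    fix x y assume "x \<in> U" "y \<in> U"
    then obtain i j where "x \<in> F i" "y \<in> F j" by (auto simp: U_def)
    then have "x \<in> F (max i j)" "y \<in> F (max i j)" using Fmono by (meson max.cobounded1 max.cobounded2 subsetD)+
    then show "B x y = (if x = y then 1 else 0)" using F(2)[of "max i j"] by (auto simp: ortho_def)
  qed
  have gU: "g i \<in> U" for i using bij by (auto simp: bij_betw_def)
  have ginj: "inj g" using bij by (auto simp: bij_betw_def)
  \<comment> \<open>The vectors approximated by the increasing spans form a subspace; it contains the dense sequence.\<close>
  define V where "V = {x \<in> S. \<forall>e>0. \<exists>n. res (F n) x < e}"
  have Vlarge: "\<exists>N. \<forall>n\<ge>N. res (F n) x < e" if xe: "x \<in> V" "e > 0" for x e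
  proof -
    obtain N where "res (F N) x < e" "x \<in> S" using xe by (auto simp: V_def)
    then show ?thesis using res_mono[OF F(1,2) Fmono] by (intro exI[of _ N]) (meson le_less_trans)
  qed
  have "complex_vector.subspace V"
  proof (rule complex_vector.subspaceI)
    have "res (F 0) 0 \<le> 0" using res_le_sq[OF F(1,2) mem_zero, of 0] by simp
    then show "0 \<in> V" by (auto simp: V_def intro!: exI[of _ 0])
    show "x + y \<in> V" if xy: "x \<in> V" "y \<in> V" for x y
    proof -
      have "\<exists>n. res (F n) (x + y) < e" if "e > 0" for e
      proof -
        obtain M N where "\<forall>n\<ge>M. res (F n) x < e / 4" "\<forall>n\<ge>N. res (F n) y < e / 4"
          using Vlarge[OF xy(1), of "e/4"] Vlarge[OF xy(2), of "e/4"] \<open>e > 0\<close> by auto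
        then have "res (F (max M N)) x < e / 4" "res (F (max M N)) y < e / 4" by simp_all
        then show ?thesis using res_add[OF F(2), of x y "max M N"] xy
          by (intro exI[of _ "max M N"]) (auto simp: V_def)
      qed
      then show ?thesis using xy by (auto simp: V_def)
    qed
    show "c *\<^sub>C x \<in> V" if x: "x \<in> V" for c x
    proof -
      have "\<exists>n. res (F n) (c *\<^sub>C x) < e" if "e > 0" for e
      proof -
        have p: "(cmod c)\<^sup>2 + 1 > 0" by (simp add: add_nonneg_pos)
        then have "e / ((cmod c)\<^sup>2 + 1) > 0" using \<open>e > 0\<close> by simp
        then obtain N where N: "res (F N) x < e / ((cmod c)\<^sup>2 + 1)"
          using x unfolding V_def by blast
        have xS: "x \<in> S" using x by (simp add: V_def)
        have "res (F N) (c *\<^sub>C x) = (cmod c)\<^sup>2 * res (F N) x" by (rule res_scaleC[OF F(2) xS])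
        also have "\<dots> \<le> ((cmod c)\<^sup>2 + 1) * res (F N) x"
          by (rule mult_right_mono) (simp_all add: res_nonneg[OF F(2) xS])
        also have "\<dots> < e" using N p by (simp add: pos_less_divide_eq mult.commute)
        finally show ?thesis by blast
      qed
      then show ?thesis using x by (auto simp: V_def)
    qed
  qed
  moreover have "D \<subseteq> V"
  proof
    fix x assume "x \<in> D"
    then obtain n where "x = d n" using d by blast
    then show "x \<in> V" using F(4)[of n] dS by (auto simp: V_def intro!: exI[of _ "Suc n"])
  qed
  ultimately have DV: "cspan D \<subseteq> V" by (metis complex_vector.span_minimal)
  have SV: "\<exists>n. res (F n) x < e" if x: "x \<in> S" and "e > 0" for x e
  proof -
    have "e / 4 > 0" "x \<in> approximable D" using \<open>e > 0\<close> D(3) x by auto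
    then obtain p where p: "p \<in> cspan D" "sq (x - p) < e / 4"
      unfolding approximable_def by blast
    then have pV: "p \<in> V" "p \<in> S" using DV by (auto simp: V_def)
    obtain n where n: "res (F n) p < e / 4"
      using pV(1) \<open>e / 4 > 0\<close> unfolding V_def by blast
    have "res (F n) ((x - p) + p) \<le> 2 * res (F n) (x - p) + 2 * res (F n) p"
      using x pV by (intro res_add F) auto
    also have "res (F n) (x - p) \<le> sq (x - p)" using x pV by (intro res_le_sq F) auto
    finally show ?thesis using n p(2) by (intro exI[of _ n]) auto
  qed
  have gsum: "(\<lambda>n. (cmod (B (g n) x))\<^sup>2) sums sq x" if x: "x \<in> S" for x
    unfolding sums_def
  proof (rule LIMSEQ_I)
    fix e :: real assume "e > 0"
    then obtain n where n: "res (F n) x < e" using SV x by blast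
    have "finite (g -` F n)" using F(1) ginj by (simp add: finite_vimageI)
    then obtain N where N: "\<forall>i\<in>g -` F n. i < N" unfolding finite_nat_set_iff_bounded ..
    have "norm ((\<Sum>i<k. (cmod (B (g i) x))\<^sup>2) - sq x) < e" if "k \<ge> N" for k
    proof -
      have og: "ortho (g ` {..<k})" by (rule ortho_subset[OF oU]) (use gU in auto)
      have "F n \<subseteq> g ` {..<k}"
      proof
        fix y assume y: "y \<in> F n"
        then have "y \<in> U" by (auto simp: U_def)
        then obtain i where i: "y = g i" using bij by (auto simp: bij_betw_def)
        then have "i \<in> g -` F n" using y by simp
        then have "i < N" using N by blast
        then have "i < k" using that by linarith
        then show "y \<in> g ` {..<k}" using i by simp
      qed
      then have "res (g ` {..<k}) x \<le> res (F n) x" by (intro res_mono og x) auto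
      moreover have "res (g ` {..<k}) x = sq x - (\<Sum>i<k. (cmod (B (g i) x))\<^sup>2)"
        using og x ginj by (simp add: res_eq sum.reindex inj_on_def)
      moreover have "res (g ` {..<k}) x \<ge> 0" by (intro res_nonneg og x)
      ultimately show ?thesis using n by simp
    qed
    then show "\<exists>N. \<forall>k\<ge>N. norm ((\<Sum>i<k. (cmod (B (g i) x))\<^sup>2) - sq x) < e" by blast
  qed
  have gS: "g i \<in> S" for i using oU gU[of i] by (auto simp: ortho_def)
  have "B (g i) (g j) = (if i = j then 1 else 0)" for i j
    using oU gU[of i] gU[of j] ginj by (auto simp: ortho_def inj_eq)
  with gS gsum show ?thesis by (intro exI[of _ g] conjI allI ballI)
qed

text \<open>A dimension count. If \<open>F\<close> were total, Parseval would give \<open>\<Sum>g\<in>F. \<Sum>i<N. |B g (h i)|\<^sup>2 = N\<close>, whereas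
  Bessel bounds each inner sum by one; take \<open>N\<close> larger than the number of elements of \<open>F\<close>.\<close>

lemma infinite_dimensional_if_ortho_sequence:
  fixes h :: "nat \<Rightarrow> 'v"
  assumes h: "\<And>i. h i \<in> S" "\<And>i j. B (h i) (h j) = (if i = j then 1 else 0)"
    and F: "finite F" "ortho F"
  shows "\<exists>x\<in>S. res F x \<noteq> 0"
proof (rule ccontr)
  assume "\<not> ?thesis"
  then have res0: "res F x = 0" if "x \<in> S" for x using that by blast
  have FS: "g \<in> S" if "g \<in> F" for g using F(2) that by (auto simp: ortho_def)
  have inj: "inj h"
  proof (rule injI)
    fix i j assume "h i = h j"
    then show "i = j" using h(2)[of i i] h(2)[of i j] by (simp split: if_splits)
  qed
  define N where "N = Suc (card F)"
  have oH: "ortho (h ` {..<N})" using h inj by (auto simp: ortho_def inj_eq)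
  have sym: "cmod (B g (h i)) = cmod (B (h i) g)" if "g \<in> F" for g i
    using commute[OF FS[OF that] h(1)[of i]] by simp
  have "(\<Sum>i<N. \<Sum>g\<in>F. (cmod (B g (h i)))\<^sup>2) = (\<Sum>i<N. 1)"
    using res0[OF h(1)] h by (intro sum.cong refl) (simp add: res_eq[OF F h(1)] sq_def)
  then have "real N = (\<Sum>g\<in>F. \<Sum>i<N. (cmod (B g (h i)))\<^sup>2)" by (subst sum.swap) simp
  also have "\<dots> \<le> (\<Sum>g\<in>F. 1)"
  proof (rule sum_mono)
    fix g assume g: "g \<in> F"
    have "0 \<le> res (h ` {..<N}) g" by (rule res_nonneg[OF oH FS[OF g]])
    also have "\<dots> = sq g - (\<Sum>i<N. (cmod (B (h i) g))\<^sup>2)"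
      using inj by (simp add: res_eq[OF _ oH FS[OF g]] sum.reindex inj_on_def)
    also have "sq g = 1" using g F(2) by (simp add: sq_def ortho_def)
    finally show "(\<Sum>i<N. (cmod (B g (h i)))\<^sup>2) \<le> 1" using sym[OF g] by simp
  qed
  also have "\<dots> = real (card F)" by simp
  finally show False by (simp add: N_def)
qed

end

lemma semi_inner_space_cinner: "semi_inner_space UNIV (cinner :: 'a::complex_inner \<Rightarrow> 'a \<Rightarrow> complex)"
  by standard (simp_all add: complex_vector.subspace_UNIV cinner_add_right cinner_scaleC_right
      cinner_commute[symmetric] cinner_self)

lemma orthonormal_basis_exists:
  "\<exists>b :: nat \<Rightarrow> 'a::separable_infinite_chilbert.
    (\<forall>i j. cinner (b i) (b j) = (if i = j then 1 else 0)) \<and>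
    (\<forall>x. (\<lambda>n. (cmod (cinner (b n) x))\<^sup>2) sums (norm x)\<^sup>2)"
proof -
  interpret semi_inner_space UNIV "cinner :: 'a \<Rightarrow> 'a \<Rightarrow> complex"
    by (rule semi_inner_space_cinner)
  have sq: "sq x = (norm x)\<^sup>2" for x by (simp add: sq_def cinner_self)
  obtain D :: "'a set" where D: "countable D" "\<And>x e. e > 0 \<Longrightarrow> \<exists>y\<in>D. dist y x < e"
    using separable by blast
  have "\<exists>y\<in>cspan D. (norm (x - y))\<^sup>2 < e" if e: "e > 0" for x e
  proof -
    obtain y where y: "y \<in> D" "dist y x < sqrt e" using D(2)[of "sqrt e" x] e by auto
    then have "(norm (x - y))\<^sup>2 < (sqrt e)\<^sup>2"
      by (intro power_strict_mono) (auto simp: dist_norm norm_minus_commute)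
    with y e show ?thesis by (intro bexI[of _ y]) (auto intro: complex_vector.span_base)
  qed
  then have "UNIV \<subseteq> approximable D" by (auto simp: approximable_def sq)
  moreover have "\<exists>x\<in>UNIV. res F x \<noteq> 0" if F: "finite F" for F
  proof (rule ccontr)
    assume "\<not> ?thesis"
    then have "res F x = 0" for x by blast
    then have "x - proj F x = 0" for x by (simp add: res_def sq)
    then have eq: "x = (\<Sum>g\<in>F. cinner g x *\<^sub>C g)" for x
      unfolding proj_def right_minus_eq .
    have "\<forall>x. \<exists>c. x = (\<Sum>b\<in>F. c b *\<^sub>C b)"
    proof
      fix x
      show "\<exists>c. x = (\<Sum>b\<in>F. c b *\<^sub>C b)" by (rule exI[of _ "\<lambda>g. cinner g x"]) (rule eq)
    qed
    then show False using infinite_dimensional[where 'a='a] F by blast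
  qed
  ultimately have "\<exists>g :: nat \<Rightarrow> 'a. (\<forall>i. g i \<in> UNIV) \<and> (\<forall>i j. cinner (g i) (g j) = (if i = j then 1 else 0)) \<and>
    (\<forall>x\<in>UNIV. (\<lambda>n. (cmod (cinner (g n) x))\<^sup>2) sums sq x)"
    by (rule total_orthonormal_sequence[OF D(1) subset_UNIV])
  then show ?thesis by (simp add: sq)
qed

lemma norm_sum_orthonormal:
  assumes "\<And>i j. cinner (b i) (b j) = (if i = j then 1 else 0)" "finite A"
  shows "(norm (\<Sum>i\<in>A. c i *\<^sub>C b i))\<^sup>2 = (\<Sum>i\<in>A. (cmod (c i))\<^sup>2)"
proof -
  have "complex_of_real ((norm (\<Sum>i\<in>A. c i *\<^sub>C b i))\<^sup>2) = (\<Sum>j\<in>A. \<Sum>i\<in>A. if i = j then c j * cnj (c i) else 0)"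
    unfolding cinner_self[symmetric] cinner_sum_right cinner_sum_left cinner_scaleC_left cinner_scaleC_right
    by (intro sum.cong refl) (simp add: assms(1) sum_distrib_left, intro sum.cong, auto)
  also have "\<dots> = complex_of_real (\<Sum>i\<in>A. (cmod (c i))\<^sup>2)"
    using assms(2) by (simp add: complex_norm_square del: of_real_power)
  finally show ?thesis by (simp only: of_real_eq_iff)
qed

text \<open>The partial sums are Cauchy, as squared norms of finite orthonormal sums are sums of squares.\<close>

lemma summable_orthonormal:
  fixes b :: "nat \<Rightarrow> 'a::chilbert_space"
  assumes on: "\<And>i j. cinner (b i) (b j) = (if i = j then 1 else 0)" and s: "summable (\<lambda>i. (cmod (c i))\<^sup>2)"
  shows "summable (\<lambda>i. c i *\<^sub>C b i)" "(norm (\<Sum>i. c i *\<^sub>C b i))\<^sup>2 = (\<Sum>i. (cmod (c i))\<^sup>2)"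
proof -
  show sm: "summable (\<lambda>i. c i *\<^sub>C b i)"
    unfolding summable_Cauchy
  proof (intro allI impI)
    fix e :: real assume "e > 0"
    then have "e\<^sup>2 > 0" by simp
    then obtain N where N: "\<And>m n. m \<ge> N \<Longrightarrow> norm (\<Sum>i=m..<n. (cmod (c i))\<^sup>2) < e\<^sup>2"
      using s unfolding summable_Cauchy by blast
    have "norm (\<Sum>i=m..<n. c i *\<^sub>C b i) < e" if "m \<ge> N" for m n
    proof -
      have "(norm (\<Sum>i=m..<n. c i *\<^sub>C b i))\<^sup>2 < e\<^sup>2"
        using N[OF that, of n] by (simp add: norm_sum_orthonormal[OF on] sum_nonneg)
      then show ?thesis using \<open>e > 0\<close> by (simp add: power2_less_imp_less)
    qed
    then show "\<exists>N. \<forall>m\<ge>N. \<forall>n. norm (\<Sum>i=m..<n. c i *\<^sub>C b i) < e" by blast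
  qed
  have "(\<lambda>n. (norm (\<Sum>i<n. c i *\<^sub>C b i))\<^sup>2) \<longlonglongrightarrow> (norm (\<Sum>i. c i *\<^sub>C b i))\<^sup>2"
    by (intro tendsto_intros summable_LIMSEQ sm)
  moreover have "(\<lambda>n. (norm (\<Sum>i<n. c i *\<^sub>C b i))\<^sup>2) \<longlonglongrightarrow> (\<Sum>i. (cmod (c i))\<^sup>2)"
    unfolding norm_sum_orthonormal[OF on finite_lessThan] by (rule summable_LIMSEQ[OF s])
  ultimately show "(norm (\<Sum>i. c i *\<^sub>C b i))\<^sup>2 = (\<Sum>i. (cmod (c i))\<^sup>2)" by (rule LIMSEQ_unique)
qed

lemma orthonormal_basis_sums:
  fixes b :: "nat \<Rightarrow> 'a::complex_inner"
  assumes on: "\<And>i j. cinner (b i) (b j) = (if i = j then 1 else 0)"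
    and s: "(\<lambda>n. (cmod (cinner (b n) x))\<^sup>2) sums (norm x)\<^sup>2"
  shows "(\<lambda>n. cinner (b n) x *\<^sub>C b n) sums x"
proof -
  have eq: "(norm (x - (\<Sum>i<n. cinner (b i) x *\<^sub>C b i)))\<^sup>2 = (norm x)\<^sup>2 - (\<Sum>i<n. (cmod (cinner (b i) x))\<^sup>2)" for n
  proof -
    let ?p = "\<Sum>i<n. cinner (b i) x *\<^sub>C b i"
    have "cinner x ?p = complex_of_real (\<Sum>i<n. (cmod (cinner (b i) x))\<^sup>2)"
      unfolding cinner_sum_right cinner_scaleC_right of_real_sum complex_norm_square
      by (intro sum.cong refl arg_cong2[where f="(*)"]) (rule cinner_commute)
    then have "inner x ?p = (\<Sum>i<n. (cmod (cinner (b i) x))\<^sup>2)" by (simp add: inner_eq_Re_cinner)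
    moreover have "(norm ?p)\<^sup>2 = (\<Sum>i<n. (cmod (cinner (b i) x))\<^sup>2)"
      by (rule norm_sum_orthonormal[OF on]) simp
    ultimately show ?thesis
      by (simp add: power2_norm_eq_inner inner_diff_left inner_diff_right inner_commute)
  qed
  have "(\<lambda>n. (norm x)\<^sup>2 - (\<Sum>i<n. (cmod (cinner (b i) x))\<^sup>2)) \<longlonglongrightarrow> (norm x)\<^sup>2 - (norm x)\<^sup>2"
    using s unfolding sums_def by (intro tendsto_intros)
  then have "(\<lambda>n. (norm (x - (\<Sum>i<n. cinner (b i) x *\<^sub>C b i)))\<^sup>2) \<longlonglongrightarrow> 0" unfolding eq by simp
  then have "(\<lambda>n. sqrt ((norm (x - (\<Sum>i<n. cinner (b i) x *\<^sub>C b i)))\<^sup>2)) \<longlonglongrightarrow> sqrt 0" by (rule tendsto_real_sqrt)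
  then have "(\<lambda>n. x - (\<Sum>i<n. cinner (b i) x *\<^sub>C b i)) \<longlonglongrightarrow> 0" by (simp add: tendsto_norm_zero_iff)
  then have "(\<lambda>n. x - (x - (\<Sum>i<n. cinner (b i) x *\<^sub>C b i))) \<longlonglongrightarrow> x - 0" by (intro tendsto_intros)
  then show ?thesis unfolding sums_def by simp
qed

context semi_inner_space
begin

text \<open>Map a vector to the series in an orthonormal basis \<open>b\<close> of \<open>'h\<close> whose coefficients are those with
  respect to a total orthonormal sequence \<open>g\<close>. Parseval's identity makes this isometric. The image is dense
  since it contains the finite combinations of \<open>b\<close>, the images of those of \<open>g\<close>.\<close>

theorem isometric_realization:
  assumes D: "countable D" "D \<subseteq> S" "S \<subseteq> approximable D"
    and inf: "\<And>F. finite F \<Longrightarrow> ortho F \<Longrightarrow> \<exists>x\<in>S. res F x \<noteq> 0"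
  shows "\<exists>\<Phi> :: 'v \<Rightarrow> 'h::separable_infinite_chilbert.
    (\<forall>x\<in>S. \<forall>y\<in>S. cinner (\<Phi> x) (\<Phi> y) = B x y) \<and> closure (\<Phi> ` S) = UNIV"
proof -
  obtain g :: "nat \<Rightarrow> 'v" where g: "(\<forall>i. g i \<in> S) \<and> (\<forall>i j. B (g i) (g j) = (if i = j then 1 else 0)) \<and>
    (\<forall>x\<in>S. (\<lambda>n. (cmod (B (g n) x))\<^sup>2) sums sq x)"
    using total_orthonormal_sequence[OF D inf] ..
  then have gS: "\<And>i. g i \<in> S" and gon: "\<And>i j. B (g i) (g j) = (if i = j then 1 else 0)"
    and gsum: "\<And>x. x \<in> S \<Longrightarrow> (\<lambda>n. (cmod (B (g n) x))\<^sup>2) sums sq x" by simp_all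
  obtain b :: "nat \<Rightarrow> 'h" where "(\<forall>i j. cinner (b i) (b j) = (if i = j then 1 else 0)) \<and>
    (\<forall>x. (\<lambda>n. (cmod (cinner (b n) x))\<^sup>2) sums (norm x)\<^sup>2)"
    using orthonormal_basis_exists[where 'a='h] ..
  then have bon: "\<And>i j. cinner (b i) (b j) = (if i = j then 1 else 0)"
    and bsum: "\<And>x. (\<lambda>n. (cmod (cinner (b n) x))\<^sup>2) sums (norm x)\<^sup>2" by simp_all
  define \<Phi> where "\<Phi> x = (\<Sum>n. B (g n) x *\<^sub>C b n)" for x
  have sm: "summable (\<lambda>n. B (g n) x *\<^sub>C b n)" if "x \<in> S" for x
    using gsum[OF that] by (intro summable_orthonormal bon) (simp add: sums_iff)
  have nrm: "(norm (\<Phi> x))\<^sup>2 = sq x" if "x \<in> S" for x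
    unfolding \<Phi>_def using gsum[OF that] by (subst summable_orthonormal(2)[OF bon]) (simp_all add: sums_iff)
  have add: "\<Phi> (x + y) = \<Phi> x + \<Phi> y" if "x \<in> S" "y \<in> S" for x y
    unfolding \<Phi>_def using that gS by (simp add: add_right scaleC_add_left suminf_add sm)
  have scale: "\<Phi> (c *\<^sub>C x) = c *\<^sub>C \<Phi> x" if "x \<in> S" for c x
    unfolding \<Phi>_def
    using bounded_linear.suminf[OF bounded_bilinear.bounded_linear_right[OF bounded_bilinear_scaleC] sm[OF that], of c] that gS
    by (simp add: scaleC_right scaleC_scaleC)
  have re: "Re (cinner (\<Phi> x) (\<Phi> y)) = Re (B x y)" if "x \<in> S" "y \<in> S" for x y
  proof -
    have "(norm (\<Phi> x + \<Phi> y))\<^sup>2 = (norm (\<Phi> x))\<^sup>2 + (norm (\<Phi> y))\<^sup>2 + 2 * Re (cinner (\<Phi> x) (\<Phi> y))"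
      by (simp add: power2_norm_eq_inner inner_add_left inner_add_right inner_commute
          inner_eq_Re_cinner[symmetric])
    then show ?thesis using that by (simp add: add[symmetric] nrm sq_add)
  qed
  have iso: "cinner (\<Phi> x) (\<Phi> y) = B x y" if "x \<in> S" "y \<in> S" for x y
    using re[OF that] re[of x "\<i> *\<^sub>C y"] that
    by (simp add: complex_eq_iff scale cinner_scaleC_right scaleC_right)
  have "z \<in> closure (\<Phi> ` S)" for z
  proof -
    have "\<Phi> (g i) = b i" for i
    proof -
      have "(\<lambda>n. B (g n) (g i) *\<^sub>C b n) = (\<lambda>n. if n = i then b i else 0)"
        by (auto simp: gon scaleC_one)
      then show ?thesis unfolding \<Phi>_def using sums_If_finite_set[of "{i}" "\<lambda>_. b i"] by (simp add: sums_iff)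
    qed
    note \<Phi>g = this
    have "\<Phi> (\<Sum>i<n. c i *\<^sub>C g i) = (\<Sum>i<n. c i *\<^sub>C b i)" for n c
    proof (induction n)
      case 0
      have "\<Phi> (0 *\<^sub>C 0) = 0 *\<^sub>C \<Phi> 0" by (rule scale) simp
      then show ?case by simp
    next
      case (Suc n)
      have "(\<Sum>i<n. c i *\<^sub>C g i) \<in> S" "c n *\<^sub>C g n \<in> S" using gS by (simp_all add: mem_sum)
      then show ?case by (simp add: add scale[OF gS] \<Phi>g Suc.IH)
    qed
    then have "(\<Sum>i<n. cinner (b i) z *\<^sub>C b i) = \<Phi> (\<Sum>i<n. cinner (b i) z *\<^sub>C g i)" for n by simp
    moreover have "(\<Sum>i<n. cinner (b i) z *\<^sub>C g i) \<in> S" for n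
      by (rule mem_sum) (simp add: gS)
    ultimately have "(\<Sum>i<n. cinner (b i) z *\<^sub>C b i) \<in> \<Phi> ` S" for n by simp
    moreover have "(\<lambda>n. \<Sum>i<n. cinner (b i) z *\<^sub>C b i) \<longlonglongrightarrow> z"
      using orthonormal_basis_sums[OF bon bsum] by (simp add: sums_def)
    ultimately show ?thesis
      unfolding closure_sequential
      by (intro exI[of _ "\<lambda>n. \<Sum>i<n. cinner (b i) z *\<^sub>C b i"] conjI allI)
  qed
  then have "closure (\<Phi> ` S) = UNIV" by blast
  with iso show ?thesis by (intro exI[of _ \<Phi>] conjI ballI)
qed

end

section \<open>Operators on Hilbert spaces and their tensor products\<close>

lemma tendsto_cblinfun: "(X \<longlongrightarrow> x) F \<Longrightarrow> ((\<lambda>n. a *\<^sub>V X n) \<longlongrightarrow> a *\<^sub>V x) F"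
  by (rule bounded_linear.tendsto[OF bounded_linear_cblinfun_apply])

lemma plus_cblinfun_apply [simp]: "(a + b) *\<^sub>V x = a *\<^sub>V x + b *\<^sub>V x"
  by transfer simp

lemma minus_cblinfun_apply [simp]: "(a - b) *\<^sub>V x = a *\<^sub>V x - b *\<^sub>V x"
  by transfer simp

lemma zero_cblinfun_apply [simp]: "0 *\<^sub>V x = 0"
  by transfer simp

lemma scaleC_cblinfun_apply [simp]: "(c *\<^sub>C a) *\<^sub>V x = c *\<^sub>C (a *\<^sub>V x)"
  by transfer simp

lemma sum_cblinfun_apply: "(\<Sum>i\<in>A. a i) *\<^sub>V x = (\<Sum>i\<in>A. a i *\<^sub>V x)"
  by (induction A rule: infinite_finite_induct) simp_all

lemma cinner_adj_right: "cinner x (adj a *\<^sub>V y) = cinner (a *\<^sub>V x) y"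
  using cinner_adj[of a y x] cinner_commute[of x "adj a *\<^sub>V y"] cinner_commute[of "a *\<^sub>V x" y] by simp

lemma adj_eqI: "(\<And>x y. cinner (b *\<^sub>V y) x = cinner y (a *\<^sub>V x)) \<Longrightarrow> adj a = b"
  using adj_ex1[of a] cinner_adj[of a] by (metis (no_types, lifting))

lemma adj_adj [simp]: "adj (adj a) = a"
  by (rule adj_eqI) (simp add: cinner_adj_right)

lemma adj_compose: "adj (a o\<^sub>C\<^sub>L b) = adj b o\<^sub>C\<^sub>L adj a"
  by (rule adj_eqI) (simp add: cinner_adj)

lemma adj_minus: "adj (a - b) = adj a - adj b"
  by (rule adj_eqI) (simp add: cinner_adj cinner_diff_left cinner_diff_right)

lemma unitary_adj_apply: "unitary u \<Longrightarrow> adj u *\<^sub>V (u *\<^sub>V x) = x"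
  unfolding unitary_def by (metis compose_cblinfun_apply id_cblinfun_apply)

lemma unitary_apply_adj: "unitary u \<Longrightarrow> u *\<^sub>V (adj u *\<^sub>V x) = x"
  unfolding unitary_def by (metis compose_cblinfun_apply id_cblinfun_apply)

lemma unitary_cinner: "unitary u \<Longrightarrow> cinner (u *\<^sub>V x) (u *\<^sub>V y) = cinner x y"
  by (simp add: cinner_adj[symmetric] unitary_adj_apply)

lemma norm_eq_of_cinner: 
  assumes "cinner x x = cinner y y"
  shows "norm x = norm y"
proof -
  have "(norm x)\<^sup>2 = (norm y)\<^sup>2" using assms unfolding cinner_self of_real_eq_iff .
  then show ?thesis by simp
qed

lemma unitary_norm: "unitary u \<Longrightarrow> norm (u *\<^sub>V x) = norm x"
  by (rule norm_eq_of_cinner) (rule unitary_cinner)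

lemma unitary_adj: "unitary u \<Longrightarrow> unitary (adj u)"
  by (simp add: unitary_def)

lemma unitary_compose: "unitary u \<Longrightarrow> unitary v \<Longrightarrow> unitary (u o\<^sub>C\<^sub>L v)"
proof -
  assume u: "unitary u" and v: "unitary v"
  have "adj (u o\<^sub>C\<^sub>L v) o\<^sub>C\<^sub>L (u o\<^sub>C\<^sub>L v) = id_cblinfun"
    by (rule cblinfun_eqI) (simp add: adj_compose unitary_adj_apply[OF u] unitary_adj_apply[OF v])
  moreover have "(u o\<^sub>C\<^sub>L v) o\<^sub>C\<^sub>L adj (u o\<^sub>C\<^sub>L v) = id_cblinfun"
    by (rule cblinfun_eqI) (simp add: adj_compose unitary_apply_adj[OF u] unitary_apply_adj[OF v])
  ultimately show ?thesis by (simp add: unitary_def)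
qed

text \<open>The induction principle behind all density arguments below: a closed property that is compatible with
  the vector space operations needs to be checked on a total set only.\<close>

lemma total_induct:
  assumes total: "closure (cspan E) = UNIV" and closed: "closed {x. P x}"
    and P: "P 0" "\<And>x y. P x \<Longrightarrow> P y \<Longrightarrow> P (x + y)" "\<And>c x. P x \<Longrightarrow> P (c *\<^sub>C x)" "\<And>x. x \<in> E \<Longrightarrow> P x"
  shows "P x"
proof -
  have "cspan E \<subseteq> {x. P x}"
  proof (rule complex_vector.span_minimal)
    show "E \<subseteq> {x. P x}" using P(4) by blast
    show "complex_vector.subspace {x. P x}"
      by (rule complex_vector.subspaceI) (simp_all add: P(1-3))
  qed
  then have "closure (cspan E) \<subseteq> {x. P x}" using closed by (rule closure_minimal)
  then show ?thesis unfolding total by blast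
qed

lemma total_cinner_ext:
  assumes total: "closure (cspan E) = UNIV" and eq: "\<And>z. z \<in> E \<Longrightarrow> cinner z x = cinner z y"
  shows "x = y"
proof (rule cinner_ext)
  fix z
  show "cinner z x = cinner z y"
  proof (rule total_induct[OF total, where P="\<lambda>z. cinner z x = cinner z y"])
    have "continuous_on UNIV (\<lambda>z. cinner z x)" "continuous_on UNIV (\<lambda>z. cinner z y)"
      by (intro linear_continuous_on bounded_bilinear.bounded_linear_left[OF bounded_bilinear_cinner])+
    then show "closed {z. cinner z x = cinner z y}" by (rule closed_Collect_eq)
  qed (simp_all add: cinner_add_left cinner_scaleC_left eq)
qed

lemma closure_cspan_subset:
  fixes E F :: "'v::complex_inner set"
  assumes "E \<subseteq> closure (cspan F)" and "closure (cspan E) = UNIV"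
  shows "closure (cspan F) = UNIV"
proof -
  have "cspan E \<subseteq> closure (cspan F)"
    by (rule complex_vector.span_minimal[OF assms(1) csubspace_closure[OF complex_vector.subspace_span]])
  then have "closure (cspan E) \<subseteq> closure (cspan F)" by (rule closure_minimal) simp
  then show ?thesis using assms(2) by blast
qed

lemma dense_imp_total: "closure E = UNIV \<Longrightarrow> closure (cspan E) = UNIV" for E :: "'v::complex_inner set"
  using closure_mono[OF complex_vector.span_superset[of E]] by blast

lemma tensor_cinner_ext:
  assumes "\<And>x y. cinner (x \<otimes>\<^sub>H y) u = cinner (x \<otimes>\<^sub>H y) v"
  shows "u = v"
  by (rule total_cinner_ext[OF tensor_total]) (use assms in auto)

text \<open>Two total families with the same Gram matrix: the isometries extending \<open>e i \<mapsto> f i\<close> and \<open>f i \<mapsto> e i\<close>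
  are inverse to each other.\<close>

lemma unitary_extension:
  fixes e :: "'i \<Rightarrow> 'v::chilbert_space" and f :: "'i \<Rightarrow> 'w::chilbert_space"
  assumes e: "closure (cspan (range e)) = UNIV" and f: "closure (cspan (range f)) = UNIV"
    and gram: "\<And>i j. cinner (f i) (f j) = cinner (e i) (e j)"
  shows "\<exists>T. unitary T \<and> (\<forall>i. T *\<^sub>V e i = f i)"
proof -
  have b: "norm (\<Sum>(c, i)\<leftarrow>ts. c *\<^sub>C f i) \<le> 1 * norm (\<Sum>(c, i)\<leftarrow>ts. c *\<^sub>C e i)" for ts
    using norm_sum_isometric[of f e ts, OF gram] by simp
  have b': "norm (\<Sum>(c, i)\<leftarrow>ts. c *\<^sub>C e i) \<le> 1 * norm (\<Sum>(c, i)\<leftarrow>ts. c *\<^sub>C f i)" for ts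
    using norm_sum_isometric[of e f ts, OF gram[symmetric]] by simp
  obtain T where T: "\<And>i. T *\<^sub>V e i = f i"
    using ex1_implies_ex[OF cblinfun_extension[OF e b]] by auto
  obtain T' where T': "\<And>i. T' *\<^sub>V f i = e i"
    using ex1_implies_ex[OF cblinfun_extension[OF f b']] by auto
  have TT': "T o\<^sub>C\<^sub>L T' = id_cblinfun"
    by (rule cblinfun_eq_total[OF f]) (auto simp: T T')
  have aT: "adj T o\<^sub>C\<^sub>L T = id_cblinfun"
  proof (rule cblinfun_eq_total[OF e])
    fix x assume "x \<in> range e"
    then obtain i where x: "x = e i" by blast
    have "adj T *\<^sub>V (T *\<^sub>V e i) = e i"
      by (rule total_cinner_ext[OF e]) (auto simp: cinner_adj_right T gram)
    then show "(adj T o\<^sub>C\<^sub>L T) *\<^sub>V x = id_cblinfun *\<^sub>V x" by (simp add: x)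
  qed
  have "adj T = T'"
  proof (rule cblinfun_eqI)
    fix x
    have "adj T *\<^sub>V x = adj T *\<^sub>V ((T o\<^sub>C\<^sub>L T') *\<^sub>V x)" by (simp add: TT')
    also have "\<dots> = (adj T o\<^sub>C\<^sub>L T) *\<^sub>V (T' *\<^sub>V x)" by simp
    finally show "adj T *\<^sub>V x = T' *\<^sub>V x" by (simp add: aT)
  qed
  then have "unitary T" using aT TT' by (simp add: unitary_def)
  with T show ?thesis by (intro exI[of _ T] conjI allI)
qed

lemma tensor_flip_exists:
  "\<exists>T :: ('b::chilbert_space, 'a::chilbert_space) htensor \<Rightarrow>\<^sub>C\<^sub>L ('a, 'b) htensor.
    unitary T \<and> (\<forall>x y. T *\<^sub>V (y \<otimes>\<^sub>H x) = x \<otimes>\<^sub>H y)"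
proof -
  have "range (\<lambda>(y :: 'b, x :: 'a). x \<otimes>\<^sub>H y) = range (\<lambda>(x, y). x \<otimes>\<^sub>H y)"
    by (auto simp: image_iff)
  then have total: "closure (cspan (range (\<lambda>(y :: 'b, x :: 'a). x \<otimes>\<^sub>H y))) = UNIV"
    using tensor_total by simp
  have "\<exists>T :: ('b, 'a) htensor \<Rightarrow>\<^sub>C\<^sub>L ('a, 'b) htensor. unitary T \<and>
      (\<forall>i. T *\<^sub>V (\<lambda>(y, x). y \<otimes>\<^sub>H x) i = (\<lambda>(y, x). x \<otimes>\<^sub>H y) i)"
    by (rule unitary_extension[OF tensor_total total]) (simp add: case_prod_unfold cinner_tensor mult.commute)
  then show ?thesis by auto
qed

lemma tensor_op_id: "id_cblinfun \<otimes>\<^sub>O id_cblinfun = id_cblinfun"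
  by (rule cblinfun_eq_tensor) (simp add: tensor_op_tensor)

lemma tensor_op_add_right: "a \<otimes>\<^sub>O (b + c) = a \<otimes>\<^sub>O b + a \<otimes>\<^sub>O c"
  by (rule cblinfun_eq_tensor) (simp add: tensor_op_tensor tensor_add_right)

lemma tensor_op_diff_right: "a \<otimes>\<^sub>O (b - c) = a \<otimes>\<^sub>O b - a \<otimes>\<^sub>O c"
  using tensor_op_add_right[of a "b - c" c] by (simp add: algebra_simps)

lemma tensor_op_scaleC_right: "a \<otimes>\<^sub>O (c *\<^sub>C b) = c *\<^sub>C (a \<otimes>\<^sub>O b)"
  by (rule cblinfun_eq_tensor) (simp add: tensor_op_tensor tensor_scaleC_right)

lemma adj_tensor_op:
  fixes a :: "'a::chilbert_space \<Rightarrow>\<^sub>C\<^sub>L 'c::chilbert_space" and b :: "'b::chilbert_space \<Rightarrow>\<^sub>C\<^sub>L 'd::chilbert_space"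
  shows "adj (a \<otimes>\<^sub>O b) = adj a \<otimes>\<^sub>O adj b"
proof (rule cblinfun_eq_tensor, rule tensor_cinner_ext)
  fix x y x' y'
  show "cinner (x' \<otimes>\<^sub>H y') (adj (a \<otimes>\<^sub>O b) *\<^sub>V (x \<otimes>\<^sub>H y)) = cinner (x' \<otimes>\<^sub>H y') ((adj a \<otimes>\<^sub>O adj b) *\<^sub>V (x \<otimes>\<^sub>H y))"
    by (simp add: cinner_adj_right tensor_op_tensor cinner_tensor)
qed

text \<open>The creation operator \<open>y \<mapsto> x \<otimes> y\<close>; its adjoint contracts the first tensor factor with \<open>x\<close>.\<close>

lift_definition creation :: "'a::complex_inner \<Rightarrow> 'b::complex_inner \<Rightarrow>\<^sub>C\<^sub>L ('a, 'b) htensor"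
  is "\<lambda>x y. x \<otimes>\<^sub>H y"
proof -
  fix x :: 'a
  show "bounded_clinear (\<lambda>y :: 'b. x \<otimes>\<^sub>H y)"
    by (rule bounded_clinearI[of _ "norm x"]) (simp_all add: tensor_add_right tensor_scaleC_right norm_tensor)
qed

lemma creation_apply [simp]: "creation x *\<^sub>V y = x \<otimes>\<^sub>H y"
  by (rule creation.rep_eq[THEN fun_cong])

text \<open>A uniform bound turns pointwise convergence on a total set into pointwise convergence, by an
  \<open>\<epsilon>/2\<close> argument.\<close>

lemma tendsto_cblinfun_total:
  fixes T :: "nat \<Rightarrow> 'a::complex_inner \<Rightarrow>\<^sub>C\<^sub>L 'b::complex_inner"
  assumes total: "closure (cspan E) = UNIV" and E: "\<And>x. x \<in> E \<Longrightarrow> (\<lambda>n. T n *\<^sub>V x) \<longlonglongrightarrow> S *\<^sub>V x"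
    and bound: "\<And>n x. norm (T n *\<^sub>V x) \<le> M * norm x"
  shows "(\<lambda>n. T n *\<^sub>V x) \<longlonglongrightarrow> S *\<^sub>V x"
proof (rule total_induct[OF total, where P="\<lambda>x. (\<lambda>n. T n *\<^sub>V x) \<longlonglongrightarrow> S *\<^sub>V x"])
  obtain L where L: "L \<ge> 0" "\<And>x. norm (S *\<^sub>V x) \<le> L * norm x" using cblinfun_bound by blast
  have "x \<in> {x. (\<lambda>n. T n *\<^sub>V x) \<longlonglongrightarrow> S *\<^sub>V x}"
    if X: "\<forall>k. X k \<in> {x. (\<lambda>n. T n *\<^sub>V x) \<longlonglongrightarrow> S *\<^sub>V x}" "X \<longlonglongrightarrow> x" for X x
  proof -
    have "\<exists>N. \<forall>n\<ge>N. norm (T n *\<^sub>V x - S *\<^sub>V x) < e" if e: "e > 0" for e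
    proof -
      have pos: "\<bar>M\<bar> + L + 1 > 0" using L by linarith
      then have "e / 2 / (\<bar>M\<bar> + L + 1) > 0" using e by simp
      then obtain k where "norm (X k - x) < e / 2 / (\<bar>M\<bar> + L + 1)"
        using LIMSEQ_D[OF X(2)] by blast
      then have k: "(\<bar>M\<bar> + L + 1) * norm (X k - x) < e / 2"
        by (simp only: pos_less_divide_eq[OF pos] mult.commute)
      have lim: "(\<lambda>n. T n *\<^sub>V X k) \<longlonglongrightarrow> S *\<^sub>V X k" using X(1) by blast
      have "e / 2 > 0" using e by simp
      from LIMSEQ_D[OF lim this] obtain N where N: "\<forall>n\<ge>N. norm (T n *\<^sub>V X k - S *\<^sub>V X k) < e / 2" ..
      have "norm (T n *\<^sub>V x - S *\<^sub>V x) < e" if n: "n \<ge> N" for n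
      proof -
        have "T n *\<^sub>V x - S *\<^sub>V x = (T n *\<^sub>V X k - S *\<^sub>V X k) - T n *\<^sub>V (X k - x) + S *\<^sub>V (X k - x)"
          by (simp add: cblinfun_diff)
        then have "norm (T n *\<^sub>V x - S *\<^sub>V x) \<le> norm (T n *\<^sub>V X k - S *\<^sub>V X k) + norm (T n *\<^sub>V (X k - x)) + norm (S *\<^sub>V (X k - x))"
          by (simp only: order_trans[OF norm_triangle_ineq add_right_mono[OF norm_triangle_ineq4]])
        also have "norm (T n *\<^sub>V (X k - x)) \<le> \<bar>M\<bar> * norm (X k - x)"
          by (rule order_trans[OF bound mult_right_mono[OF abs_ge_self norm_ge_zero]])
        also have "norm (S *\<^sub>V (X k - x)) \<le> L * norm (X k - x)" by (rule L)
        finally have "norm (T n *\<^sub>V x - S *\<^sub>V x) \<le> norm (T n *\<^sub>V X k - S *\<^sub>V X k) + (\<bar>M\<bar> + L + 1) * norm (X k - x)"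
          unfolding distrib_right mult_1 using norm_ge_zero[of "X k - x"] by linarith
        moreover have "norm (T n *\<^sub>V X k - S *\<^sub>V X k) < e / 2" using N n by blast
        ultimately show ?thesis using k by linarith
      qed
      then show ?thesis by blast
    qed
    then have "(\<lambda>n. T n *\<^sub>V x) \<longlonglongrightarrow> S *\<^sub>V x" by (rule LIMSEQ_I)
    then show ?thesis by simp
  qed
  then show "closed {x. (\<lambda>n. T n *\<^sub>V x) \<longlonglongrightarrow> S *\<^sub>V x}"
    unfolding closed_sequential_limits by blast
qed (simp_all add: E cblinfun_add cblinfun_scaleC tendsto_add tendsto_scaleC)

lemma positive_op_iff: "positive_op a \<longleftrightarrow> (\<forall>x. 0 \<le> Re (cinner x (a *\<^sub>V x)) \<and> Im (cinner x (a *\<^sub>V x)) = 0)"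
  by (simp add: positive_op_def complex_nonneg_Reals_iff)

lemma self_adjoint_cinner: "self_adjoint a \<Longrightarrow> cinner (a *\<^sub>V x) y = cinner x (a *\<^sub>V y)"
  unfolding self_adjoint_def by (metis cinner_adj)

lemma self_adjoint_Im: "self_adjoint a \<Longrightarrow> Im (cinner x (a *\<^sub>V x)) = 0"
  using self_adjoint_cinner[of a x x] arg_cong[OF cinner_commute[of x "a *\<^sub>V x"], of Im] by simp

lemma self_adjoint_positive_iff: "self_adjoint a \<Longrightarrow> positive_op a \<longleftrightarrow> (\<forall>x. 0 \<le> Re (cinner x (a *\<^sub>V x)))"
  by (simp add: positive_op_iff self_adjoint_Im)

lemma self_adjoint_diff: "self_adjoint a \<Longrightarrow> self_adjoint b \<Longrightarrow> self_adjoint (a - b)"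
  by (simp add: self_adjoint_def adj_minus)

lemma op_le_iff:
  assumes "self_adjoint a" "self_adjoint b"
  shows "op_le a b \<longleftrightarrow> (\<forall>x. Re (cinner x (a *\<^sub>V x)) \<le> Re (cinner x (b *\<^sub>V x)))"
  unfolding op_le_def self_adjoint_positive_iff[OF self_adjoint_diff[OF assms(2,1)]]
  by (simp add: cinner_diff_right)

text \<open>The quadratic polynomial \<open>r \<mapsto> \<langle>x + r y, a (x + r y)\<rangle>\<close> is nonnegative, so its discriminant is not
  positive.\<close>

lemma positive_Cauchy_Schwarz:
  assumes "self_adjoint a" "positive_op a"
  shows "(Re (cinner x (a *\<^sub>V y)))\<^sup>2 \<le> Re (cinner x (a *\<^sub>V x)) * Re (cinner y (a *\<^sub>V y))"
proof -
  define A where "A = Re (cinner x (a *\<^sub>V x))"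
  define B where "B = Re (cinner x (a *\<^sub>V y))"
  define C where "C = Re (cinner y (a *\<^sub>V y))"
  have B': "Re (cinner y (a *\<^sub>V x)) = B"
    using self_adjoint_cinner[OF assms(1), of y x] arg_cong[OF cinner_commute[of x "a *\<^sub>V y"], of Re]
    by (simp add: B_def)
  have quad: "0 \<le> A + 2 * r * B + r * r * C" for r :: real
  proof -
    have "0 \<le> Re (cinner (x + complex_of_real r *\<^sub>C y) (a *\<^sub>V (x + complex_of_real r *\<^sub>C y)))"
      using assms(2) by (simp only: positive_op_iff)
    also have "\<dots> = A + 2 * r * B + r * r * C"
      using B' by (simp add: cblinfun_add cblinfun_scaleC cinner_add_left cinner_add_right
          cinner_scaleC_left cinner_scaleC_right A_def B_def C_def algebra_simps)
    finally show ?thesis .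
  qed
  have "C \<ge> 0" using assms(2) by (simp add: positive_op_iff C_def)
  have "B\<^sup>2 \<le> A * C"
  proof (cases "C = 0")
    case True
    have "B = 0"
    proof (rule ccontr)
      assume "B \<noteq> 0"
      \<comment> \<open>For \<open>C = 0\<close> the polynomial is affine in \<open>r\<close>; here it takes the value \<open>-1\<close>.\<close>
      then have "A + 2 * (- (A + 1) / (2 * B)) * B + (- (A + 1) / (2 * B)) * (- (A + 1) / (2 * B)) * C = - 1"
        using True by (simp add: field_simps)
      then show False using quad[of "- (A + 1) / (2 * B)"] by linarith
    qed
    with True show ?thesis by simp
  next
    case False
    then have "C > 0" using \<open>C \<ge> 0\<close> by simp
    have "0 \<le> (A + 2 * (- B / C) * B + (- B / C) * (- B / C) * C) * C"
      by (rule mult_nonneg_nonneg[OF quad \<open>C \<ge> 0\<close>])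
    also have "\<dots> = A * C - B\<^sup>2" using \<open>C > 0\<close> by (simp add: field_simps power2_eq_square)
    finally show ?thesis by simp
  qed
  then show ?thesis by (simp only: A_def B_def C_def)
qed

definition is_onb :: "(nat \<Rightarrow> 'a::complex_inner) \<Rightarrow> bool"
  where "is_onb b \<longleftrightarrow> (\<forall>i j. cinner (b i) (b j) = (if i = j then 1 else 0)) \<and>
    (\<forall>x. (\<lambda>n. cinner (b n) x *\<^sub>C b n) sums x)"

lemma onb_exists: "\<exists>b :: nat \<Rightarrow> 'a::separable_infinite_chilbert. is_onb b"
proof -
  obtain b :: "nat \<Rightarrow> 'a" where "(\<forall>i j. cinner (b i) (b j) = (if i = j then 1 else 0)) \<and>
    (\<forall>x. (\<lambda>n. (cmod (cinner (b n) x))\<^sup>2) sums (norm x)\<^sup>2)"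
    using orthonormal_basis_exists[where 'a='a] ..
  then have b: "\<And>i j. cinner (b i) (b j) = (if i = j then 1 else 0)"
    "\<And>x. (\<lambda>n. (cmod (cinner (b n) x))\<^sup>2) sums (norm x)\<^sup>2" by simp_all
  have "(\<lambda>n. cinner (b n) x *\<^sub>C b n) sums x" for x
    by (rule orthonormal_basis_sums[OF b])
  with b(1) show ?thesis unfolding is_onb_def by (intro exI[of _ b] conjI allI)
qed

lemma onb_cinner: "is_onb b \<Longrightarrow> cinner (b i) (b j) = (if i = j then 1 else 0)"
  by (simp add: is_onb_def)

lemma onb_norm: "is_onb b \<Longrightarrow> norm (b i) = 1"
  using onb_cinner[of b i i] by (simp add: cinner_self)
     (metis norm_ge_zero of_real_1 of_real_eq_iff of_real_power power2_eq_1_iff norm_minus_cancel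
       not_one_le_zero zero_le_one le_minus_one_simps(3))

lemma adj_creation: "adj (creation x) *\<^sub>V (y \<otimes>\<^sub>H z) = cinner x y *\<^sub>C z"
  by (rule cinner_ext) (simp add: cinner_adj_right cinner_tensor cinner_scaleC_right)

text \<open>The operator \<open>p \<otimes> 1\<close>, where \<open>p\<close> is the projection onto the span of the first \<open>N\<close> basis vectors. Writing
  it with creation operators exhibits the coefficients of a tensor along the basis.\<close>

definition slice :: "(nat \<Rightarrow> 'a::chilbert_space) \<Rightarrow> nat \<Rightarrow> ('a, 'b::chilbert_space) htensor \<Rightarrow>\<^sub>C\<^sub>L ('a, 'b) htensor"
  where "slice b N = (\<Sum>n<N. creation (b n) o\<^sub>C\<^sub>L adj (creation (b n)))"

lemma slice_apply: "slice b N *\<^sub>V u = (\<Sum>n<N. b n \<otimes>\<^sub>H (adj (creation (b n)) *\<^sub>V u))"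
  by (simp add: slice_def sum_cblinfun_apply)

lemma cinner_sum_onb:
  assumes "is_onb b"
  shows "cinner (\<Sum>n<N. b n \<otimes>\<^sub>H y n) (\<Sum>n<N. b n \<otimes>\<^sub>H z n) = (\<Sum>n<(N::nat). cinner (y n) (z n))"
proof -
  have "cinner (\<Sum>n<N. b n \<otimes>\<^sub>H y n) (\<Sum>n<N. b n \<otimes>\<^sub>H z n) =
      (\<Sum>m<N. \<Sum>n<N. if n = m then cinner (y m) (z m) else 0)"
    unfolding cinner_sum_left cinner_sum_right cinner_tensor onb_cinner[OF assms]
    by (intro sum.cong refl) auto
  then show ?thesis by simp
qed

text \<open>A projection is a contraction: \<open>\<langle>s, u\<rangle> = \<langle>s, s\<rangle>\<close> for \<open>s = slice b N u\<close>.\<close>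

lemma norm_slice_le:
  assumes "is_onb b"
  shows "norm (slice b N *\<^sub>V u) \<le> norm u"
proof -
  let ?s = "slice b N *\<^sub>V u"
  have "cinner ?s u = (\<Sum>n<N. cinner (adj (creation (b n)) *\<^sub>V u) (adj (creation (b n)) *\<^sub>V u))"
    unfolding slice_apply cinner_sum_left by (simp add: cinner_adj_right)
  also have "\<dots> = cinner ?s ?s"
    unfolding slice_apply by (rule cinner_sum_onb[OF assms, symmetric])
  finally have "inner ?s u = (norm ?s)\<^sup>2" by (simp add: inner_eq_Re_cinner cinner_self)
  then have "norm ?s * norm ?s \<le> norm ?s * norm u"
    using norm_cauchy_schwarz[of ?s u] by (simp add: power2_eq_square)
  then show ?thesis
    by (cases "norm ?s = 0") (simp_all add: mult_le_cancel_left)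
qed

lemma slice_tendsto:
  assumes "is_onb b"
  shows "(\<lambda>N. slice b N *\<^sub>V u) \<longlonglongrightarrow> u"
proof -
  have "(\<lambda>N. slice b N *\<^sub>V u) \<longlonglongrightarrow> id_cblinfun *\<^sub>V u"
  proof (rule tendsto_cblinfun_total[OF tensor_total, where M=1])
    fix u assume "u \<in> range (\<lambda>(x, y). (x::'a) \<otimes>\<^sub>H (y::'b))"
    then obtain x :: 'a and y :: 'b where u: "u = x \<otimes>\<^sub>H y" by auto
    have "slice b N *\<^sub>V u = (\<Sum>n<N. cinner (b n) x *\<^sub>C b n) \<otimes>\<^sub>H y" for N
      unfolding u slice_apply adj_creation tensor_sum_left tensor_scaleC_left tensor_scaleC_right ..
    moreover have "(\<lambda>N. (\<Sum>n<N. cinner (b n) x *\<^sub>C b n) \<otimes>\<^sub>H y) \<longlonglongrightarrow> x \<otimes>\<^sub>H y"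
    proof -
      have bl: "bounded_linear (\<lambda>x :: 'a. x \<otimes>\<^sub>H y)"
        by (rule bounded_linear_intro[of _ "norm y"])
           (simp_all add: tensor_add_left scaleR_scaleC tensor_scaleC_left norm_tensor)
      have "(\<lambda>N. \<Sum>n<N. cinner (b n) x *\<^sub>C b n) \<longlonglongrightarrow> x"
        using assms by (simp add: is_onb_def sums_def)
      then show ?thesis by (rule bounded_linear.tendsto[OF bl])
    qed
    ultimately show "(\<lambda>N. slice b N *\<^sub>V u) \<longlonglongrightarrow> id_cblinfun *\<^sub>V u" by (simp add: u)
  qed (simp add: norm_slice_le[OF assms])
  then show ?thesis by simp
qed

lemma cinner_slice_amplified:
  assumes "is_onb b"
  shows "cinner (slice b N *\<^sub>V u) ((id_cblinfun \<otimes>\<^sub>O a) *\<^sub>V (slice b N *\<^sub>V u)) =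
    (\<Sum>n<N. cinner (adj (creation (b n)) *\<^sub>V u) (a *\<^sub>V (adj (creation (b n)) *\<^sub>V u)))"
  unfolding slice_apply cblinfun_sum tensor_op_tensor id_cblinfun_apply
  by (rule cinner_sum_onb[OF assms])

text \<open>On a slice the form of \<open>1 \<otimes> a\<close> is a finite sum of values of the form of \<open>a\<close>.\<close>

lemma positive_amplified:
  fixes a :: "'h::chilbert_space \<Rightarrow>\<^sub>C\<^sub>L 'h" and u :: "('a::separable_infinite_chilbert, 'h) htensor"
  assumes "positive_op a"
  shows "0 \<le> Re (cinner u ((id_cblinfun \<otimes>\<^sub>O a) *\<^sub>V u))"
proof -
  obtain b :: "nat \<Rightarrow> 'a" where b: "is_onb b" using onb_exists ..
  let ?q = "\<lambda>u :: ('a, 'h) htensor. Re (cinner u ((id_cblinfun \<otimes>\<^sub>O a) *\<^sub>V u))"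
  have "(\<lambda>N. ?q (slice b N *\<^sub>V u)) \<longlonglongrightarrow> ?q u"
    by (intro tendsto_Re tendsto_cinner tendsto_cblinfun slice_tendsto b)
  moreover have "0 \<le> ?q (slice b N *\<^sub>V u)" for N
    unfolding cinner_slice_amplified[OF b] Re_sum
    using assms by (intro sum_nonneg) (simp add: positive_op_iff)
  ultimately show ?thesis by (intro LIMSEQ_le_const) auto
qed

lift_definition rank_one :: "'a::complex_inner \<Rightarrow> 'b::complex_inner \<Rightarrow> 'a \<Rightarrow>\<^sub>C\<^sub>L 'b"
  is "\<lambda>v w z. cinner v z *\<^sub>C w"
proof -
  fix v :: 'a and w :: 'b
  have "norm (cinner v z *\<^sub>C w) \<le> (norm v * norm w) * norm z" for z
    using mult_right_mono[OF norm_cinner_le[of v z] norm_ge_zero[of w]] by (simp add: norm_scaleC mult_ac)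
  then show "bounded_clinear (\<lambda>z. cinner v z *\<^sub>C w)"
    by (intro bounded_clinearI[of _ "norm v * norm w"])
       (simp_all add: cinner_add_right cinner_scaleC_right scaleC_add_left scaleC_scaleC)
qed

lemma rank_one_apply [simp]: "rank_one v w *\<^sub>V z = cinner v z *\<^sub>C w"
  by (rule rank_one.rep_eq[THEN fun_cong])

section \<open>Suprema of directed sets of operators\<close>

text \<open>An increasing net converges weakly to its supremum \<open>s\<close>. The forms \<open>q a y = \<langle>y, (s - a) y\<rangle>\<close> decrease to a
  limit form \<open>L\<close>. If \<open>L x > 0\<close>, the limit \<open>\<phi>\<close> of the functionals \<open>y \<mapsto> Re \<langle>x, (s - a) y\<rangle>\<close> satisfies
  \<open>(\<phi> y)\<^sup>2 \<le> L x * L y\<close> by Cauchy-Schwarz. Represent \<open>\<phi>\<close> by a vector \<open>v\<close>. The positive operator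
  \<open>c = |v\<rangle>\<langle>v| / L x\<close> is then below every \<open>s - a\<close>, so \<open>s - c\<close> is an upper bound smaller than \<open>s\<close>.\<close>

lemma directed_sup_small:
  fixes s :: "'h::chilbert_space \<Rightarrow>\<^sub>C\<^sub>L 'h"
  assumes ne: "A \<noteq> {}" and sa: "\<And>a. a \<in> A \<Longrightarrow> self_adjoint a"
    and dir: "\<And>a b. a \<in> A \<Longrightarrow> b \<in> A \<Longrightarrow> \<exists>c\<in>A. op_le a c \<and> op_le b c"
    and sup: "is_op_sup A s" and e: "e > 0"
  shows "\<exists>a\<in>A. Re (cinner x ((s - a) *\<^sub>V x)) < e"
proof (rule ccontr)
  assume neg: "\<not> ?thesis"
  define q where "q a y = Re (cinner y ((s - a) *\<^sub>V y))" for a y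
  define r where "r a y = Re (cinner x ((s - a) *\<^sub>V y))" for a y
  have ss: "self_adjoint s" using sup by (simp add: is_op_sup_def)
  have sd: "self_adjoint (s - a)" if "a \<in> A" for a by (rule self_adjoint_diff[OF ss sa[OF that]])
  have pos: "positive_op (s - a)" if "a \<in> A" for a
    using sup that by (simp add: is_op_sup_def op_le_def)
  have q0: "0 \<le> q a y" if "a \<in> A" for a y
    using pos[OF that] by (simp add: q_def positive_op_iff)
  have qmono: "q c y \<le> q a y" if "a \<in> A" "c \<in> A" "op_le a c" for a c y
    using that(3) op_le_iff[OF sa[OF that(1)] sa[OF that(2)]] by (simp add: q_def cinner_diff_right)
  have le_refl: "op_le a a" if "a \<in> A" for a using op_le_iff[OF sa[OF that] sa[OF that]] by simp
  have le_trans: "op_le a c" if "a \<in> A" "b \<in> A" "c \<in> A" "op_le a b" "op_le b c" for a b c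
    using that op_le_iff[OF sa[OF that(1)] sa[OF that(2)]] op_le_iff[OF sa[OF that(2)] sa[OF that(3)]]
      op_le_iff[OF sa[OF that(1)] sa[OF that(3)]] order_trans by fast
  \<comment> \<open>The filter of tails of the directed set.\<close>
  define F where "F = (INF a\<in>A. principal {c \<in> A. op_le a c})"
  have evF: "eventually P F \<longleftrightarrow> (\<exists>a\<in>A. \<forall>c\<in>A. op_le a c \<longrightarrow> P c)" for P
  proof -
    have "\<exists>c\<in>A. principal {d \<in> A. op_le c d} \<le> inf (principal {d \<in> A. op_le a d}) (principal {d \<in> A. op_le b d})"
      if ab: "a \<in> A" "b \<in> A" for a b
    proof -
      obtain c where c: "c \<in> A" "op_le a c" "op_le b c" using dir[OF ab] by blast
      have "{d \<in> A. op_le c d} \<subseteq> {d \<in> A. op_le a d} \<inter> {d \<in> A. op_le b d}"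
        using le_trans[OF ab(1) c(1) _ c(2)] le_trans[OF ab(2) c(1) _ c(3)] by blast
      then show ?thesis using c(1) by (intro bexI[of _ c]) simp_all
    qed
    then have "eventually P F \<longleftrightarrow> (\<exists>a\<in>A. eventually P (principal {c \<in> A. op_le a c}))"
      unfolding F_def using ne by (subst eventually_INF_base) blast+
    then show ?thesis unfolding eventually_principal by blast
  qed
  have Fbot: "F \<noteq> bot"
    unfolding trivial_limit_def evF using le_refl by blast
  have FA: "eventually (\<lambda>a. a \<in> A) F" unfolding evF using ne by blast
  define L where "L y = (INF a\<in>A. q a y)" for y
  have bdd: "bdd_below ((\<lambda>a. q a y) ` A)" for y using q0 by (auto intro!: bdd_belowI2)
  have L_le: "L y \<le> q a y" if "a \<in> A" for a y unfolding L_def by (rule cINF_lower[OF bdd that])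
  have L0: "0 \<le> L y" for y unfolding L_def by (rule cINF_greatest[OF ne q0])
  have qL: "((\<lambda>a. q a y) \<longlongrightarrow> L y) F" for y
  proof (rule tendstoI)
    fix d :: real assume "d > 0"
    then have "L y < L y + d" by simp
    then obtain a where a: "a \<in> A" "q a y < L y + d" unfolding L_def cINF_less_iff[OF ne bdd] by blast
    have "dist (q c y) (L y) < d" if "c \<in> A" "op_le a c" for c
      using qmono[OF a(1) that, of y] L_le[OF that(1), of y] a(2) by (simp add: dist_real_def)
    then show "eventually (\<lambda>a. dist (q a y) (L y) < d) F" unfolding evF using a(1) by blast
  qed
  define \<phi> where "\<phi> y = (L (x + y) - L (x - y)) / 4" for y
  have rq: "r a y = (q a (x + y) - q a (x - y)) / 4" if "a \<in> A" for a y
  proof -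
    have "cinner y ((s - a) *\<^sub>V x) = cnj (cinner x ((s - a) *\<^sub>V y))"
      using self_adjoint_cinner[OF sd[OF that], of y x] cinner_commute[of "(s - a) *\<^sub>V y" x] by simp
    then have c: "Re (cinner y ((s - a) *\<^sub>V x)) = Re (cinner x ((s - a) *\<^sub>V y))" by simp
    have "q a (x + y) - q a (x - y) = 2 * Re (cinner x ((s - a) *\<^sub>V y)) + 2 * Re (cinner y ((s - a) *\<^sub>V x))"
      unfolding q_def cblinfun_add[of "s - a"] cblinfun_diff[of "s - a"] cinner_add_left cinner_add_right cinner_diff_left cinner_diff_right
      by simp
    with c show ?thesis by (simp add: r_def)
  qed
  have r\<phi>: "((\<lambda>a. r a y) \<longlongrightarrow> \<phi> y) F" for y
  proof -
    have "((\<lambda>a. (q a (x + y) - q a (x - y)) / 4) \<longlongrightarrow> \<phi> y) F"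
      unfolding \<phi>_def by (intro tendsto_intros qL) simp
    moreover have "eventually (\<lambda>a. (q a (x + y) - q a (x - y)) / 4 = r a y) F"
      using FA by (rule eventually_mono) (simp add: rq)
    ultimately show ?thesis by (rule Lim_transform_eventually)
  qed
  have \<phi>_add: "\<phi> (y + z) = \<phi> y + \<phi> z" for y z
  proof (rule tendsto_unique[OF Fbot r\<phi>])
    have "r a (y + z) = r a y + r a z" for a
      by (simp only: r_def cblinfun_add cinner_add_right plus_complex.sel)
    then show "((\<lambda>a. r a (y + z)) \<longlongrightarrow> \<phi> y + \<phi> z) F" by (simp add: tendsto_add r\<phi>)
  qed
  have \<phi>_scale: "\<phi> (k *\<^sub>R y) = k *\<^sub>R \<phi> y" for k y
  proof (rule tendsto_unique[OF Fbot r\<phi>])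
    have "r a (k *\<^sub>R y) = k *\<^sub>R r a y" for a
      by (simp only: r_def scaleR_scaleC cblinfun_scaleC cinner_scaleC_right) simp
    then show "((\<lambda>a. r a (k *\<^sub>R y)) \<longlongrightarrow> k *\<^sub>R \<phi> y) F" by (simp add: tendsto_mult_left r\<phi>)
  qed
  have \<phi>_CS: "(\<phi> y)\<^sup>2 \<le> L x * L y" for y
  proof (rule tendsto_le[OF Fbot])
    show "((\<lambda>a. q a x * q a y) \<longlongrightarrow> L x * L y) F" by (intro tendsto_intros qL)
    show "((\<lambda>a. (r a y)\<^sup>2) \<longlongrightarrow> (\<phi> y)\<^sup>2) F" by (intro tendsto_intros r\<phi>)
    show "eventually (\<lambda>a. (r a y)\<^sup>2 \<le> q a x * q a y) F"
      using FA by (rule eventually_mono) (simp only: q_def r_def positive_Cauchy_Schwarz sd pos)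
  qed
  have \<phi>x: "\<phi> x = L x"
    using tendsto_unique[OF Fbot r\<phi>[of x] qL[of x, unfolded q_def, folded r_def]] .
  have Lx: "L x > 0"
  proof -
    have "e \<le> L x" unfolding L_def using neg by (intro cINF_greatest[OF ne]) (auto simp: q_def not_less)
    with e show ?thesis by linarith
  qed
  obtain a0 where a0: "a0 \<in> A" using ne by blast
  obtain K where K: "K \<ge> 0" "\<And>y. norm ((s - a0) *\<^sub>V y) \<le> K * norm y" using cblinfun_bound by blast
  have "\<bar>\<phi> y\<bar> \<le> norm y * sqrt (L x * K)" for y
  proof -
    have "L y \<le> cmod (cinner y ((s - a0) *\<^sub>V y))"
      using L_le[OF a0, of y] complex_Re_le_cmod[of "cinner y ((s - a0) *\<^sub>V y)"] unfolding q_def by linarith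
    also have "\<dots> \<le> norm y * norm ((s - a0) *\<^sub>V y)" by (rule norm_cinner_le)
    also have "\<dots> \<le> norm y * (K * norm y)" by (intro mult_left_mono K) simp
    finally have "L x * L y \<le> L x * (norm y * (K * norm y))" by (rule mult_left_mono) (rule L0)
    also have "\<dots> = (norm y * sqrt (L x * K))\<^sup>2"
      using L0[of x] K(1) by (simp add: power_mult_distrib power2_eq_square[of "norm y"])
    finally have "(\<phi> y)\<^sup>2 \<le> (norm y * sqrt (L x * K))\<^sup>2" using \<phi>_CS[of y] by linarith
    then show ?thesis using L0[of x] K(1) by (simp add: abs_le_square_iff[symmetric] abs_mult)
  qed
  then have "bounded_linear \<phi>"
    by (intro bounded_linear_intro[of _ "sqrt (L x * K)"] \<phi>_add \<phi>_scale) simp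
  then obtain v where v: "\<And>y. \<phi> y = inner v y" using Riesz_real by blast
  define c where "c = rank_one v (complex_of_real (inverse (L x)) *\<^sub>C v)"
  have cc: "cinner z (c *\<^sub>V y) = complex_of_real (inverse (L x)) * (cinner v y * cinner z v)" for z y
    by (simp add: c_def cinner_scaleC_right mult_ac)
  have sc: "self_adjoint c"
    unfolding self_adjoint_def
  proof (rule adj_eqI)
    fix z y
    have "cinner (c *\<^sub>V y) z = cnj (cinner z (c *\<^sub>V y))" by (rule cinner_commute)
    also have "\<dots> = cinner y (c *\<^sub>V z)"
      unfolding cc using cinner_commute[of v y] cinner_commute[of z v] by simp
    finally show "cinner (c *\<^sub>V y) z = cinner y (c *\<^sub>V z)" .
  qed
  have ccz: "Re (cinner z (c *\<^sub>V z)) = inverse (L x) * (cmod (cinner v z))\<^sup>2" for z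
  proof -
    have "cinner v z * cinner z v = complex_of_real ((cmod (cinner v z))\<^sup>2)"
      unfolding complex_norm_square using cinner_commute[of z v] by simp
    then show ?thesis unfolding cc by (simp only: of_real_mult[symmetric] Re_complex_of_real)
  qed
  have cL: "Re (cinner z (c *\<^sub>V z)) \<le> L z" for z
  proof (cases "cinner v z = 0")
    case True
    then show ?thesis unfolding ccz using L0 by simp
  next
    case False
    \<comment> \<open>A phase that makes \<open>\<langle>v, p z\<rangle>\<close> equal to \<open>|\<langle>v, z\<rangle>|\<close>; the real functional \<open>\<phi>\<close> sees only real parts.\<close>
    define p where "p = cnj (cinner v z) / complex_of_real (cmod (cinner v z))"
    have p1: "cmod p = 1" using False by (simp add: p_def norm_divide)
    have pp: "cnj p * p = 1"
      using p1 complex_norm_square[of p] by (simp add: mult.commute)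
    have "cinner v (p *\<^sub>C z) = complex_of_real (cmod (cinner v z))"
      using False complex_norm_square[of "cinner v z"]
      by (simp add: cinner_scaleC_right p_def field_simps power2_eq_square)
    then have \<phi>p: "\<phi> (p *\<^sub>C z) = cmod (cinner v z)" by (simp add: v inner_eq_Re_cinner)
    have "q a (p *\<^sub>C z) = q a z" for a
      unfolding q_def cblinfun_scaleC cinner_scaleC_left cinner_scaleC_right mult.assoc[symmetric]
        pp pp[unfolded mult.commute[of "cnj p"]] by simp
    then have "L (p *\<^sub>C z) = L z" by (simp add: L_def)
    then have "(cmod (cinner v z))\<^sup>2 \<le> L x * L z" using \<phi>_CS[of "p *\<^sub>C z"] \<phi>p by simp
    then show ?thesis unfolding ccz using Lx by (simp add: field_simps)
  qed
  have "op_le s (s - c)"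
  proof -
    have "op_le a (s - c)" if "a \<in> A" for a
      unfolding op_le_iff[OF sa[OF that] self_adjoint_diff[OF ss sc]]
    proof
      fix z
      show "Re (cinner z (a *\<^sub>V z)) \<le> Re (cinner z ((s - c) *\<^sub>V z))"
        using order_trans[OF cL L_le[OF that], of z] by (simp add: q_def cinner_diff_right)
    qed
    then show ?thesis using sup self_adjoint_diff[OF ss sc] by (simp add: is_op_sup_def)
  qed
  then have "Re (cinner x (c *\<^sub>V x)) \<le> 0"
    unfolding op_le_iff[OF ss self_adjoint_diff[OF ss sc]] by (simp add: cinner_diff_right)
  then have "(cmod (cinner v x))\<^sup>2 \<le> 0" unfolding ccz using Lx by (simp add: field_simps mult_le_0_iff)
  then have "cinner v x = 0" by simp
  then show False using \<phi>x Lx by (simp add: v inner_eq_Re_cinner)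
qed

lemma directed_finite_upper_bound:
  assumes ne: "A \<noteq> {}" and dir: "\<And>a b. a \<in> A \<Longrightarrow> b \<in> A \<Longrightarrow> \<exists>c\<in>A. op_le a c \<and> op_le b c"
    and sa: "\<And>a. a \<in> A \<Longrightarrow> self_adjoint a" and fin: "finite B" "B \<subseteq> A"
  shows "\<exists>c\<in>A. \<forall>b\<in>B. op_le b c"
  using fin
proof (induction B)
  case empty
  then show ?case using ne by blast
next
  case (insert b B)
  then obtain c where c: "c \<in> A" "\<forall>b\<in>B. op_le b c" by blast
  have bA: "b \<in> A" "B \<subseteq> A" using insert.prems by simp_all
  obtain d where d: "d \<in> A" "op_le b d" "op_le c d" using dir[OF bA(1) c(1)] by blast
  have "op_le b' d" if b': "b' \<in> B" for b'
  proof -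
    have "b' \<in> A" "op_le b' c" using b' bA c(2) by blast+
    then show ?thesis
      using op_le_iff[OF sa sa, of b' c] op_le_iff[OF sa sa, of c d] op_le_iff[OF sa sa, of b' d] c(1) d
      by (metis order_trans)
  qed
  with d show ?case by (intro bexI[of _ d]) auto
qed

lemma quadratic_form_add_le:
  assumes "\<And>x. 0 \<le> Re (cinner x (T *\<^sub>V x))"
  shows "Re (cinner (u + v) (T *\<^sub>V (u + v))) \<le> 2 * Re (cinner u (T *\<^sub>V u)) + 2 * Re (cinner v (T *\<^sub>V v))"
  using assms[of "u - v"]
  by (simp add: cblinfun_add cblinfun_diff cinner_add_left cinner_add_right cinner_diff_left cinner_diff_right)

text \<open>Split \<open>u\<close> into a slice and a remainder. The remainder is small, uniformly for all \<open>a\<close> above a fixed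
  \<open>a0\<close>; the slice has finitely many coefficients, and by directedness one \<open>a\<close> is good for all of them.\<close>

lemma amplified_directed_sup_small:
  fixes s :: "'h::chilbert_space \<Rightarrow>\<^sub>C\<^sub>L 'h" and u :: "('a::separable_infinite_chilbert, 'h) htensor"
  assumes ne: "A \<noteq> {}" and sa: "\<And>a. a \<in> A \<Longrightarrow> self_adjoint a"
    and dir: "\<And>a b. a \<in> A \<Longrightarrow> b \<in> A \<Longrightarrow> \<exists>c\<in>A. op_le a c \<and> op_le b c"
    and sup: "is_op_sup A s" and e: "e > 0"
  shows "\<exists>a\<in>A. Re (cinner u ((id_cblinfun \<otimes>\<^sub>O (s - a)) *\<^sub>V u)) < e"
proof -
  obtain b :: "nat \<Rightarrow> 'a" where b: "is_onb b" using onb_exists ..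
  define q where "q a u = Re (cinner u ((id_cblinfun \<otimes>\<^sub>O (s - a)) *\<^sub>V u))" for a and u :: "('a, 'h) htensor"
  have pos: "positive_op (s - a)" if "a \<in> A" for a
    using sup that by (simp add: is_op_sup_def op_le_def)
  have q0: "0 \<le> q a u" if "a \<in> A" for a u
    unfolding q_def by (rule positive_amplified[OF pos[OF that]])
  have qmono: "q c u \<le> q a u" if "op_le a c" for a c u
  proof -
    have "0 \<le> Re (cinner u ((id_cblinfun \<otimes>\<^sub>O (c - a)) *\<^sub>V u))"
      using that by (intro positive_amplified) (simp add: op_le_def)
    then show ?thesis unfolding q_def by (simp add: tensor_op_diff_right cinner_diff_right)
  qed
  obtain a0 where a0: "a0 \<in> A" using ne by blast
  obtain K where K: "K \<ge> 0" "\<And>u :: ('a, 'h) htensor. norm ((id_cblinfun \<otimes>\<^sub>O (s - a0)) *\<^sub>V u) \<le> K * norm u"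
    using cblinfun_bound[of "id_cblinfun \<otimes>\<^sub>O (s - a0) :: ('a, 'h) htensor \<Rightarrow>\<^sub>C\<^sub>L ('a, 'h) htensor"] by blast
  have q_le: "q a0 v \<le> K * (norm v)\<^sup>2" for v
  proof -
    have "q a0 v \<le> norm v * norm ((id_cblinfun \<otimes>\<^sub>O (s - a0)) *\<^sub>V v)"
      unfolding q_def by (rule order_trans[OF complex_Re_le_cmod norm_cinner_le])
    also have "\<dots> \<le> norm v * (K * norm v)" by (intro mult_left_mono K) simp
    finally show ?thesis by (simp add: power2_eq_square mult_ac)
  qed
  have "(\<lambda>N. K * (norm (u - slice b N *\<^sub>V u))\<^sup>2) \<longlonglongrightarrow> K * (norm (u - u))\<^sup>2"
    by (intro tendsto_intros slice_tendsto b)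
  then have "(\<lambda>N. K * (norm (u - slice b N *\<^sub>V u))\<^sup>2) \<longlonglongrightarrow> 0" by simp
  moreover have e4: "e / 4 > 0" using e by simp
  ultimately have "\<exists>N0. \<forall>N\<ge>N0. norm (K * (norm (u - slice b N *\<^sub>V u))\<^sup>2 - 0) < e / 4"
    by (rule LIMSEQ_D)
  then obtain N where "norm (K * (norm (u - slice b N *\<^sub>V u))\<^sup>2 - 0) < e / 4" by blast
  then have N: "K * (norm (u - slice b N *\<^sub>V u))\<^sup>2 < e / 4" by simp
  define y where "y n = adj (creation (b n)) *\<^sub>V u" for n
  \<comment> \<open>Chosen so that \<open>N\<close> errors of size \<open>d\<close> add up to at most \<open>e / 4\<close>, also for \<open>N = 0\<close>.\<close>
  define d where "d = e / (4 * (real N + 1))"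
  have d: "d > 0" using e by (simp add: d_def)
  have "\<forall>n. \<exists>a\<in>A. Re (cinner (y n) ((s - a) *\<^sub>V y n)) < d"
    using directed_sup_small[OF ne sa dir sup d] by blast
  then obtain a where a: "\<And>n. a n \<in> A" "\<And>n. Re (cinner (y n) ((s - a n) *\<^sub>V y n)) < d" by metis
  obtain c where c: "c \<in> A" "\<forall>b\<in>insert a0 (a ` {..<N}). op_le b c"
    using directed_finite_upper_bound[OF ne dir sa, of "insert a0 (a ` {..<N})"] a0 a(1) by blast
  have "q c (slice b N *\<^sub>V u) = (\<Sum>n<N. Re (cinner (y n) ((s - c) *\<^sub>V y n)))"
    unfolding q_def cinner_slice_amplified[OF b] Re_sum y_def ..
  also have "\<dots> \<le> (\<Sum>n<N. d)"
  proof (rule sum_mono)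
    fix n assume "n \<in> {..<N}"
    then have "op_le (a n) c" using c(2) by blast
    then have "0 \<le> Re (cinner (y n) ((c - a n) *\<^sub>V y n))" by (simp add: op_le_def positive_op_iff)
    then show "Re (cinner (y n) ((s - c) *\<^sub>V y n)) \<le> d"
      using a(2)[of n] by (simp add: cinner_diff_right)
  qed
  also have "\<dots> \<le> e / 4" using e by (simp add: d_def field_simps)
  finally have q1: "q c (slice b N *\<^sub>V u) \<le> e / 4" .
  have "q c (u - slice b N *\<^sub>V u) \<le> q a0 (u - slice b N *\<^sub>V u)" using c(2) by (intro qmono) blast
  then have q2: "q c (u - slice b N *\<^sub>V u) < e / 4" using q_le[of "u - slice b N *\<^sub>V u"] N by linarith
  have "q c (slice b N *\<^sub>V u + (u - slice b N *\<^sub>V u)) \<le> 2 * q c (slice b N *\<^sub>V u) + 2 * q c (u - slice b N *\<^sub>V u)"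
    unfolding q_def by (rule quadratic_form_add_le) (rule positive_amplified[OF pos[OF c(1)]])
  then have "q c u < e" using q1 q2 by simp
  with c(1) show ?thesis unfolding q_def by blast
qed

section \<open>The endomorphism defined by a unitary\<close>

definition amplify :: "('a::chilbert_space, 'h::chilbert_space) htensor \<Rightarrow>\<^sub>C\<^sub>L 'h \<Rightarrow> ('h \<Rightarrow>\<^sub>C\<^sub>L 'h) \<Rightarrow> ('h \<Rightarrow>\<^sub>C\<^sub>L 'h)"
  where "amplify w a = w o\<^sub>C\<^sub>L (id_cblinfun \<otimes>\<^sub>O a) o\<^sub>C\<^sub>L adj w"

lemma amplify_apply: "amplify w a *\<^sub>V x = w *\<^sub>V ((id_cblinfun \<otimes>\<^sub>O a) *\<^sub>V (adj w *\<^sub>V x))"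
  by (simp add: amplify_def)

lemma adj_id [simp]: "adj id_cblinfun = id_cblinfun"
  by (rule adj_eqI) simp

lemma adj_amplify:
  fixes w :: "('a::chilbert_space, 'h::chilbert_space) htensor \<Rightarrow>\<^sub>C\<^sub>L 'h"
  shows "adj (amplify w a) = amplify w (adj a)"
proof (rule adj_eqI)
  fix x y
  have "(id_cblinfun :: 'a \<Rightarrow>\<^sub>C\<^sub>L 'a) \<otimes>\<^sub>O adj a = adj (id_cblinfun \<otimes>\<^sub>O a)"
    by (simp add: adj_tensor_op)
  then have "cinner (amplify w (adj a) *\<^sub>V y) x =
      cinner (adj (id_cblinfun \<otimes>\<^sub>O a) *\<^sub>V (adj w *\<^sub>V y)) (adj w *\<^sub>V x)"
    unfolding amplify_apply by (simp only: cinner_adj_right[of _ w, symmetric])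
  then show "cinner (amplify w (adj a) *\<^sub>V y) x = cinner y (amplify w a *\<^sub>V x)"
    unfolding amplify_apply by (simp only: cinner_adj)
qed

lemma cinner_amplify: "cinner x (amplify w a *\<^sub>V x) = cinner (adj w *\<^sub>V x) ((id_cblinfun \<otimes>\<^sub>O a) *\<^sub>V (adj w *\<^sub>V x))"
  unfolding amplify_apply by (simp only: cinner_adj)

lemma amplify_star_endomorphism:
  fixes w :: "('a::chilbert_space, 'h::chilbert_space) htensor \<Rightarrow>\<^sub>C\<^sub>L 'h"
  assumes "unitary w"
  shows "unital_star_endomorphism (amplify w)"
  unfolding unital_star_endomorphism_def
proof (intro conjI allI)
  show "amplify w (a + b) = amplify w a + amplify w b" for a b
    by (rule cblinfun_eqI) (simp add: amplify_apply tensor_op_add_right cblinfun_add)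
  show "amplify w (c *\<^sub>C a) = c *\<^sub>C amplify w a" for a c
    by (rule cblinfun_eqI) (simp add: amplify_apply tensor_op_scaleC_right cblinfun_scaleC)
  show "amplify w (a o\<^sub>C\<^sub>L b) = amplify w a o\<^sub>C\<^sub>L amplify w b" for a b
  proof (rule cblinfun_eqI)
    fix x
    have "(id_cblinfun :: 'a \<Rightarrow>\<^sub>C\<^sub>L 'a) \<otimes>\<^sub>O (a o\<^sub>C\<^sub>L b) = (id_cblinfun \<otimes>\<^sub>O a) o\<^sub>C\<^sub>L (id_cblinfun \<otimes>\<^sub>O b)"
      by (rule cblinfun_eq_tensor) (simp add: tensor_op_tensor)
    then show "amplify w (a o\<^sub>C\<^sub>L b) *\<^sub>V x = (amplify w a o\<^sub>C\<^sub>L amplify w b) *\<^sub>V x"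
      by (simp add: amplify_apply unitary_adj_apply[OF assms])
  qed
  show "amplify w (adj a) = adj (amplify w a)" for a by (rule adj_amplify[symmetric])
  show "amplify w id_cblinfun = id_cblinfun"
    by (rule cblinfun_eqI) (simp add: amplify_apply tensor_op_id unitary_apply_adj[OF assms])
qed

lemma amplify_normal:
  fixes w :: "('a::separable_infinite_chilbert, 'h::chilbert_space) htensor \<Rightarrow>\<^sub>C\<^sub>L 'h"
  shows "normal_map (amplify w)"
  unfolding normal_map_def
proof (intro allI impI)
  fix A :: "('h \<Rightarrow>\<^sub>C\<^sub>L 'h) set" and s
  assume "A \<noteq> {} \<and> (\<forall>a\<in>A. self_adjoint a) \<and> (\<forall>a\<in>A. \<forall>b\<in>A. \<exists>c\<in>A. op_le a c \<and> op_le b c) \<and> is_op_sup A s"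
  then have ne: "A \<noteq> {}" and sa: "\<And>a. a \<in> A \<Longrightarrow> self_adjoint a"
    and dir: "\<And>a b. a \<in> A \<Longrightarrow> b \<in> A \<Longrightarrow> \<exists>c\<in>A. op_le a c \<and> op_le b c" and sup: "is_op_sup A s" by simp_all
  have ss: "self_adjoint s" using sup by (simp add: is_op_sup_def)
  have am_sa: "self_adjoint (amplify w a)" if "self_adjoint a" for a
    using that by (simp add: self_adjoint_def adj_amplify)
  show "is_op_sup (amplify w ` A) (amplify w s)"
    unfolding is_op_sup_def
  proof (intro conjI ballI allI impI)
    show "self_adjoint (amplify w s)" by (rule am_sa[OF ss])
    fix b assume "b \<in> amplify w ` A"
    then obtain a where a: "a \<in> A" "b = amplify w a" by blast
    have "0 \<le> Re (cinner u ((id_cblinfun \<otimes>\<^sub>O (s - a)) *\<^sub>V u))" for u :: "('a, 'h) htensor"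
      using sup a(1) by (intro positive_amplified) (simp add: is_op_sup_def op_le_def)
    then show "op_le b (amplify w s)"
      unfolding a(2) op_le_iff[OF am_sa[OF sa[OF a(1)]] am_sa[OF ss]] cinner_amplify
      by (simp add: tensor_op_diff_right cinner_diff_right)
  next
    fix b assume b: "self_adjoint b \<and> (\<forall>a\<in>amplify w ` A. op_le a b)"
    show "op_le (amplify w s) b"
      unfolding op_le_iff[OF am_sa[OF ss] conjunct1[OF b]]
    proof
      fix x
      show "Re (cinner x (amplify w s *\<^sub>V x)) \<le> Re (cinner x (b *\<^sub>V x))"
      proof (rule field_le_epsilon)
        fix e :: real assume "e > 0"
        then obtain a where a: "a \<in> A"
          "Re (cinner (adj w *\<^sub>V x) ((id_cblinfun \<otimes>\<^sub>O (s - a)) *\<^sub>V (adj w *\<^sub>V x))) < e"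
          using amplified_directed_sup_small[OF ne sa dir sup] by blast
        then have "Re (cinner x (amplify w s *\<^sub>V x)) - Re (cinner x (amplify w a *\<^sub>V x)) < e"
          unfolding cinner_amplify by (simp add: tensor_op_diff_right cinner_diff_right)
        moreover have "op_le (amplify w a) b" using b a(1) by blast
        then have "Re (cinner x (amplify w a *\<^sub>V x)) \<le> Re (cinner x (b *\<^sub>V x))"
          unfolding op_le_iff[OF am_sa[OF sa[OF a(1)]] conjunct1[OF b]] ..
        ultimately show "Re (cinner x (amplify w s *\<^sub>V x)) \<le> Re (cinner x (b *\<^sub>V x)) + e" by linarith
      qed
    qed
  qed
qed

text \<open>The range of \<open>amplify w\<close> misses \<open>w (p \<otimes> 1) w\<^sup>*\<close> for the projection \<open>p\<close> onto the first basis vector: an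
  equation \<open>1 \<otimes> a = p \<otimes> 1\<close> gives \<open>a h = 0\<close> on the second basis vector and \<open>a h = h\<close> on the first.\<close>

lemma amplify_not_bij:
  fixes w :: "('a::separable_infinite_chilbert, 'h::chilbert_space) htensor \<Rightarrow>\<^sub>C\<^sub>L 'h"
  assumes w: "unitary w" and ne: "(UNIV :: 'h set) \<noteq> {0}"
  shows "\<not> bij (amplify w)"
proof
  assume "bij (amplify w)"
  obtain b :: "nat \<Rightarrow> 'a" where b: "is_onb b" using onb_exists ..
  define p where "p = rank_one (b 0) (b 0)"
  obtain a where a: "amplify w a = w o\<^sub>C\<^sub>L (p \<otimes>\<^sub>O id_cblinfun) o\<^sub>C\<^sub>L adj w"
    using \<open>bij (amplify w)\<close> by (metis bij_is_surj surjD)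
  have eq: "x \<otimes>\<^sub>H (a *\<^sub>V h) = (p *\<^sub>V x) \<otimes>\<^sub>H h" for x h
  proof -
    have "amplify w a *\<^sub>V (w *\<^sub>V (x \<otimes>\<^sub>H h)) = w *\<^sub>V (x \<otimes>\<^sub>H (a *\<^sub>V h))"
      by (simp add: amplify_apply unitary_adj_apply[OF w] tensor_op_tensor)
    moreover have "amplify w a *\<^sub>V (w *\<^sub>V (x \<otimes>\<^sub>H h)) = w *\<^sub>V ((p *\<^sub>V x) \<otimes>\<^sub>H h)"
      unfolding a by (simp add: unitary_adj_apply[OF w] tensor_op_tensor)
    ultimately have "adj w *\<^sub>V (w *\<^sub>V (x \<otimes>\<^sub>H (a *\<^sub>V h))) = adj w *\<^sub>V (w *\<^sub>V ((p *\<^sub>V x) \<otimes>\<^sub>H h))" by simp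
    then show ?thesis by (simp only: unitary_adj_apply[OF w])
  qed
  have "h = 0" for h :: 'h
  proof -
    have "b 1 \<otimes>\<^sub>H (a *\<^sub>V h) = 0" using eq[of "b 1" h] by (simp add: p_def onb_cinner[OF b])
    then have "norm (b 1) * norm (a *\<^sub>V h) = 0" unfolding norm_tensor[symmetric] by simp
    then have "a *\<^sub>V h = 0" by (simp add: onb_norm[OF b])
    then have "b 0 \<otimes>\<^sub>H h = 0" using eq[of "b 0" h] by (simp add: p_def onb_cinner[OF b] scaleC_one)
    then have "norm (b 0) * norm h = 0" unfolding norm_tensor[symmetric] by simp
    then show ?thesis by (simp add: onb_norm[OF b])
  qed
  with ne show False by blast
qed

lemma norm_amplified_le:
  fixes a :: "'h::chilbert_space \<Rightarrow>\<^sub>C\<^sub>L 'h" and u :: "('a::chilbert_space, 'h) htensor"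
  assumes K: "\<And>h. norm (a *\<^sub>V h) \<le> K * norm h" "K \<ge> 0"
  shows "norm ((id_cblinfun \<otimes>\<^sub>O a) *\<^sub>V u) \<le> K * norm u"
proof -
  have cont: "continuous_on UNIV (\<lambda>u :: ('a, 'h) htensor. norm ((id_cblinfun \<otimes>\<^sub>O a) *\<^sub>V u))" "continuous_on UNIV (\<lambda>u :: ('a, 'h) htensor. K * norm u)"
    by (intro continuous_intros linear_continuous_on bounded_linear_cblinfun_apply)+
  have "cspan (range (\<lambda>(x::'a, y::'h). x \<otimes>\<^sub>H y)) \<subseteq> {u :: ('a, 'h) htensor. norm ((id_cblinfun \<otimes>\<^sub>O a) *\<^sub>V u) \<le> K * norm u}"
  proof
    fix u assume "u \<in> cspan (range (\<lambda>(x::'a, y::'h). x \<otimes>\<^sub>H y))"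
    from cspan_range_sum_list[OF this] obtain ts where u: "u = (\<Sum>(c, i)\<leftarrow>ts. c *\<^sub>C (case i of (x, y) \<Rightarrow> x \<otimes>\<^sub>H y))" ..
    define us where "us = map (\<lambda>(c, x, y). (c *\<^sub>C x, y)) ts"
    have u': "u = (\<Sum>(x, y)\<leftarrow>us. x \<otimes>\<^sub>H y)"
      unfolding u us_def by (simp add: comp_def case_prod_unfold tensor_scaleC_left)
    have "(id_cblinfun \<otimes>\<^sub>O a) *\<^sub>V u = (\<Sum>(x, y)\<leftarrow>us. x \<otimes>\<^sub>H (a *\<^sub>V y))"
      unfolding u' by (simp add: cblinfun_sum_list case_prod_unfold tensor_op_tensor)
    then show "u \<in> {u :: ('a, 'h) htensor. norm ((id_cblinfun \<otimes>\<^sub>O a) *\<^sub>V u) \<le> K * norm u}"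
      using tensor_sum_bound_right[OF K(2,1), of us] u' by simp
  qed
  moreover have "closed {u :: ('a, 'h) htensor. norm ((id_cblinfun \<otimes>\<^sub>O a) *\<^sub>V u) \<le> K * norm u}"
    by (rule closed_Collect_le[OF cont])
  ultimately have "closure (cspan (range (\<lambda>(x, y). x \<otimes>\<^sub>H y))) \<subseteq> {u :: ('a, 'h) htensor. norm ((id_cblinfun \<otimes>\<^sub>O a) *\<^sub>V u) \<le> K * norm u}"
    by (rule closure_minimal)
  then show ?thesis unfolding tensor_total by blast
qed

lemma norm_amplify_le:
  fixes w :: "('a::chilbert_space, 'h::chilbert_space) htensor \<Rightarrow>\<^sub>C\<^sub>L 'h"
  assumes w: "unitary w" and K: "\<And>h. norm (a *\<^sub>V h) \<le> K * norm h" "K \<ge> 0"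
  shows "norm (amplify w a *\<^sub>V x) \<le> K * norm x"
proof -
  have "norm (amplify w a *\<^sub>V x) = norm ((id_cblinfun \<otimes>\<^sub>O a) *\<^sub>V (adj w *\<^sub>V x))"
    unfolding amplify_apply by (rule unitary_norm[OF w])
  also have "\<dots> \<le> K * norm (adj w *\<^sub>V x)" by (rule norm_amplified_le[OF K])
  also have "norm (adj w *\<^sub>V x) = norm x" by (rule unitary_norm[OF unitary_adj[OF w]])
  finally show ?thesis .
qed

section \<open>The semigroup of a measurable right dilation\<close>

text \<open>Choose a compact \<open>T\<close> inside \<open>A\<close> and an open \<open>U\<close> around \<open>T\<close> of less than twice its measure. A small shift
  of \<open>T\<close> stays inside \<open>U\<close>, so it cannot be disjoint from \<open>T\<close>.\<close>

lemma Steinhaus: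
  fixes A :: "real set"
  assumes A: "A \<in> lmeasurable" "bounded A" and pos: "measure lebesgue A > 0"
  shows "\<exists>d>0. \<forall>h. \<bar>h\<bar> < d \<longrightarrow> (\<exists>r\<in>A. r + h \<in> A)"
proof -
  have AS: "A \<in> sets lebesgue" using A(1) by (rule fmeasurableD)
  obtain T where T: "closed T" "T \<subseteq> A" "A - T \<in> lmeasurable" "emeasure lebesgue (A - T) < ennreal (measure lebesgue A)"
    by (rule sets_lebesgue_inner_closed[OF AS pos])
  have cT: "compact T" using T(1,2) A(2) bounded_subset compact_eq_bounded_closed by blast
  then have mT: "T \<in> lmeasurable" by (rule lmeasurable_compact)
  have "measure lebesgue (A - T) < measure lebesgue A"
    using T(4) emeasure_eq_measure2[OF T(3)] by (simp add: ennreal_less_iff)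
  moreover have "measure lebesgue (A - T) = measure lebesgue A - measure lebesgue T"
    by (rule measurable_measure_Diff[OF A(1) fmeasurableD[OF mT] T(2)])
  ultimately have Tpos: "measure lebesgue T > 0" by simp
  obtain U where U: "open U" "T \<subseteq> U" "U - T \<in> lmeasurable" "emeasure lebesgue (U - T) < ennreal (measure lebesgue T)"
    by (rule sets_lebesgue_outer_open[OF fmeasurableD[OF mT] Tpos])
  have less: "measure lebesgue (U - T) < measure lebesgue T"
    using U(4) emeasure_eq_measure2[OF U(3)] by (simp add: ennreal_less_iff)
  have "U = T \<union> (U - T)" using U(2) by blast
  then have mU: "U \<in> lmeasurable" using fmeasurable.Un[OF mT U(3)] by simp
  have "measure lebesgue (U - T) = measure lebesgue U - measure lebesgue T"
    by (rule measurable_measure_Diff[OF mU fmeasurableD[OF mT] U(2)])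
  with less have U2: "measure lebesgue U < 2 * measure lebesgue T" by simp
  obtain d where d: "d > 0" "(\<Union>x\<in>T. ball x d) \<subseteq> U"
    by (rule compact_subset_open_imp_ball_epsilon_subset[OF cT U(1,2)])
  have "\<exists>r\<in>A. r + h \<in> A" if h: "\<bar>h\<bar> < d" for h
  proof (rule ccontr)
    assume neg: "\<not> ?thesis"
    have disj: "T \<inter> ((+) h ` T) = {}"
    proof (rule ccontr)
      assume "T \<inter> ((+) h ` T) \<noteq> {}"
      then obtain r where "r \<in> T" "h + r \<in> T" by blast
      then have "r \<in> A" "r + h \<in> A" using T(2) by (auto simp: add.commute)
      with neg show False by blast
    qed
    have mh: "(+) h ` T \<in> lmeasurable" by (rule measurable_translation[OF mT])
    have "(+) h ` T \<subseteq> U"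
    proof
      fix y assume "y \<in> (+) h ` T"
      then obtain x where "x \<in> T" "y \<in> ball x d" using h by (auto simp: dist_real_def)
      then show "y \<in> U" using d(2) by blast
    qed
    then have "T \<union> (+) h ` T \<subseteq> U" using U(2) by blast
    then have "measure lebesgue (T \<union> (+) h ` T) \<le> measure lebesgue U"
      by (rule measure_mono_fmeasurable[OF _ fmeasurableD[OF fmeasurable.Un[OF mT mh]] mU])
    moreover have "measure lebesgue (T \<union> (+) h ` T) = measure lebesgue T + measure lebesgue ((+) h ` T)"
      by (rule measure_Un2[OF mT mh, THEN trans]) (use disj in \<open>simp add: Diff_triv Int_commute\<close>)
    moreover have "measure lebesgue ((+) h ` T) = measure lebesgue T" by (rule measure_translation)
    ultimately show False using U2 by simp
  qed
  with d(1) show ?thesis by blast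
qed

lemma quadratic_form_diff_le:
  assumes K: "\<And>u. norm (T *\<^sub>V u) \<le> K * norm u" "K \<ge> 0"
  shows "cmod (cinner u (T *\<^sub>V u) - cinner v (T *\<^sub>V v)) \<le> K * (norm u + norm v) * norm (u - v)"
proof -
  have "cinner u (T *\<^sub>V u) - cinner v (T *\<^sub>V v) = cinner (u - v) (T *\<^sub>V u) + cinner v (T *\<^sub>V (u - v))"
    by (simp add: cblinfun_diff cinner_diff_left cinner_diff_right)
  then have "cmod (cinner u (T *\<^sub>V u) - cinner v (T *\<^sub>V v)) \<le>
      cmod (cinner (u - v) (T *\<^sub>V u)) + cmod (cinner v (T *\<^sub>V (u - v)))"
    by (simp only: norm_triangle_ineq)
  also have "\<dots> \<le> norm (u - v) * norm (T *\<^sub>V u) + norm v * norm (T *\<^sub>V (u - v))"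
    by (intro add_mono norm_cinner_le)
  also have "\<dots> \<le> norm (u - v) * (K * norm u) + norm v * (K * norm (u - v))"
    by (intro add_mono mult_left_mono K) simp_all
  also have "\<dots> = K * (norm u + norm v) * norm (u - v)" by (simp add: algebra_simps)
  finally show ?thesis .
qed

lemma cinner_polarization:
  "cinner y (a *\<^sub>V x) = (1 / 4) * (cinner (x + y) (a *\<^sub>V (x + y)) - cinner (x - y) (a *\<^sub>V (x - y)) +
    \<i> * (cinner (x + \<i> *\<^sub>C y) (a *\<^sub>V (x + \<i> *\<^sub>C y)) - cinner (x - \<i> *\<^sub>C y) (a *\<^sub>V (x - \<i> *\<^sub>C y))))"
  by (simp add: cblinfun_add cblinfun_diff cblinfun_scaleC cinner_add_left cinner_add_right cinner_diff_left
      cinner_diff_right cinner_scaleC_left cinner_scaleC_right algebra_simps)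

text \<open>Weak measurability of the dilation is all that the continuity of the semigroup rests on. The guard
  \<open>t > 0\<close> is needed since \<open>w t\<close> is arbitrary for other \<open>t\<close>.\<close>

locale measurable_right_dilation =
  fixes m :: "real \<Rightarrow> real \<Rightarrow> 'a \<Rightarrow> 'a \<Rightarrow> 'a::separable_infinite_chilbert"
    and w :: "real \<Rightarrow> ('a, 'h::separable_infinite_chilbert) htensor \<Rightarrow>\<^sub>C\<^sub>L 'h"
  assumes arveson: "arveson_system m" and dilation: "right_dilation m w"
    and measurable: "\<And>u x. (\<lambda>t. if t > 0 then cinner (w t *\<^sub>V u) x else 0) \<in> borel_measurable borel"
begin

text \<open>The value for \<open>t \<le> 0\<close> is chosen such that \<open>\<theta> 0\<close> is the identity.\<close>

definition \<theta> :: "real \<Rightarrow> ('h \<Rightarrow>\<^sub>C\<^sub>L 'h) \<Rightarrow> ('h \<Rightarrow>\<^sub>C\<^sub>L 'h)"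
  where "\<theta> t = (if t > 0 then amplify (w t) else id)"

lemma unitary_w: "t > 0 \<Longrightarrow> unitary (w t)"
  using dilation by (simp add: right_dilation_def)

lemma dilation_mult:
  assumes "s > 0" "t > 0"
  shows "w t *\<^sub>V (x \<otimes>\<^sub>H (w s *\<^sub>V (y \<otimes>\<^sub>H h))) = w (s + t) *\<^sub>V (m t s x y \<otimes>\<^sub>H h)"
proof -
  have "w t o\<^sub>C\<^sub>L (id_cblinfun \<otimes>\<^sub>O w s) o\<^sub>C\<^sub>L tensor_assoc = w (s + t) o\<^sub>C\<^sub>L (system_unitary m t s \<otimes>\<^sub>O id_cblinfun)"
    using dilation assms by (simp add: right_dilation_def)
  then have "(w t o\<^sub>C\<^sub>L (id_cblinfun \<otimes>\<^sub>O w s) o\<^sub>C\<^sub>L tensor_assoc) *\<^sub>V ((x \<otimes>\<^sub>H y) \<otimes>\<^sub>H h) =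
      (w (s + t) o\<^sub>C\<^sub>L (system_unitary m t s \<otimes>\<^sub>O id_cblinfun)) *\<^sub>V ((x \<otimes>\<^sub>H y) \<otimes>\<^sub>H h)"
    by (rule arg_cong)
  then show ?thesis
    by (simp add: tensor_assoc_tensor tensor_op_tensor system_unitary(2)[OF arveson assms(2,1)])
qed

lemma amplify_intertwines: "t > 0 \<Longrightarrow> amplify (w t) a *\<^sub>V (w t *\<^sub>V (x \<otimes>\<^sub>H h)) = w t *\<^sub>V (x \<otimes>\<^sub>H (a *\<^sub>V h))"
  by (simp add: amplify_apply unitary_adj_apply[OF unitary_w] tensor_op_tensor)

lemma amplify_eqI:
  assumes t: "t > 0" and eq: "\<And>x h. c *\<^sub>V (w t *\<^sub>V (x \<otimes>\<^sub>H h)) = w t *\<^sub>V (x \<otimes>\<^sub>H (a *\<^sub>V h))"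
  shows "c = amplify (w t) a"
proof (rule cblinfun_eqI)
  fix x
  have "c o\<^sub>C\<^sub>L w t = w t o\<^sub>C\<^sub>L (id_cblinfun \<otimes>\<^sub>O a)"
    by (rule cblinfun_eq_tensor) (simp add: eq tensor_op_tensor)
  then have "(c o\<^sub>C\<^sub>L w t) *\<^sub>V (adj (w t) *\<^sub>V x) = (w t o\<^sub>C\<^sub>L (id_cblinfun \<otimes>\<^sub>O a)) *\<^sub>V (adj (w t) *\<^sub>V x)" by simp
  then show "c *\<^sub>V x = amplify (w t) a *\<^sub>V x"
    by (simp add: amplify_apply unitary_apply_adj[OF unitary_w[OF t]])
qed

text \<open>Both sides intertwine the operators \<open>h \<mapsto> w\<^bsub>s + t\<^esub> (m s t x y \<otimes> h)\<close>, and the products \<open>m s t x y\<close> are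
  total, which is expressed by cancelling the unitary \<open>U \<otimes> 1\<close>.\<close>

lemma amplify_amplify:
  assumes s: "s > 0" and t: "t > 0"
  shows "amplify (w s) (amplify (w t) a) = amplify (w (s + t)) a"
proof (rule amplify_eqI)
  define U where "U = system_unitary m s t"
  define c where "c = amplify (w s) (amplify (w t) a)"
  have U: "unitary U" "\<And>x y. U *\<^sub>V (x \<otimes>\<^sub>H y) = m s t x y"
    unfolding U_def by (rule system_unitary[OF arveson s t])+
  have "c o\<^sub>C\<^sub>L w (s + t) o\<^sub>C\<^sub>L (U \<otimes>\<^sub>O id_cblinfun) = w (s + t) o\<^sub>C\<^sub>L (id_cblinfun \<otimes>\<^sub>O a) o\<^sub>C\<^sub>L (U \<otimes>\<^sub>O id_cblinfun)"
  proof (rule cblinfun_eq_total[OF tensor3_total])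
    fix u assume "u \<in> range (\<lambda>(x, y, z). ((x::'a) \<otimes>\<^sub>H (y::'a)) \<otimes>\<^sub>H (z::'h))"
    then obtain x y h where u: "u = (x \<otimes>\<^sub>H y) \<otimes>\<^sub>H h" by auto
    have ww: "w (s + t) *\<^sub>V (m s t x y \<otimes>\<^sub>H h) = w s *\<^sub>V (x \<otimes>\<^sub>H (w t *\<^sub>V (y \<otimes>\<^sub>H h)))" for h
      using dilation_mult[OF t s, of x y h] by (simp add: add.commute)
    show "(c o\<^sub>C\<^sub>L w (s + t) o\<^sub>C\<^sub>L (U \<otimes>\<^sub>O id_cblinfun)) *\<^sub>V u =
        (w (s + t) o\<^sub>C\<^sub>L (id_cblinfun \<otimes>\<^sub>O a) o\<^sub>C\<^sub>L (U \<otimes>\<^sub>O id_cblinfun)) *\<^sub>V u"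
      by (simp add: u tensor_op_tensor U(2) ww c_def amplify_intertwines s t)
  qed
  then have eq: "(c o\<^sub>C\<^sub>L w (s + t) o\<^sub>C\<^sub>L (U \<otimes>\<^sub>O id_cblinfun)) *\<^sub>V u =
      (w (s + t) o\<^sub>C\<^sub>L (id_cblinfun \<otimes>\<^sub>O a) o\<^sub>C\<^sub>L (U \<otimes>\<^sub>O id_cblinfun)) *\<^sub>V u" for u by simp
  fix z h
  show "amplify (w s) (amplify (w t) a) *\<^sub>V (w (s + t) *\<^sub>V (z \<otimes>\<^sub>H h)) = w (s + t) *\<^sub>V (z \<otimes>\<^sub>H (a *\<^sub>V h))"
    using eq[of "(adj U *\<^sub>V z) \<otimes>\<^sub>H h"]
    by (simp add: tensor_op_tensor unitary_apply_adj[OF U(1)] c_def)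
qed (use s t in simp)

lemma \<theta>_add: "s \<ge> 0 \<Longrightarrow> t \<ge> 0 \<Longrightarrow> \<theta> (s + t) = \<theta> s \<circ> \<theta> t"
  by (cases "s = 0"; cases "t = 0") (simp_all add: \<theta>_def fun_eq_iff amplify_amplify)

theorem E0_semigroup_\<theta>: "E0_semigroup \<theta>"
  unfolding E0_semigroup_def
proof (intro conjI allI impI)
  show "\<theta> 0 = id" by (simp add: \<theta>_def)
  show "\<theta> (s + t) = \<theta> s \<circ> \<theta> t" if "s \<ge> 0" "t \<ge> 0" for s t by (rule \<theta>_add[OF that])
  show "unital_star_endomorphism (\<theta> t)" if "t \<ge> 0" for t
  proof (cases "t = 0")
    case True
    then show ?thesis by (simp add: \<theta>_def unital_star_endomorphism_def)
  next
    case False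
    then show ?thesis using that by (simp add: \<theta>_def amplify_star_endomorphism unitary_w)
  qed
  show "normal_map (\<theta> t)" if "t \<ge> 0" for t
    by (cases "t > 0") (simp_all add: \<theta>_def amplify_normal, simp add: normal_map_def)
  show "\<not> bij (\<theta> t)" if "t > 0" for t
    using dilation that by (simp add: \<theta>_def amplify_not_bij unitary_w right_dilation_def)
qed

theorem has_Arveson_system_\<theta>: "has_Arveson_system \<theta> m"
  unfolding has_Arveson_system_def
  by (intro exI[of _ w] conjI dilation) (simp add: \<theta>_def amplify_def)

lemma norm_\<theta>_le: "(\<And>h. norm (a *\<^sub>V h) \<le> K * norm h) \<Longrightarrow> K \<ge> 0 \<Longrightarrow> norm (\<theta> t a *\<^sub>V x) \<le> K * norm x"
  by (cases "t > 0") (simp_all add: \<theta>_def norm_amplify_le unitary_w)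

text \<open>All \<open>w\<^sub>r\<^sup>* x\<close> have the norm of \<open>x\<close>, so their distance to a vector \<open>u\<close> is determined by the measurable
  function \<open>r \<mapsto> \<langle>w\<^sub>r u, x\<rangle>\<close>. Countably many balls of radius \<open>e / 2\<close> cover the space, hence one of them
  is visited on a set of positive measure, to which Steinhaus' theorem applies.\<close>

lemma dilation_returns:
  assumes T: "T > 0" and e: "e > 0"
  shows "\<exists>d>0. \<forall>h. \<bar>h\<bar> < d \<longrightarrow>
    (\<exists>r. 0 < r \<and> r < T \<and> 0 < r + h \<and> norm (adj (w (r + h)) *\<^sub>V x - adj (w r) *\<^sub>V x) < e)"
proof -
  obtain D :: "'h set" where D: "countable D" "\<And>x e. e > 0 \<Longrightarrow> \<exists>y\<in>D. dist y x < e"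
    using separable by blast
  define C where "C = (\<lambda>d. adj (w 1) *\<^sub>V d) ` D"
  define f where "f u t = (if t > 0 then cinner (w t *\<^sub>V u) x else 0)" for u and t :: real
  define A where "A u = {t \<in> {0<..<T}. (norm x)\<^sup>2 + (norm u)\<^sup>2 - 2 * Re (f u t) < (e / 2)\<^sup>2}" for u
  have near: "t \<in> A u \<longleftrightarrow> norm (adj (w t) *\<^sub>V x - u) < e / 2" if t: "0 < t" "t < T" for t u
  proof -
    have n: "norm (adj (w t) *\<^sub>V x) = norm x" by (rule unitary_norm[OF unitary_adj[OF unitary_w[OF t(1)]]])
    have "inner (adj (w t) *\<^sub>V x) u = Re (f u t)"
      unfolding inner_eq_Re_cinner cinner_adj f_def
      using t(1) arg_cong[OF cinner_commute[of x "w t *\<^sub>V u"], of Re] by simp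
    then have "(norm (adj (w t) *\<^sub>V x - u))\<^sup>2 = (norm x)\<^sup>2 + (norm u)\<^sup>2 - 2 * Re (f u t)"
      by (simp add: n[symmetric] power2_norm_eq_inner inner_diff_left inner_diff_right inner_commute)
    then have "t \<in> A u \<longleftrightarrow> (norm (adj (w t) *\<^sub>V x - u))\<^sup>2 < (e / 2)\<^sup>2" using t by (simp add: A_def)
    also have "\<dots> \<longleftrightarrow> norm (adj (w t) *\<^sub>V x - u) < e / 2"
    proof
      assume "(norm (adj (w t) *\<^sub>V x - u))\<^sup>2 < (e / 2)\<^sup>2"
      then show "norm (adj (w t) *\<^sub>V x - u) < e / 2"
        by (rule power2_less_imp_less) (use e in simp)
    next
      assume "norm (adj (w t) *\<^sub>V x - u) < e / 2"
      then show "(norm (adj (w t) *\<^sub>V x - u))\<^sup>2 < (e / 2)\<^sup>2"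
        by (rule power_strict_mono) simp_all
    qed
    finally show ?thesis .
  qed
  have f: "f u \<in> borel_measurable borel" for u unfolding f_def by (rule measurable)
  have Am: "A u \<in> sets borel" for u
  proof -
    have "(\<lambda>t. (norm x)\<^sup>2 + (norm u)\<^sup>2 - 2 * Re (f u t)) \<in> borel_measurable borel"
      by (intro borel_measurable_diff borel_measurable_times borel_measurable_const
          measurable_compose[OF f borel_measurable_Re])
    then have "{t \<in> space borel. (norm x)\<^sup>2 + (norm u)\<^sup>2 - 2 * Re (f u t) < (e / 2)\<^sup>2} \<in> sets borel"
      by (rule borel_measurable_less) (rule borel_measurable_const)
    then have "{0<..<T} \<inter> {t \<in> space borel. (norm x)\<^sup>2 + (norm u)\<^sup>2 - 2 * Re (f u t) < (e / 2)\<^sup>2} \<in> sets borel"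
      by (rule sets.Int[OF borel_open[OF open_greaterThanLessThan]])
    moreover have "A u = {0<..<T} \<inter> {t \<in> space borel. (norm x)\<^sup>2 + (norm u)\<^sup>2 - 2 * Re (f u t) < (e / 2)\<^sup>2}"
      unfolding A_def space_borel by blast
    ultimately show "A u \<in> sets borel" by (simp only:)
  qed
  have cover: "{0<..<T} = (\<Union>u\<in>C. A u)"
  proof (intro equalityI subsetI)
    fix t assume t: "t \<in> {0<..<T}"
    have u1: "unitary (w 1)" by (rule unitary_w) simp
    have "e / 2 > 0" using e by simp
    from D(2)[OF this] obtain d where d: "d \<in> D" "dist d (w 1 *\<^sub>V (adj (w t) *\<^sub>V x)) < e / 2" ..
    have "norm (adj (w t) *\<^sub>V x - adj (w 1) *\<^sub>V d) = norm (w 1 *\<^sub>V (adj (w t) *\<^sub>V x - adj (w 1) *\<^sub>V d))"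
      by (rule unitary_norm[OF u1, symmetric])
    also have "\<dots> = dist d (w 1 *\<^sub>V (adj (w t) *\<^sub>V x))"
      by (simp add: cblinfun_diff unitary_apply_adj[OF u1] dist_norm norm_minus_commute)
    finally have "norm (adj (w t) *\<^sub>V x - adj (w 1) *\<^sub>V d) < e / 2" using d(2) by simp
    then have "t \<in> A (adj (w 1) *\<^sub>V d)" using near[of t] t by simp
    moreover have "adj (w 1) *\<^sub>V d \<in> C" unfolding C_def using d(1) by (rule imageI)
    ultimately show "t \<in> (\<Union>u\<in>C. A u)" by blast
  next
    fix t assume "t \<in> (\<Union>u\<in>C. A u)"
    then show "t \<in> {0<..<T}" unfolding A_def by blast
  qed
  have "\<exists>u\<in>C. emeasure lborel (A u) \<noteq> 0"
  proof (rule ccontr)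
    assume neg: "\<not> ?thesis"
    have "(\<Union>u\<in>C. A u) \<in> null_sets lborel"
    proof (rule null_sets_UN')
      show "countable C" unfolding C_def using D(1) by (rule countable_image)
      fix u assume "u \<in> C"
      then show "A u \<in> null_sets lborel" using neg Am[of u] by (intro null_setsI) auto
    qed
    then have "emeasure lborel {0<..<T} = 0" unfolding cover by (rule null_setsD1)
    then show False using T by simp
  qed
  then obtain u where u: "emeasure lborel (A u) \<noteq> 0" by blast
  have bA: "bounded (A u)" by (rule bounded_subset[of "{0<..<T}"]) (auto simp: A_def)
  have lA: "A u \<in> lmeasurable"
  proof (rule fmeasurableI2[of "{0..T}"])
    show "{0..T} \<in> lmeasurable" by (rule lmeasurable_interval(1)[of 0 T, unfolded cbox_interval])
    show "A u \<subseteq> {0..T}" by (auto simp: A_def)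
    show "A u \<in> sets lebesgue" using Am[of u] by (simp add: sets_completionI_sets)
  qed
  have "emeasure lebesgue (A u) = emeasure lborel (A u)" by (simp add: Am)
  then have "measure lebesgue (A u) \<noteq> 0" using u emeasure_eq_measure2[OF lA] by auto
  then have "measure lebesgue (A u) > 0" using measure_nonneg[of lebesgue "A u"] by linarith
  from Steinhaus[OF lA bA this] obtain d where d: "d > 0" "\<And>h. \<bar>h\<bar> < d \<Longrightarrow> \<exists>r\<in>A u. r + h \<in> A u" by blast
  have "\<exists>r. 0 < r \<and> r < T \<and> 0 < r + h \<and> norm (adj (w (r + h)) *\<^sub>V x - adj (w r) *\<^sub>V x) < e" if h: "\<bar>h\<bar> < d" for h
  proof -
    obtain r where r: "r \<in> A u" "r + h \<in> A u" using d(2)[OF h] by blast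
    then have b: "0 < r" "r < T" "0 < r + h" "r + h < T" by (auto simp: A_def)
    have "norm (adj (w (r + h)) *\<^sub>V x - u) < e / 2" "norm (adj (w r) *\<^sub>V x - u) < e / 2"
      using r near b by blast+
    then have "norm (adj (w (r + h)) *\<^sub>V x - adj (w r) *\<^sub>V x) < e"
      using norm_triangle_ineq4[of "adj (w (r + h)) *\<^sub>V x - u" "adj (w r) *\<^sub>V x - u"] by simp
    with b show ?thesis by blast
  qed
  with d(1) show ?thesis by blast
qed

text \<open>For \<open>t' = t + h\<close> choose \<open>r < t\<close> as in \<open>dilation_returns\<close>. With \<open>b = \<theta>\<^bsub>t - r\<^esub> a\<close> both quantities are
  values of the bounded form of \<open>1 \<otimes> b\<close>, at the nearby vectors \<open>w\<^bsub>r + h\<^esub>\<^sup>* x\<close> and \<open>w\<^sub>r\<^sup>* x\<close>, and the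
  bound of \<open>b\<close> does not depend on \<open>r\<close>.\<close>

lemma continuous_quadratic_\<theta>: "continuous_on {0<..} (\<lambda>t. cinner x (\<theta> t a *\<^sub>V x))"
  unfolding continuous_on_iff
proof (intro ballI allI impI)
  fix t e :: real assume "t \<in> {0<..}" and e: "0 < e"
  then have t: "t > 0" by simp
  obtain K where K: "K \<ge> 0" "\<And>h. norm (a *\<^sub>V h) \<le> K * norm h" using cblinfun_bound by blast
  \<comment> \<open>The form of \<open>1 \<otimes> b\<close> changes by at most \<open>K * 2 \<parallel>x\<parallel>\<close> times the distance of the two vectors; adding one makes \<open>M\<close> positive.\<close>
  define M where "M = K * (norm x + norm x) + 1"
  have M: "M > 0" using K(1) by (simp add: M_def add_nonneg_pos)
  have "e / M > 0" using e M by simp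
  from dilation_returns[OF t this, of x] obtain d where d: "d > 0" "\<And>h. \<bar>h\<bar> < d \<Longrightarrow>
    \<exists>r. 0 < r \<and> r < t \<and> 0 < r + h \<and> norm (adj (w (r + h)) *\<^sub>V x - adj (w r) *\<^sub>V x) < e / M" by blast
  have "dist (cinner x (\<theta> t' a *\<^sub>V x)) (cinner x (\<theta> t a *\<^sub>V x)) < e" if t': "dist t' t < d" for t'
  proof -
    have "\<bar>t' - t\<bar> < d" using t' by (simp add: dist_real_def)
    then obtain r where r: "0 < r" "r < t" "0 < r + (t' - t)"
      "norm (adj (w (r + (t' - t))) *\<^sub>V x - adj (w r) *\<^sub>V x) < e / M" using d(2) by blast
    define b where "b = \<theta> (t - r) a"
    define u where "u = adj (w (r + (t' - t))) *\<^sub>V x"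
    define v where "v = adj (w r) *\<^sub>V x"
    have bb: "norm ((id_cblinfun \<otimes>\<^sub>O b) *\<^sub>V z) \<le> K * norm z" for z :: "('a, 'h) htensor"
      unfolding b_def by (intro norm_amplified_le norm_\<theta>_le K)
    have nu: "norm u = norm x" "norm v = norm x"
      unfolding u_def v_def using r by (simp_all add: unitary_norm[OF unitary_adj[OF unitary_w]])
    have "\<theta> t a = \<theta> r b" using fun_cong[OF \<theta>_add[of r "t - r"], of a] r by (simp add: b_def)
    then have 1: "cinner x (\<theta> t a *\<^sub>V x) = cinner v ((id_cblinfun \<otimes>\<^sub>O b) *\<^sub>V v)"
      using r(1) by (simp add: \<theta>_def cinner_amplify v_def)
    have "\<theta> t' a = \<theta> (r + (t' - t)) b"
      using fun_cong[OF \<theta>_add[of "r + (t' - t)" "t - r"], of a] r by (simp add: b_def)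
    then have 2: "cinner x (\<theta> t' a *\<^sub>V x) = cinner u ((id_cblinfun \<otimes>\<^sub>O b) *\<^sub>V u)"
      using r(3) by (simp add: \<theta>_def cinner_amplify u_def)
    have "dist (cinner x (\<theta> t' a *\<^sub>V x)) (cinner x (\<theta> t a *\<^sub>V x)) \<le> K * (norm u + norm v) * norm (u - v)"
      unfolding 1 2 dist_norm by (rule quadratic_form_diff_le[OF bb K(1)])
    also have "\<dots> \<le> M * norm (u - v)" by (intro mult_right_mono) (simp_all add: nu M_def)
    also have "\<dots> < e" using r(4) M by (simp add: u_def v_def pos_less_divide_eq mult.commute)
    finally show ?thesis .
  qed
  with d(1) show "\<exists>d>0. \<forall>t'\<in>{0<..}. dist t' t < d \<longrightarrow> dist (cinner x (\<theta> t' a *\<^sub>V x)) (cinner x (\<theta> t a *\<^sub>V x)) < e"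
    by blast
qed

lemma continuous_weak_\<theta>: "continuous_on {0<..} (\<lambda>t. cinner y (\<theta> t a *\<^sub>V x))"
  unfolding cinner_polarization[of y "\<theta> _ a" x] by (intro continuous_intros continuous_quadratic_\<theta>)

text \<open>Weak continuity implies strong continuity for homomorphisms, because
  \<open>\<parallel>\<theta>\<^sub>s(a) x\<parallel>\<^sup>2 = \<langle>x, \<theta>\<^sub>s(a\<^sup>* a) x\<rangle>\<close> is continuous in \<open>s\<close>.\<close>

lemma continuous_\<theta>_pos: "continuous_on {0<..} (\<lambda>t. \<theta> t a *\<^sub>V x)"
  unfolding continuous_on_def
proof
  fix t :: real assume t: "t \<in> {0<..}"
  let ?F = "at t within {0<..}"
  have n: "(norm (\<theta> s a *\<^sub>V x))\<^sup>2 = Re (cinner x (\<theta> s (adj a o\<^sub>C\<^sub>L a) *\<^sub>V x))" if "s > 0" for s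
  proof -
    have "\<theta> s (adj a o\<^sub>C\<^sub>L a) = adj (\<theta> s a) o\<^sub>C\<^sub>L \<theta> s a"
      using that amplify_star_endomorphism[OF unitary_w[OF that]]
      by (simp add: \<theta>_def unital_star_endomorphism_def)
    then show ?thesis by (simp add: cinner_adj_right cinner_self)
  qed
  have l1: "((\<lambda>s. Re (cinner x (\<theta> s (adj a o\<^sub>C\<^sub>L a) *\<^sub>V x))) \<longlongrightarrow> (norm (\<theta> t a *\<^sub>V x))\<^sup>2) ?F"
    unfolding n[OF t[unfolded greaterThan_iff]]
    by (intro tendsto_Re) (use continuous_weak_\<theta> t in \<open>simp add: continuous_on_def\<close>)
  have l2: "((\<lambda>s. Re (cinner (\<theta> t a *\<^sub>V x) (\<theta> s a *\<^sub>V x))) \<longlongrightarrow> Re (cinner (\<theta> t a *\<^sub>V x) (\<theta> t a *\<^sub>V x))) ?F"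
    by (intro tendsto_Re) (use continuous_weak_\<theta> t in \<open>simp add: continuous_on_def\<close>)
  have "((\<lambda>s. Re (cinner x (\<theta> s (adj a o\<^sub>C\<^sub>L a) *\<^sub>V x)) + (norm (\<theta> t a *\<^sub>V x))\<^sup>2 -
      2 * Re (cinner (\<theta> t a *\<^sub>V x) (\<theta> s a *\<^sub>V x))) \<longlongrightarrow>
      (norm (\<theta> t a *\<^sub>V x))\<^sup>2 + (norm (\<theta> t a *\<^sub>V x))\<^sup>2 - 2 * Re (cinner (\<theta> t a *\<^sub>V x) (\<theta> t a *\<^sub>V x))) ?F"
    by (intro tendsto_intros l1 l2)
  moreover have "eventually (\<lambda>s. Re (cinner x (\<theta> s (adj a o\<^sub>C\<^sub>L a) *\<^sub>V x)) + (norm (\<theta> t a *\<^sub>V x))\<^sup>2 -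
      2 * Re (cinner (\<theta> t a *\<^sub>V x) (\<theta> s a *\<^sub>V x)) = (norm (\<theta> s a *\<^sub>V x - \<theta> t a *\<^sub>V x))\<^sup>2) ?F"
    unfolding eventually_at_filter
  proof (rule always_eventually, intro allI impI)
    fix s :: real assume "s \<in> {0<..}"
    then have "s > 0" by simp
    show "Re (cinner x (\<theta> s (adj a o\<^sub>C\<^sub>L a) *\<^sub>V x)) + (norm (\<theta> t a *\<^sub>V x))\<^sup>2 -
      2 * Re (cinner (\<theta> t a *\<^sub>V x) (\<theta> s a *\<^sub>V x)) = (norm (\<theta> s a *\<^sub>V x - \<theta> t a *\<^sub>V x))\<^sup>2"
      unfolding n[OF \<open>s > 0\<close>, symmetric]
      by (simp add: inner_eq_Re_cinner[symmetric] power2_norm_eq_inner inner_diff_left inner_diff_right inner_commute)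
  qed
  ultimately have "((\<lambda>s. (norm (\<theta> s a *\<^sub>V x - \<theta> t a *\<^sub>V x))\<^sup>2) \<longlongrightarrow>
      (norm (\<theta> t a *\<^sub>V x))\<^sup>2 + (norm (\<theta> t a *\<^sub>V x))\<^sup>2 - 2 * Re (cinner (\<theta> t a *\<^sub>V x) (\<theta> t a *\<^sub>V x))) ?F"
    by (rule Lim_transform_eventually)
  then have "((\<lambda>s. (norm (\<theta> s a *\<^sub>V x - \<theta> t a *\<^sub>V x))\<^sup>2) \<longlongrightarrow> 0) ?F"
    by (simp add: cinner_self)
  then have "((\<lambda>s. sqrt ((norm (\<theta> s a *\<^sub>V x - \<theta> t a *\<^sub>V x))\<^sup>2)) \<longlongrightarrow> sqrt 0) ?F" by (rule tendsto_real_sqrt)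
  then have "((\<lambda>s. \<theta> s a *\<^sub>V x - \<theta> t a *\<^sub>V x) \<longlongrightarrow> 0) ?F" by (simp add: tendsto_norm_zero_iff)
  then show "((\<lambda>s. \<theta> s a *\<^sub>V x) \<longlongrightarrow> \<theta> t a *\<^sub>V x) ?F" by (rule Lim_null[THEN iffD2])
qed

text \<open>The isometry \<open>V h = w\<^sub>1 (b 0 \<otimes> h)\<close> satisfies \<open>\<theta>\<^bsub>1 + t\<^esub>(a) V = V \<theta>\<^sub>t(a)\<close>, which moves the question from
  \<open>[0, \<infinity>)\<close> into \<open>[1, \<infinity>)\<close>.\<close>

theorem strongly_continuous_\<theta>: "strongly_continuous \<theta>"
  unfolding strongly_continuous_def
proof (intro allI)
  fix a x
  obtain b :: "nat \<Rightarrow> 'a" where b: "is_onb b" using onb_exists ..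
  define V where "V = w 1 o\<^sub>C\<^sub>L creation (b 0)"
  have V: "adj V *\<^sub>V (V *\<^sub>V h) = h" for h
    by (simp add: V_def adj_compose unitary_adj_apply[OF unitary_w] adj_creation onb_cinner[OF b] scaleC_one)
  have eq: "adj V *\<^sub>V (\<theta> (1 + t) a *\<^sub>V (V *\<^sub>V x)) = \<theta> t a *\<^sub>V x" if "t \<in> {0..}" for t
  proof -
    have "\<theta> (1 + t) a = amplify (w 1) (\<theta> t a)"
      using fun_cong[OF \<theta>_add[of 1 t], of a] that by (simp add: \<theta>_def)
    then have "\<theta> (1 + t) a *\<^sub>V (V *\<^sub>V x) = V *\<^sub>V (\<theta> t a *\<^sub>V x)"
      by (simp add: V_def amplify_intertwines)
    then show ?thesis by (simp add: V)
  qed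
  have "continuous_on {0..} (\<lambda>t. adj V *\<^sub>V (\<theta> (1 + t) a *\<^sub>V (V *\<^sub>V x)))"
  proof (rule continuous_on_compose2[OF linear_continuous_on[OF bounded_linear_cblinfun_apply, of UNIV]])
    show "continuous_on {0..} (\<lambda>t. \<theta> (1 + t) a *\<^sub>V (V *\<^sub>V x))"
      by (rule continuous_on_compose2[OF continuous_\<theta>_pos]) (auto intro!: continuous_intros)
  qed simp
  then show "continuous_on {0..} (\<lambda>t. \<theta> t a *\<^sub>V x)" by (rule continuous_on_eq) (rule eq)
qed

end

section \<open>Stable sections of an Arveson system\<close>

lemma set_integral_translation:
  fixes h :: "real \<Rightarrow> 'b::{banach, second_countable_topology}"
  shows "set_integrable lborel {a + c..<b + c} h \<longleftrightarrow> set_integrable lborel {a..<b} (\<lambda>r. h (r + c))"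
    and "set_lebesgue_integral lborel {a + c..<b + c} h = set_lebesgue_integral lborel {a..<b} (\<lambda>r. h (r + c))"
proof -
  have eq: "(\<lambda>x. indicat_real {a + c..<b + c} (c + 1 * x) *\<^sub>R h (c + 1 * x)) =
      (\<lambda>x. indicat_real {a..<b} x *\<^sub>R h (x + c))"
    by (rule ext) (simp add: indicator_def add.commute)
  show "set_integrable lborel {a + c..<b + c} h \<longleftrightarrow> set_integrable lborel {a..<b} (\<lambda>r. h (r + c))"
    unfolding set_integrable_def eq[symmetric]
    by (rule lborel_integrable_real_affine_iff[of 1, symmetric]) simp
  show "set_lebesgue_integral lborel {a + c..<b + c} h = set_lebesgue_integral lborel {a..<b} (\<lambda>r. h (r + c))"
    unfolding set_lebesgue_integral_def eq[symmetric]
    by (subst lborel_integral_real_affine[of 1 _ c]) simp_all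
qed

text \<open>Compare the two ways to cut the interval from \<open>l\<close> to \<open>k + 1\<close>: the pieces \<open>[l, k)\<close> and \<open>[l + 1, k + 1)\<close> carry
  the same integral.\<close>

lemma set_integral_periodic:
  fixes h :: "real \<Rightarrow> 'b::{banach, second_countable_topology}"
  assumes per: "\<And>r. l \<le> r \<Longrightarrow> h (r + 1) = h r" and int: "set_integrable lborel {l..<l + 1} h" and le: "l \<le> k"
  shows "set_integrable lborel {k..<k + 1} h"
    and "set_lebesgue_integral lborel {k..<k + 1} h = set_lebesgue_integral lborel {l..<l + 1} h"
proof -
  have tr: "set_integrable lborel {l + 1..<b + 1} h \<longleftrightarrow> set_integrable lborel {l..<b} h"
    "set_lebesgue_integral lborel {l + 1..<b + 1} h = set_lebesgue_integral lborel {l..<b} h" for b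
  proof -
    have "set_integrable lborel {l..<b} (\<lambda>r. h (r + 1)) \<longleftrightarrow> set_integrable lborel {l..<b} h"
      by (rule set_integrable_cong) (auto simp: per)
    then show "set_integrable lborel {l + 1..<b + 1} h \<longleftrightarrow> set_integrable lborel {l..<b} h"
      unfolding set_integral_translation(1) .
    have "set_lebesgue_integral lborel {l..<b} (\<lambda>r. h (r + 1)) = set_lebesgue_integral lborel {l..<b} h"
      by (rule set_lebesgue_integral_cong) (auto simp: per)
    then show "set_lebesgue_integral lborel {l + 1..<b + 1} h = set_lebesgue_integral lborel {l..<b} h"
      unfolding set_integral_translation(2) .
  qed
  have big: "set_integrable lborel {l..<l + real n} h" for n
  proof (induction n)
    case 0
    show ?case by simp
  next
    case (Suc n)
    have "{l..<l + real (Suc n)} = {l..<l + 1} \<union> {l + 1..<(l + real n) + 1}" by auto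
    moreover have "set_integrable lborel \<dots> h"
      by (rule set_integrable_Un[OF int]) (simp_all add: tr(1) Suc.IH)
    ultimately show ?case by simp
  qed
  obtain n :: nat where n: "k + 1 \<le> l + real n" using real_arch_simple[of "k + 1 - l"] by (auto simp: algebra_simps)
  have sub: "set_integrable lborel {a..<b} h" if "l \<le> a" "b \<le> k + 1" for a b
    by (rule set_integrable_subset[OF big[of n]]) (use that n in auto)
  show "set_integrable lborel {k..<k + 1} h" by (rule sub) (use le in auto)
  have "set_lebesgue_integral lborel {l..<k} h + set_lebesgue_integral lborel {k..<k + 1} h =
      set_lebesgue_integral lborel ({l..<k} \<union> {k..<k + 1}) h"
    by (rule set_integral_Un[symmetric]) (use le in \<open>auto intro!: sub\<close>)
  also have "{l..<k} \<union> {k..<k + 1} = {l..<l + 1} \<union> {l + 1..<k + 1}" using le by auto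
  also have "set_lebesgue_integral lborel \<dots> h =
      set_lebesgue_integral lborel {l..<l + 1} h + set_lebesgue_integral lborel {l + 1..<k + 1} h"
    by (rule set_integral_Un) (use le in \<open>auto intro!: sub\<close>)
  also have "set_lebesgue_integral lborel {l + 1..<k + 1} h = set_lebesgue_integral lborel {l..<k} h" by (rule tr(2))
  finally show "set_lebesgue_integral lborel {k..<k + 1} h = set_lebesgue_integral lborel {l..<l + 1} h" by simp
qed

lemma borel_measurable_cinner:
  fixes f g :: "'c \<Rightarrow> 'a::separable_infinite_chilbert"
  assumes "f \<in> borel_measurable M" "g \<in> borel_measurable M"
  shows "(\<lambda>r. cinner (f r) (g r)) \<in> borel_measurable M"
proof (rule borel_measurable_continuous_Pair[OF assms])
  show "continuous_on UNIV (\<lambda>x :: 'a \<times> 'a. cinner (fst x) (snd x))"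
    by (intro bounded_bilinear.continuous_on[OF bounded_bilinear_cinner] continuous_intros)
qed

lemma borel_measurable_scaleC:
  fixes f :: "'c \<Rightarrow> 'a::separable_infinite_chilbert"
  assumes "f \<in> borel_measurable M"
  shows "(\<lambda>r. c *\<^sub>C f r) \<in> borel_measurable M"
  by (rule borel_measurable_continuous_on[OF linear_continuous_on[OF
    bounded_bilinear.bounded_linear_right[OF bounded_bilinear_scaleC]] assms])

text \<open>The unit vector \<open>e\<close> of \<open>E\<^sub>1\<close> continues sections from one unit interval to the next.\<close>

locale arveson_unit =
  fixes m :: "real \<Rightarrow> real \<Rightarrow> 'a \<Rightarrow> 'a \<Rightarrow> 'a::separable_infinite_chilbert" and e :: 'a
  assumes arveson: "arveson_system m" and unit: "norm e = 1"
begin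

lemma m_system_unitary: "s > 0 \<Longrightarrow> t > 0 \<Longrightarrow> m s t x y = system_unitary m s t *\<^sub>V (x \<otimes>\<^sub>H y)"
  by (rule system_unitary(2)[OF arveson, symmetric])

lemma m_assoc: "r > 0 \<Longrightarrow> s > 0 \<Longrightarrow> t > 0 \<Longrightarrow> m (r + s) t (m r s x y) z = m r (s + t) x (m s t y z)"
  using arveson by (simp add: arveson_system_def)

lemma cinner_m: "s > 0 \<Longrightarrow> t > 0 \<Longrightarrow> cinner (m s t x y) (m s t x' y') = cinner x x' * cinner y y'"
  by (simp add: m_system_unitary unitary_cinner[OF system_unitary(1)[OF arveson]] cinner_tensor)

lemma norm_m: "s > 0 \<Longrightarrow> t > 0 \<Longrightarrow> norm (m s t x y) = norm x * norm y"
  by (simp add: m_system_unitary unitary_norm[OF system_unitary(1)[OF arveson]] norm_tensor)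

lemma m_zero_right [simp]: "s > 0 \<Longrightarrow> t > 0 \<Longrightarrow> m s t x 0 = 0"
  by (simp add: m_system_unitary)

lemma m_add_left: "s > 0 \<Longrightarrow> t > 0 \<Longrightarrow> m s t (x + x') y = m s t x y + m s t x' y"
  by (simp add: m_system_unitary tensor_add_left cblinfun_add)

lemma m_scaleC_left: "s > 0 \<Longrightarrow> t > 0 \<Longrightarrow> m s t (c *\<^sub>C x) y = c *\<^sub>C m s t x y"
  by (simp add: m_system_unitary tensor_scaleC_left cblinfun_scaleC)

lemma m_ext:
  assumes st: "s > 0" "t > 0" and eq: "\<And>x y. cinner (m s t x y) u = cinner (m s t x y) v"
  shows "u = v"
proof -
  define U where "U = system_unitary m s t"
  have U: "unitary U" unfolding U_def by (rule system_unitary(1)[OF arveson st])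
  have "adj U *\<^sub>V u = adj U *\<^sub>V v"
    by (rule tensor_cinner_ext) (use eq in \<open>simp add: m_system_unitary[OF st] U_def[symmetric] cinner_adj_right\<close>)
  then have "U *\<^sub>V (adj U *\<^sub>V u) = U *\<^sub>V (adj U *\<^sub>V v)" by (rule arg_cong)
  then show ?thesis by (simp only: unitary_apply_adj[OF U])
qed

text \<open>Joint measurability of the multiplication, in a form that applies to functions of a parameter. The
  value zero is taken where the indices are not both positive.\<close>

lemma borel_measurable_m:
  assumes s: "s \<in> borel_measurable M" and t: "t \<in> borel_measurable M"
    and x: "x \<in> borel_measurable M" and y: "y \<in> borel_measurable M"
  shows "(\<lambda>\<omega>. if s \<omega> > 0 \<and> t \<omega> > 0 then m (s \<omega>) (t \<omega>) (x \<omega>) (y \<omega>) else 0) \<in> borel_measurable M"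
proof -
  define \<Omega> where "\<Omega> = {\<omega> \<in> space M. s \<omega> > 0 \<and> t \<omega> > 0}"
  have \<Omega>: "\<Omega> \<in> sets M" unfolding \<Omega>_def using s t by measurable
  let ?N = "restrict_space M \<Omega>"
  have pair: "(\<lambda>\<omega>. (s \<omega>, x \<omega>)) \<in> ?N \<rightarrow>\<^sub>M bundle_borel" "(\<lambda>\<omega>. (t \<omega>, y \<omega>)) \<in> ?N \<rightarrow>\<^sub>M bundle_borel"
    unfolding bundle_borel_def
    by (rule measurable_restrict_space2[OF _ measurable_restrict_space1[OF borel_measurable_Pair]];
        use s t x y in \<open>auto simp: space_restrict_space \<Omega>_def\<close>)+
  have "(\<lambda>((s, x), (t, y)). (s + t, m s t x y)) \<in> bundle_borel \<Otimes>\<^sub>M bundle_borel \<rightarrow>\<^sub>M bundle_borel"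
    using arveson by (simp add: arveson_system_def)
  from measurable_compose[OF measurable_Pair[OF pair] this]
  have "(\<lambda>\<omega>. (s \<omega> + t \<omega>, m (s \<omega>) (t \<omega>) (x \<omega>) (y \<omega>))) \<in> ?N \<rightarrow>\<^sub>M bundle_borel" by simp
  then have b: "(\<lambda>\<omega>. (s \<omega> + t \<omega>, m (s \<omega>) (t \<omega>) (x \<omega>) (y \<omega>))) \<in> ?N \<rightarrow>\<^sub>M borel"
    unfolding bundle_borel_def by (simp add: measurable_restrict_space2_iff)
  have "snd \<in> borel \<rightarrow>\<^sub>M (borel :: 'a measure)" 
    by (rule borel_measurable_continuous_onI) (intro continuous_intros)
  from measurable_compose[OF b this]
  have "(\<lambda>\<omega>. m (s \<omega>) (t \<omega>) (x \<omega>) (y \<omega>)) \<in> ?N \<rightarrow>\<^sub>M borel" by simp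
  then have "(\<lambda>\<omega>. if \<omega> \<in> \<Omega> then m (s \<omega>) (t \<omega>) (x \<omega>) (y \<omega>) else 0) \<in> M \<rightarrow>\<^sub>M borel"
    using \<Omega> by (subst (asm) measurable_restrict_space_iff[where c=0]) auto
  then show ?thesis by (rule measurable_cong[THEN iffD1, rotated]) (simp add: \<Omega>_def)
qed

text \<open>Stability is required at every \<open>r \<ge> l\<close>, not only almost everywhere: all constructions below preserve
  the pointwise equation.\<close>

definition stable :: "real \<Rightarrow> (real \<Rightarrow> 'a) \<Rightarrow> bool"
  where "stable l f \<longleftrightarrow> f \<in> borel_measurable borel \<and> (\<forall>r\<ge>l. f (r + 1) = m r 1 (f r) e) \<and>
    set_integrable lborel {l..<l + 1} (\<lambda>r. (norm (f r))\<^sup>2)"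

definition sections :: "(real \<Rightarrow> 'a) set"
  where "sections = {f. \<exists>l>0. stable l f}"

definition window_integral :: "real \<Rightarrow> (real \<Rightarrow> 'a) \<Rightarrow> (real \<Rightarrow> 'a) \<Rightarrow> complex"
  where "window_integral l f g = set_lebesgue_integral lborel {l..<l + 1} (\<lambda>r. cinner (f r) (g r))"

text \<open>The sequence of integrals is eventually constant on stable sections. Writing \<open>B\<close> as a limit of integrals
  over fixed intervals makes its measurable dependence on parameters evident.\<close>

definition B :: "(real \<Rightarrow> 'a) \<Rightarrow> (real \<Rightarrow> 'a) \<Rightarrow> complex"
  where "B f g = lim (\<lambda>n. window_integral (real n) f g)"

lemma stable_measurable: "stable l f \<Longrightarrow> f \<in> borel_measurable borel"
  by (simp add: stable_def)

lemma stable_shift: "stable l f \<Longrightarrow> l \<le> r \<Longrightarrow> f (r + 1) = m r 1 (f r) e"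
  by (simp add: stable_def)

lemma stable_cinner_periodic:
  assumes "l > 0" "stable l f" "stable l g" "l \<le> r"
  shows "cinner (f (r + 1)) (g (r + 1)) = cinner (f r) (g r)"
proof -
  have "cinner (m r 1 (f r) e) (m r 1 (g r) e) = cinner (f r) (g r) * cinner e e"
    using assms by (intro cinner_m) simp_all
  then show ?thesis
    unfolding stable_shift[OF assms(2,4)] stable_shift[OF assms(3,4)] by (simp add: cinner_self unit)
qed

lemma stable_mono:
  assumes l: "l > 0" and f: "stable l f" and k: "l \<le> k"
  shows "stable k f"
proof -
  have per: "(norm (f (r + 1)))\<^sup>2 = (norm (f r))\<^sup>2" if "l \<le> r" for r
  proof -
    have "norm (m r 1 (f r) e) = norm (f r) * norm e" using l that by (intro norm_m) simp_all
    then show ?thesis unfolding stable_shift[OF f that] by (simp add: unit)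
  qed
  have int: "set_integrable lborel {l..<l + 1} (\<lambda>r. (norm (f r))\<^sup>2)" using f unfolding stable_def by blast
  have "set_integrable lborel {k..<k + 1} (\<lambda>r. (norm (f r))\<^sup>2)"
    by (rule set_integral_periodic(1)[OF per int k])
  moreover have "\<forall>r\<ge>k. f (r + 1) = m r 1 (f r) e" using stable_shift[OF f] k by (meson order_trans)
  ultimately show ?thesis using stable_measurable[OF f] unfolding stable_def by blast
qed

lemma stable_cinner_integrable:
  assumes "stable l f" "stable l g"
  shows "set_integrable lborel {l..<l + 1} (\<lambda>r. cinner (f r) (g r))"
proof (rule set_integrable_bound)
  show "set_integrable lborel {l..<l + 1} (\<lambda>r. (norm (f r))\<^sup>2 + (norm (g r))\<^sup>2)"
    using assms by (intro set_integral_add) (simp_all add: stable_def)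
  have "(\<lambda>r. cinner (f r) (g r)) \<in> borel_measurable borel"
    using assms by (intro borel_measurable_cinner) (simp_all add: stable_def)
  then show "set_borel_measurable lborel {l..<l + 1} (\<lambda>r. cinner (f r) (g r))"
    unfolding set_borel_measurable_def by simp
  have "cmod (cinner x y) \<le> (norm x)\<^sup>2 + (norm y)\<^sup>2" for x y :: 'a
  proof -
    have "0 \<le> (norm x - norm y)\<^sup>2" by simp
    then have "2 * (norm x * norm y) \<le> (norm x)\<^sup>2 + (norm y)\<^sup>2" by (simp add: power2_diff)
    moreover have "0 \<le> norm x * norm y" by simp
    ultimately have "norm x * norm y \<le> (norm x)\<^sup>2 + (norm y)\<^sup>2" by linarith
    then show ?thesis using norm_cinner_le[of x y] by linarith
  qed
  then show "AE x in lborel. x \<in> {l..<l + 1} \<longrightarrow> norm (cinner (f x) (g x)) \<le> norm ((norm (f x))\<^sup>2 + (norm (g x))\<^sup>2)"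
    by (intro AE_I2 impI) (simp add: add_nonneg_nonneg)
qed

lemma window_integral_eq:
  assumes "l > 0" "stable l f" "stable l g" "l \<le> k"
  shows "window_integral k f g = window_integral l f g"
  unfolding window_integral_def
  by (rule set_integral_periodic(2)[OF stable_cinner_periodic[OF assms(1-3)] stable_cinner_integrable[OF assms(2,3)] assms(4)])

lemma B_eq:
  assumes "l > 0" "stable l f" "stable l g"
  shows "B f g = window_integral l f g"
proof -
  obtain N :: nat where N: "l \<le> real N" using real_arch_simple by blast
  have "(\<lambda>n. window_integral (real n) f g) \<longlonglongrightarrow> window_integral l f g"
  proof (rule tendsto_eventually)
    show "eventually (\<lambda>n. window_integral (real n) f g = window_integral l f g) sequentially"
      by (rule eventually_sequentiallyI[of N]) (use N in \<open>auto intro!: window_integral_eq assms\<close>)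
  qed
  then show ?thesis unfolding B_def by (rule limI)
qed

lemma stable_add:
  assumes l: "l > 0" and f: "stable l f" and g: "stable l g"
  shows "stable l (f + g)"
  unfolding stable_def
proof (intro conjI allI impI)
  have mf: "f \<in> borel_measurable borel" "g \<in> borel_measurable borel" using f g by (simp_all add: stable_def)
  then have mfg: "(\<lambda>r. f r + g r) \<in> borel_measurable borel" by (rule borel_measurable_add)
  then show "f + g \<in> borel_measurable borel" by (simp add: plus_fun_def)
  show "(f + g) (r + 1) = m r 1 ((f + g) r) e" if "l \<le> r" for r
    using that l f g by (simp add: stable_shift m_add_left)
  show "set_integrable lborel {l..<l + 1} (\<lambda>r. (norm ((f + g) r))\<^sup>2)"
  proof (rule set_integrable_bound)
    show "set_integrable lborel {l..<l + 1} (\<lambda>r. 2 * (norm (f r))\<^sup>2 + 2 * (norm (g r))\<^sup>2)"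
      using f g by (intro set_integral_add set_integrable_mult_right) (simp_all add: stable_def)
    have "(\<lambda>r. (norm (f r + g r))\<^sup>2) \<in> borel_measurable borel" using mfg by measurable
    then show "set_borel_measurable lborel {l..<l + 1} (\<lambda>r. (norm ((f + g) r))\<^sup>2)"
      unfolding set_borel_measurable_def by simp
    have "(norm (x + y))\<^sup>2 \<le> 2 * (norm x)\<^sup>2 + 2 * (norm y)\<^sup>2" for x y :: 'a
      using inner_ge_zero[of "x - y"]
      by (simp add: power2_norm_eq_inner inner_add_left inner_add_right inner_diff_left inner_diff_right inner_commute)
    then show "AE x in lborel. x \<in> {l..<l + 1} \<longrightarrow>
        norm ((norm ((f + g) x))\<^sup>2) \<le> norm (2 * (norm (f x))\<^sup>2 + 2 * (norm (g x))\<^sup>2)"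
      by (intro AE_I2 impI) simp
  qed
qed

lemma stable_scaleC:
  assumes l: "l > 0" and f: "stable l f"
  shows "stable l (c *\<^sub>C f)"
  unfolding stable_def
proof (intro conjI allI impI)
  show "c *\<^sub>C f \<in> borel_measurable borel"
    using borel_measurable_scaleC[OF stable_measurable[OF f], of c] by (simp add: scaleC_fun_def)
  show "(c *\<^sub>C f) (r + 1) = m r 1 ((c *\<^sub>C f) r) e" if "l \<le> r" for r
    using that l f by (simp add: stable_shift m_scaleC_left)
  have "set_integrable lborel {l..<l + 1} (\<lambda>r. (cmod c)\<^sup>2 * (norm (f r))\<^sup>2)"
    using f by (intro set_integrable_mult_right) (simp add: stable_def)
  then show "set_integrable lborel {l..<l + 1} (\<lambda>r. (norm ((c *\<^sub>C f) r))\<^sup>2)"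
    by (simp add: norm_scaleC power_mult_distrib)
qed

lemma stable_zero: 
  assumes "l > 0" shows "stable l 0"
proof -
  have "(0 :: real \<Rightarrow> 'a) \<in> borel_measurable borel"
    unfolding zero_fun_def by (rule borel_measurable_const)
  then show ?thesis
    using assms m_scaleC_left[of _ 1 0 0 e] by (simp add: stable_def set_integrable_def)
qed

lemma sections_common:
  assumes "f \<in> sections" "g \<in> sections"
  obtains l where "l > 0" "stable l f" "stable l g"
proof -
  obtain k l where k: "k > 0" "stable k f" and l: "l > 0" "stable l g"
    using assms by (auto simp: sections_def)
  show ?thesis
    by (rule that[of "max k l"]) (use k l in \<open>auto intro: stable_mono\<close>)
qed

lemma sectionsI: "l > 0 \<Longrightarrow> stable l f \<Longrightarrow> f \<in> sections"
  by (auto simp: sections_def)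

lemma sections_subspace: "complex_vector.subspace sections"
proof (rule complex_vector.subspaceI)
  show "0 \<in> sections" by (rule sectionsI[OF _ stable_zero, of 1]) simp_all
  show "f + g \<in> sections" if fg: "f \<in> sections" "g \<in> sections" for f g
  proof -
    obtain l where "l > 0" "stable l f" "stable l g" using sections_common[OF fg] by blast
    then show ?thesis by (intro sectionsI[of l] stable_add)
  qed
  show "c *\<^sub>C f \<in> sections" if f: "f \<in> sections" for c f
  proof -
    obtain l where "l > 0" "stable l f" using f by (auto simp: sections_def)
    then show ?thesis by (intro sectionsI[of l] stable_scaleC)
  qed
qed

lemma window_integral_self: "window_integral l f f = complex_of_real (set_lebesgue_integral lborel {l..<l + 1} (\<lambda>r. (norm (f r))\<^sup>2))"
  unfolding window_integral_def cinner_self by (rule set_integral_complex_of_real)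

sublocale semi_inner_space sections B
proof
  show "complex_vector.subspace sections" by (rule sections_subspace)
  fix f g h :: "real \<Rightarrow> 'a" and c
  assume f: "f \<in> sections" and g: "g \<in> sections"
  obtain l where l: "l > 0" "stable l f" "stable l g" using sections_common[OF f g] by blast
  have "(\<lambda>r. indicat_real {l..<l + 1} r *\<^sub>R cinner (f r) (g r)) =
      (\<lambda>r. cnj (indicat_real {l..<l + 1} r *\<^sub>R cinner (g r) (f r)))"
    unfolding scaleR_conv_of_real complex_cnj_mult complex_cnj_complex_of_real
    by (rule ext, rule arg_cong2[where f="(*)"], rule refl, rule cinner_commute)
  then show "B f g = cnj (B g f)"
    unfolding B_eq[OF l] B_eq[OF l(1,3,2)] window_integral_def set_lebesgue_integral_def by (simp only: Bochner_Integration.integral_cnj)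
  have "stable l (c *\<^sub>C g)" by (rule stable_scaleC[OF l(1,3)])
  then show "B f (c *\<^sub>C g) = c * B f g"
    unfolding B_eq[OF l] using B_eq[OF l(1,2)] by (simp add: window_integral_def cinner_scaleC_right)
  assume h: "h \<in> sections"
  obtain k where k: "k > 0" "stable k h" using h by (auto simp: sections_def)
  define n where "n = max k l"
  have n: "n > 0" "stable n f" "stable n g" "stable n h"
    using k l by (auto simp: n_def intro: stable_mono)
  have "window_integral n f (g + h) = window_integral n f g + window_integral n f h"
    unfolding window_integral_def plus_fun_apply cinner_add_right
    by (rule set_integral_add(2)[OF stable_cinner_integrable[OF n(2,3)] stable_cinner_integrable[OF n(2,4)]])
  then show "B f (g + h) = B f g + B f h"
    unfolding B_eq[OF n(1,2) stable_add[OF n(1,3,4)]] B_eq[OF n(1,2,3)] B_eq[OF n(1,2,4)] .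
next
  fix f assume "f \<in> sections"
  then obtain l where l: "l > 0" "stable l f" by (auto simp: sections_def)
  have "0 \<le> set_lebesgue_integral lborel {l..<l + 1} (\<lambda>r. (norm (f r))\<^sup>2)"
    unfolding set_lebesgue_integral_def by (intro integral_nonneg_AE AE_I2) simp
  then show "0 \<le> Re (B f f)" unfolding B_eq[OF l(1,2,2)] window_integral_self by simp
qed

lemma sq_stable: "l > 0 \<Longrightarrow> stable l f \<Longrightarrow> sq f = set_lebesgue_integral lborel {l..<l + 1} (\<lambda>r. (norm (f r))\<^sup>2)"
  unfolding sq_def by (simp add: B_eq window_integral_self)

lemma stable_diff: "l > 0 \<Longrightarrow> stable l f \<Longrightarrow> stable l g \<Longrightarrow> stable l (f - g)"
  using stable_add[of l f "(-1) *\<^sub>C g"] stable_scaleC[of l g "-1"] by (simp add: complex_vector.scale_minus_left scaleC_one)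

lemma stable_sum: "l > 0 \<Longrightarrow> (\<And>i. i \<in> A \<Longrightarrow> stable l (f i)) \<Longrightarrow> stable l (\<Sum>i\<in>A. f i)"
  by (induction A rule: infinite_finite_induct) (auto intro: stable_zero stable_add)

text \<open>Convergence on one unit interval is enough, since a stable section is determined, up to length zero,
  by its restriction to it.\<close>

lemma sq_dominated_convergence:
  assumes l: "l > 0" "stable l f" "\<And>k. stable l (g k)"
    and lim: "\<And>r. l \<le> r \<Longrightarrow> r < l + 1 \<Longrightarrow> (\<lambda>k. g k r) \<longlonglongrightarrow> f r"
    and dom: "\<And>k r. l \<le> r \<Longrightarrow> r < l + 1 \<Longrightarrow> norm (g k r) \<le> 2 * norm (f r) + C"
  shows "(\<lambda>k. sq (f - g k)) \<longlonglongrightarrow> 0"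
proof -
  let ?I = "indicat_real {l..<l + 1}"
  have m: "f \<in> borel_measurable borel" "g k \<in> borel_measurable borel" for k using l by (simp_all add: stable_def)
  have "(\<lambda>k. \<integral>r. ?I r *\<^sub>R (norm (f r - g k r))\<^sup>2 \<partial>lborel) \<longlonglongrightarrow> integral\<^sup>L lborel (\<lambda>r::real. 0::real)"
  proof (rule integral_dominated_convergence)
    show "(\<lambda>_. 0) \<in> borel_measurable lborel" by simp
    show "(\<lambda>r. ?I r *\<^sub>R (norm (f r - g k r))\<^sup>2) \<in> borel_measurable lborel" for k using m by measurable
    \<comment> \<open>From \<open>\<parallel>f - g k\<parallel> \<le> 3 \<parallel>f\<parallel> + C\<close> and \<open>(a + b)\<^sup>2 \<le> 2 a\<^sup>2 + 2 b\<^sup>2\<close>.\<close>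
    have "set_integrable lborel {l..<l + 1} (\<lambda>r. 18 * (norm (f r))\<^sup>2 + 2 * C\<^sup>2)"
      using l(2) by (intro set_integral_add(1) set_integrable_mult_right) (simp_all add: stable_def set_integrable_def)
    then show "integrable lborel (\<lambda>r. ?I r *\<^sub>R (18 * (norm (f r))\<^sup>2 + 2 * C\<^sup>2))"
      by (simp add: set_integrable_def)
    show "AE r in lborel. (\<lambda>k. ?I r *\<^sub>R (norm (f r - g k r))\<^sup>2) \<longlonglongrightarrow> 0"
    proof (rule AE_I2)
      fix r
      show "(\<lambda>k. ?I r *\<^sub>R (norm (f r - g k r))\<^sup>2) \<longlonglongrightarrow> 0"
      proof (cases "r \<in> {l..<l + 1}")
        case True
        then have "(\<lambda>k. (norm (f r - g k r))\<^sup>2) \<longlonglongrightarrow> (norm (f r - f r))\<^sup>2"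
          by (intro tendsto_intros lim) auto
        with True show ?thesis by simp
      qed simp
    qed
    fix k
    show "AE r in lborel. norm (?I r *\<^sub>R (norm (f r - g k r))\<^sup>2) \<le> ?I r *\<^sub>R (18 * (norm (f r))\<^sup>2 + 2 * C\<^sup>2)"
    proof (rule AE_I2)
      fix r
      show "norm (?I r *\<^sub>R (norm (f r - g k r))\<^sup>2) \<le> ?I r *\<^sub>R (18 * (norm (f r))\<^sup>2 + 2 * C\<^sup>2)"
      proof (cases "r \<in> {l..<l + 1}")
        case True
        then have "norm (f r - g k r) \<le> 3 * norm (f r) + C"
          using dom[of r k] norm_triangle_ineq4[of "f r" "g k r"] by simp
        then have "(norm (f r - g k r))\<^sup>2 \<le> (3 * norm (f r) + C)\<^sup>2" by (rule power_mono) simp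
        also have "\<dots> \<le> 18 * (norm (f r))\<^sup>2 + 2 * C\<^sup>2"
          using zero_le_power2[of "3 * norm (f r) - C"] by (simp add: power2_sum power2_diff power_mult_distrib)
        finally show ?thesis using True by simp
      qed simp
    qed
  qed
  moreover have "sq (f - g k) = (\<integral>r. ?I r *\<^sub>R (norm (f r - g k r))\<^sup>2 \<partial>lborel)" for k
    unfolding sq_stable[OF l(1) stable_diff[OF l]] set_lebesgue_integral_def by simp
  ultimately show ?thesis by simp
qed

section \<open>Separability of the space of stable sections\<close>

definition shift_right :: "(real \<Rightarrow> 'a) \<Rightarrow> real \<Rightarrow> 'a"
  where "shift_right f r = (if r > 1 then m (r - 1) 1 (f (r - 1)) e else 0)"

text \<open>The stable section with prescribed values \<open>g\<close> on \<open>[l, l + 1)\<close>: at \<open>r\<close>, go back by the integer part of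
  \<open>r - l\<close> and multiply by \<open>e\<close> as many times.\<close>

definition extend :: "real \<Rightarrow> (real \<Rightarrow> 'a) \<Rightarrow> real \<Rightarrow> 'a"
  where "extend l g r = (shift_right ^^ nat \<lfloor>r - l\<rfloor>) g r"

lemma shift_right_measurable:
  assumes "f \<in> borel_measurable borel"
  shows "shift_right f \<in> borel_measurable borel"
proof -
  have id: "(\<lambda>r::real. r - 1) \<in> borel_measurable borel" by measurable
  have f: "(\<lambda>r. f (r - 1)) \<in> borel_measurable borel"
    by (rule measurable_compose[OF id assms])
  have "(\<lambda>r::real. if r - 1 > 0 \<and> (1::real) > 0 then m (r - 1) 1 (f (r - 1)) e else 0) \<in> borel_measurable borel"
    by (rule borel_measurable_m[OF id borel_measurable_const f borel_measurable_const])
  then show ?thesis unfolding shift_right_def[abs_def] by simp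
qed

lemma shift_right_funpow_measurable:
  "g \<in> borel_measurable borel \<Longrightarrow> (shift_right ^^ n) g \<in> borel_measurable borel"
  by (induction n) (simp_all add: shift_right_measurable)

lemma extend_measurable:
  assumes "g \<in> borel_measurable borel"
  shows "extend l g \<in> borel_measurable borel"
  unfolding extend_def[abs_def]
proof (rule measurable_compose_countable)
  show "(shift_right ^^ n) g \<in> borel_measurable borel" for n
    by (rule shift_right_funpow_measurable[OF assms])
  have "(\<lambda>r::real. \<lfloor>r - l\<rfloor>) \<in> borel \<rightarrow>\<^sub>M count_space UNIV" by measurable
  then show "(\<lambda>r. nat \<lfloor>r - l\<rfloor>) \<in> borel \<rightarrow>\<^sub>M count_space UNIV"
    by (rule measurable_compose) simp
qed

lemma extend_eq: "l \<le> r \<Longrightarrow> r < l + 1 \<Longrightarrow> extend l g r = g r"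
proof -
  assume "l \<le> r" "r < l + 1"
  then have "\<lfloor>r - l\<rfloor> = 0" by (simp add: floor_eq_iff)
  then show ?thesis by (simp add: extend_def)
qed

lemma extend_stable:
  assumes l: "l > 0" and g: "g \<in> borel_measurable borel" and bd: "\<And>r. norm (g r) \<le> C"
  shows "stable l (extend l g)"
  unfolding stable_def
proof (intro conjI allI impI)
  show mg: "extend l g \<in> borel_measurable borel" by (rule extend_measurable[OF g])
  show "extend l g (r + 1) = m r 1 (extend l g r) e" if r: "l \<le> r" for r
  proof -
    have "\<lfloor>r + 1 - l\<rfloor> = \<lfloor>r - l\<rfloor> + 1" using floor_add_int[of "r - l" 1] by (simp add: algebra_simps)
    moreover have "\<lfloor>r - l\<rfloor> \<ge> 0" using r by simp
    moreover have "nat (k + 1) = Suc (nat k)" if "k \<ge> 0" for k :: int using that by simp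
    ultimately have "nat \<lfloor>r + 1 - l\<rfloor> = Suc (nat \<lfloor>r - l\<rfloor>)" by presburger
    then have "extend l g (r + 1) = shift_right ((shift_right ^^ nat \<lfloor>r - l\<rfloor>) g) (r + 1)"
      by (simp add: extend_def)
    also have "\<dots> = m r 1 (extend l g r) e" using l r by (simp add: shift_right_def extend_def)
    finally show ?thesis .
  qed
  show "set_integrable lborel {l..<l + 1} (\<lambda>r. (norm (extend l g r))\<^sup>2)"
  proof (rule set_integrable_bound)
    show "set_integrable lborel {l..<l + 1} (\<lambda>r. C\<^sup>2)" by (simp add: set_integrable_def)
    have "(\<lambda>r. (norm (extend l g r))\<^sup>2) \<in> borel_measurable borel" using mg by measurable
    then show "set_borel_measurable lborel {l..<l + 1} (\<lambda>r. (norm (extend l g r))\<^sup>2)"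
      unfolding set_borel_measurable_def by simp
    have "(norm (extend l g r))\<^sup>2 \<le> C\<^sup>2" if "r \<in> {l..<l + 1}" for r
    proof -
      have "norm (extend l g r) \<le> C" using that bd[of r] by (simp add: extend_eq)
      then show ?thesis by (rule power_mono) simp
    qed
    then show "AE x in lborel. x \<in> {l..<l + 1} \<longrightarrow> norm ((norm (extend l g x))\<^sup>2) \<le> norm (C\<^sup>2)"
      by (intro AE_I2 impI) simp
  qed
qed

text \<open>The interval starts at \<open>Suc n\<close> instead of \<open>n\<close> because sections live on \<open>(0, \<infinity>)\<close>.\<close>

definition step_section :: "nat \<Rightarrow> real set \<Rightarrow> 'a \<Rightarrow> real \<Rightarrow> 'a"
  where "step_section n A y = extend (real (Suc n)) (\<lambda>r. indicat_real A r *\<^sub>R y)"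

lemma step_section_stable: "A \<in> sets borel \<Longrightarrow> stable (real (Suc n)) (step_section n A y)"
  unfolding step_section_def
proof (rule extend_stable)
  assume A: "A \<in> sets borel"
  show "(\<lambda>r. indicat_real A r *\<^sub>R y) \<in> borel_measurable borel" using A by measurable
  show "norm (indicat_real A r *\<^sub>R y) \<le> norm y" for r by (simp add: indicator_def)
qed simp

lemma step_section_eq: "real (Suc n) \<le> r \<Longrightarrow> r < real (Suc n) + 1 \<Longrightarrow> step_section n A y r = indicat_real A r *\<^sub>R y"
  unfolding step_section_def by (rule extend_eq)

lemma approximable_limit:
  assumes D: "D \<subseteq> sections" and l: "l > 0" "stable l f" "\<And>k. stable l (g k)"
    and lim: "\<And>r. l \<le> r \<Longrightarrow> r < l + 1 \<Longrightarrow> (\<lambda>k. g k r) \<longlonglongrightarrow> f r"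
    and dom: "\<And>k r. l \<le> r \<Longrightarrow> r < l + 1 \<Longrightarrow> norm (g k r) \<le> 2 * norm (f r) + C"
    and g: "\<And>k. g k \<in> approximable D"
  shows "f \<in> approximable D"
proof (rule approximable_closed[OF D sectionsI[OF l(1,2)]])
  fix \<epsilon> :: real assume "\<epsilon> > 0"
  from LIMSEQ_D[OF sq_dominated_convergence[OF l lim dom] this]
  obtain N where "\<forall>k\<ge>N. norm (sq (f - g k) - 0) < \<epsilon>" by blast
  then have "norm (sq (f - g N) - 0) < \<epsilon>" by blast
  then have "sq (f - g N) < \<epsilon>" by simp
  with g show "\<exists>g\<in>approximable D. sq (f - g) < \<epsilon>" by blast
qed

lemma approximable_agree:
  assumes D: "D \<subseteq> sections" and l: "l > 0" "stable l f" "stable l g"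
    and eq: "\<And>r. l \<le> r \<Longrightarrow> r < l + 1 \<Longrightarrow> f r = g r" and g: "g \<in> approximable D"
  shows "f \<in> approximable D"
  by (rule approximable_limit[where g="\<lambda>_. g" and C=0, OF D l]) (simp_all add: eq g)

lemma approximable_sum: "D \<subseteq> sections \<Longrightarrow> (\<And>i. i \<in> A \<Longrightarrow> f i \<in> approximable D) \<Longrightarrow> (\<Sum>i\<in>A. f i) \<in> approximable D"
  by (rule complex_vector.subspace_sum[OF approximable_subspace])

text \<open>The sets for which the claim holds form a Dynkin system, and the open half-lines are stable under
  intersection and generate the Borel sets.\<close>

lemma step_section_approximable:
  assumes D: "D \<subseteq> sections" and half: "\<And>a y. step_section n {..<a} y \<in> approximable D" and A: "A \<in> sets borel"
  shows "step_section n A y \<in> approximable D"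
proof -
  let ?n = "real (Suc n)"
  have sets_eq: "sets borel = sigma_sets UNIV (range (\<lambda>a::real. {..<a}))"
    unfolding borel_Iio by (rule sets_measure_of) simp
  have "Int_stable (range (\<lambda>a::real. {..<a}))"
  proof (rule Int_stableI)
    fix A B :: "real set" assume "A \<in> range lessThan" "B \<in> range lessThan"
    then obtain a b where "A = {..<a}" "B = {..<b}" by blast
    then have "A \<inter> B = {..<min a b}" by auto
    then show "A \<inter> B \<in> range lessThan" by simp
  qed
  moreover have "range (\<lambda>a::real. {..<a}) \<subseteq> Pow UNIV" by simp
  moreover have "A \<in> sigma_sets UNIV (range (\<lambda>a::real. {..<a}))" using A unfolding sets_eq .
  ultimately show ?thesis
  proof (induction rule: sigma_sets_induct_disjoint)
    case (basic A)
    then show ?case using half by auto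
  next
    case empty
    show ?case
    proof (rule approximable_agree[OF D _ step_section_stable stable_zero])
      show "(0 :: real \<Rightarrow> 'a) \<in> approximable D"
        by (rule complex_vector.subspace_0[OF approximable_subspace[OF D]])
    qed (simp_all add: step_section_eq)
  next
    case (compl A)
    then have "A \<in> sets borel" unfolding sets_eq by simp
    then have A: "A \<in> sets borel" "UNIV - A \<in> sets borel" by auto
    show ?case
    proof (rule approximable_agree[OF D _ step_section_stable[OF A(2)] stable_diff[OF _ step_section_stable[of "{..<?n + 1}"] step_section_stable[OF A(1)]]])
      show "step_section n {..<?n + 1} y - step_section n A y \<in> approximable D"
        by (rule complex_vector.subspace_diff[OF approximable_subspace[OF D] half compl.IH])
    qed (auto simp: step_section_eq indicator_def)
  next
    case (union A)
    then have A: "A i \<in> sets borel" for i unfolding sets_eq by auto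
    have UA: "(\<Union>i. A i) \<in> sets borel" using A by auto
    have eq: "(\<Sum>i<k. step_section n (A i) y) r = (\<Sum>i<k. indicat_real (A i) r) *\<^sub>R y" if "?n \<le> r" "r < ?n + 1" for r k
      using that by (simp add: sum_fun_apply step_section_eq scaleR_sum_left)
    have dj: "disjoint_family A" by fact
    have ind: "(\<Sum>i<k. indicat_real (A i) r) = indicat_real (\<Union>i<k. A i) r" for r k
    proof -
      have "indicat_real (\<Union>i\<in>{..<k}. A i) r = (\<Sum>i\<in>{..<k}. indicat_real (A i) r)"
        by (rule indicator_UN_disjoint) (use dj in \<open>auto simp: disjoint_family_on_def\<close>)
      then show ?thesis by simp
    qed
    show ?case
    proof (rule approximable_limit[where g="\<lambda>k. \<Sum>i<k. step_section n (A i) y" and C=0, OF D _ step_section_stable[OF UA]])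
      show "stable ?n (\<Sum>i<k. step_section n (A i) y)" for k by (intro stable_sum step_section_stable A) simp
      show "(\<Sum>i<k. step_section n (A i) y) \<in> approximable D" for k by (intro approximable_sum D union.IH)
      fix r assume r: "?n \<le> r" "r < ?n + 1"
      have "(\<lambda>k. \<Sum>i<k. indicat_real (A i) r) \<longlonglongrightarrow> indicat_real (\<Union>i. A i) r"
        unfolding ind by (rule LIMSEQ_indicator_UN)
      then show "(\<lambda>k. (\<Sum>i<k. step_section n (A i) y) r) \<longlonglongrightarrow> step_section n (\<Union>i. A i) y r"
        unfolding eq[OF r] step_section_eq[OF r] by (intro tendsto_intros)
      show "norm ((\<Sum>i<k. step_section n (A i) y) r) \<le> 2 * norm (step_section n (\<Union>i. A i) y r) + 0" for k
        unfolding eq[OF r] step_section_eq[OF r] ind by (auto simp: indicator_def)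
    qed simp
  qed
qed

text \<open>A countable total set: step functions with one half-line \<open>(-\<infinity>, q)\<close>, \<open>q\<close> rational, and one value from a
  countable dense set. Arbitrary half-lines and values are limits of such; then come all Borel sets, simple
  functions, and finally all sections, each time by dominated convergence.\<close>

lemma sections_separable:
  "\<exists>D. countable D \<and> D \<subseteq> sections \<and> sections \<subseteq> approximable D"
proof -
  obtain D0 :: "'a set" where D0: "countable D0" "\<And>x \<epsilon>. \<epsilon> > 0 \<Longrightarrow> \<exists>y\<in>D0. dist y x < \<epsilon>"
    using separable by blast
  define D where "D = (\<lambda>(n, q, y). step_section n {..<real_of_rat q} y) ` (UNIV \<times> UNIV \<times> D0)"
  have cD: "countable D" unfolding D_def by (intro countable_image countable_SIGMA D0(1)) auto
  have memD: "step_section n {..<real_of_rat q} y \<in> D" if "y \<in> D0" for n q y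
    unfolding D_def by (rule image_eqI[of _ _ "(n, q, y)"]) (use that in auto)
  have DS: "D \<subseteq> sections" 
  proof
    fix f assume "f \<in> D"
    then obtain n q y where "f = step_section n {..<real_of_rat q} y" unfolding D_def by auto
    then show "f \<in> sections" using sectionsI[OF _ step_section_stable[of "{..<real_of_rat q}" n y]] by simp
  qed
  have spanD: "f \<in> approximable D" if "f \<in> D" for f
    unfolding approximable_def
  proof (intro CollectI conjI allI impI)
    show "f \<in> sections" using DS that by blast
    fix \<epsilon> :: real assume "\<epsilon> > 0"
    then show "\<exists>g\<in>cspan D. sq (f - g) < \<epsilon>"
      by (intro bexI[of _ f] complex_vector.span_base that) simp
  qed
  have half: "step_section n {..<a} y \<in> approximable D" for n a y
  proof -
    have "\<forall>k. \<exists>z\<in>D0. dist z y < inverse (real (Suc k))" using D0(2) by simp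
    then obtain z where z: "\<And>k. z k \<in> D0" "\<And>k. dist (z k) y < inverse (real (Suc k))" by metis
    have "\<exists>q. a - inverse (real (Suc k)) < real_of_rat q \<and> real_of_rat q < a" for k
      by (rule of_rat_dense) simp
    then obtain q where q: "\<And>k. a - inverse (real (Suc k)) < real_of_rat (q k)" "\<And>k. real_of_rat (q k) < a" by metis
    have zl: "z \<longlonglongrightarrow> y"
    proof (rule metric_LIMSEQ_I)
      fix \<epsilon> :: real assume "\<epsilon> > 0"
      then obtain N where N: "inverse (real (Suc N)) < \<epsilon>" using reals_Archimedean by blast
      have "dist (z k) y < \<epsilon>" if "N \<le> k" for k
      proof -
        have "inverse (real (Suc k)) \<le> inverse (real (Suc N))" using that by simp
        then show ?thesis using z(2)[of k] N by linarith
      qed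
      then show "\<exists>N. \<forall>k\<ge>N. dist (z k) y < \<epsilon>" by blast
    qed
    have zb: "norm (z k) \<le> norm y + 1" for k
    proof -
      have "inverse (real (Suc k)) \<le> 1" by (simp add: field_simps)
      then have "dist (z k) y \<le> 1" using z(2)[of k] by linarith
      then show ?thesis using norm_triangle_ineq2[of "z k" y] by (simp add: dist_norm)
    qed
    have il: "(\<lambda>k. indicat_real {..<real_of_rat (q k)} r) \<longlonglongrightarrow> indicat_real {..<a} r" for r
    proof (rule tendsto_eventually)
      show "eventually (\<lambda>k. indicat_real {..<real_of_rat (q k)} r = indicat_real {..<a} r) sequentially"
      proof (cases "r < a")
        case True
        then obtain N where N: "inverse (real (Suc N)) < a - r" using reals_Archimedean[of "a - r"] by auto
        have "r < real_of_rat (q k)" if "N \<le> k" for k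
        proof -
          have "inverse (real (Suc k)) \<le> inverse (real (Suc N))" using that by simp
          then show ?thesis using q(1)[of k] N by linarith
        qed
        then show ?thesis using True by (intro eventually_sequentiallyI[of N]) (simp add: indicator_def)
      next
        case False
        then have "\<not> r < real_of_rat (q k)" for k using q(2)[of k] by linarith
        then show ?thesis using False by (simp add: indicator_def)
      qed
    qed
    show ?thesis
    proof (rule approximable_limit[where g="\<lambda>k. step_section n {..<real_of_rat (q k)} (z k)" and C="norm y + 1", OF DS _ step_section_stable])
      fix k
      show "stable (real (Suc n)) (step_section n {..<real_of_rat (q k)} (z k))" by (rule step_section_stable) simp
      show "step_section n {..<real_of_rat (q k)} (z k) \<in> approximable D" by (intro spanD memD z)
    next
      fix r assume r: "real (Suc n) \<le> r" "r < real (Suc n) + 1"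
      show "(\<lambda>k. step_section n {..<real_of_rat (q k)} (z k) r) \<longlonglongrightarrow> step_section n {..<a} y r"
        unfolding step_section_eq[OF r] by (intro tendsto_scaleR il zl)
      fix k
      have "norm (indicat_real {..<real_of_rat (q k)} r *\<^sub>R z k) \<le> norm (z k)" by (simp add: indicator_def)
      then show "norm (step_section n {..<real_of_rat (q k)} (z k) r) \<le> 2 * norm (step_section n {..<a} y r) + (norm y + 1)"
        unfolding step_section_eq[OF r] using zb[of k] norm_ge_zero[of "indicat_real {..<a} r *\<^sub>R y"] by linarith
    qed simp_all
  qed
  have "f \<in> approximable D" if f: "f \<in> sections" for f
  proof -
    obtain l where l: "l > 0" "stable l f" using f by (auto simp: sections_def)
    obtain n :: nat where "l \<le> real n" using real_arch_simple by blast
    then have n: "stable (real (Suc n)) f" by (intro stable_mono[OF l]) simp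
    have n0: "real (Suc n) > 0" by simp
    obtain F where "(\<forall>i. simple_function borel (F i)) \<and> (\<forall>r\<in>space borel. (\<lambda>i. F i r) \<longlonglongrightarrow> f r) \<and>
      (\<forall>i. \<forall>r\<in>space borel. dist (F i r) 0 \<le> 2 * dist (f r) 0)"
      using borel_measurable_implies_sequence_metric[OF stable_measurable[OF n], of 0] ..
    then have F: "\<And>i. simple_function borel (F i)" "\<And>r. (\<lambda>i. F i r) \<longlonglongrightarrow> f r"
      "\<And>i r. dist (F i r) 0 \<le> 2 * dist (f r) 0" by simp_all
    have Fm: "F i \<in> borel_measurable borel" for i by (rule borel_measurable_simple_function[OF F(1)])
    have fin: "finite (range (F i))" for i using simple_functionD(1)[OF F(1)[of i]] by simp
    have Fb: "norm (F i r) \<le> Max (norm ` range (F i))" for i r using fin by (intro Max_ge) auto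
    have st: "stable (real (Suc n)) (extend (real (Suc n)) (F i))" for i
      by (rule extend_stable[OF n0 Fm Fb])
    show ?thesis
    proof (rule approximable_limit[where g="\<lambda>i. extend (real (Suc n)) (F i)" and C=0, OF DS n0 n st])
      fix i
      have pre: "F i -` {y} \<in> sets borel" for y using simple_functionD(2)[OF F(1)[of i], of "{y}"] by simp
      show "extend (real (Suc n)) (F i) \<in> approximable D"
      proof (rule approximable_agree[OF DS n0 st])
        show "stable (real (Suc n)) (\<Sum>y\<in>range (F i). step_section n (F i -` {y}) y)"
          by (intro stable_sum step_section_stable pre n0)
        show "(\<Sum>y\<in>range (F i). step_section n (F i -` {y}) y) \<in> approximable D"
          by (rule approximable_sum[OF DS step_section_approximable[OF DS half pre]])
        fix r assume r: "real (Suc n) \<le> r" "r < real (Suc n) + 1"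
        have "(\<Sum>y\<in>range (F i). indicat_real (F i -` {y}) r *\<^sub>R y) = (\<Sum>y\<in>range (F i). if y = F i r then y else 0)"
          by (intro sum.cong refl) (auto simp: indicator_def)
        also have "\<dots> = F i r" using fin[of i] by simp
        finally show "extend (real (Suc n)) (F i) r = (\<Sum>y\<in>range (F i). step_section n (F i -` {y}) y) r"
          by (simp only: extend_eq[OF r] sum_fun_apply step_section_eq[OF r])
      qed
    next
      fix r assume r: "real (Suc n) \<le> r" "r < real (Suc n) + 1"
      show "(\<lambda>i. extend (real (Suc n)) (F i) r) \<longlonglongrightarrow> f r" unfolding extend_eq[OF r] by (rule F(2))
      show "norm (extend (real (Suc n)) (F i) r) \<le> 2 * norm (f r) + 0" for i
        unfolding extend_eq[OF r] using F(3)[of i r] by simp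
    qed
  qed
  with cD DS show ?thesis by (intro exI[of _ D]) blast
qed

text \<open>The sections that are constant on \<open>[1, 2)\<close> carry the inner product of the fibre.\<close>

lemma sections_infinite_dimensional:
  assumes F: "finite F" "ortho F"
  shows "\<exists>x\<in>sections. res F x \<noteq> 0"
proof -
  obtain b :: "nat \<Rightarrow> 'a" where b: "is_onb b" using onb_exists ..
  define h where "h i = step_section 0 UNIV (b i)" for i
  have st: "stable 1 (h i)" for i using step_section_stable[of UNIV 0 "b i"] by (simp add: h_def)
  have hr: "h i r = b i" if "r \<in> {1..<2}" for i r using that step_section_eq[of 0 r UNIV "b i"] by (simp add: h_def)
  have "B (h i) (h j) = (if i = j then 1 else 0)" for i j
  proof -
    have "B (h i) (h j) = set_lebesgue_integral lborel {1..<2} (\<lambda>r. cinner (h i r) (h j r))"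
      using B_eq[OF _ st st] by (simp add: window_integral_def)
    also have "\<dots> = set_lebesgue_integral lborel {1..<2} (\<lambda>r::real. cinner (b i) (b j))"
      by (rule set_lebesgue_integral_cong) (auto simp: hr)
    also have "\<dots> = cinner (b i) (b j)" by (simp add: set_lebesgue_integral_def)
    finally show ?thesis by (simp add: onb_cinner[OF b])
  qed
  moreover have "h i \<in> sections" for i by (rule sectionsI[OF _ st]) simp
  ultimately show ?thesis by (intro infinite_dimensional_if_ortho_sequence[of h] F)
qed

lemma sections_realization:
  "\<exists>\<Phi> :: (real \<Rightarrow> 'a) \<Rightarrow> 'h::separable_infinite_chilbert.
    (\<forall>f\<in>sections. \<forall>g\<in>sections. cinner (\<Phi> f) (\<Phi> g) = B f g) \<and> closure (\<Phi> ` sections) = UNIV"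
proof -
  obtain D where D: "countable D \<and> D \<subseteq> sections \<and> sections \<subseteq> approximable D" using sections_separable ..
  then show ?thesis by (intro isometric_realization[of D] sections_infinite_dimensional) simp_all
qed

section \<open>Left multiplication of stable sections\<close>

text \<open>Left multiplication of a section by the element \<open>y\<close> of \<open>E\<^sub>t\<close>.\<close>

definition translate :: "real \<Rightarrow> 'a \<Rightarrow> (real \<Rightarrow> 'a) \<Rightarrow> real \<Rightarrow> 'a"
  where "translate t y f r = (if r > t then m t (r - t) y (f (r - t)) else 0)"

lemma translate_measurable_joint:
  assumes f: "f \<in> borel_measurable borel"
  shows "(\<lambda>p. if 0 < fst p then translate (fst p) y f (snd p) else 0) \<in> borel_measurable (borel \<Otimes>\<^sub>M lborel)"
proof -
  let ?M = "borel \<Otimes>\<^sub>M lborel :: (real \<times> real) measure"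
  have t: "(\<lambda>p. fst p) \<in> borel_measurable ?M" by measurable
  have d: "(\<lambda>p. snd p - fst p) \<in> borel_measurable ?M" by measurable
  have "(\<lambda>p. if 0 < fst p \<and> 0 < snd p - fst p then m (fst p) (snd p - fst p) y (f (snd p - fst p)) else 0)
      \<in> borel_measurable ?M"
    by (rule borel_measurable_m[OF t d borel_measurable_const measurable_compose[OF d f]])
  moreover have "(\<lambda>p. if 0 < fst p \<and> 0 < snd p - fst p then m (fst p) (snd p - fst p) y (f (snd p - fst p)) else 0) =
      (\<lambda>p. if 0 < fst p then translate (fst p) y f (snd p) else 0)"
    by (rule ext) (simp add: translate_def)
  ultimately show ?thesis by simp
qed

lemma translate_measurable:
  assumes t: "t > 0" and f: "f \<in> borel_measurable borel"
  shows "translate t y f \<in> borel_measurable borel"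
proof -
  have d: "(\<lambda>r::real. r - t) \<in> borel_measurable borel" by measurable
  have "(\<lambda>r. if 0 < t \<and> 0 < r - t then m t (r - t) y (f (r - t)) else 0) \<in> borel_measurable borel"
    by (rule borel_measurable_m[OF borel_measurable_const d borel_measurable_const measurable_compose[OF d f]])
  moreover have "(\<lambda>r. if 0 < t \<and> 0 < r - t then m t (r - t) y (f (r - t)) else 0) = translate t y f"
    using t by (intro ext) (simp add: translate_def)
  ultimately show ?thesis by simp
qed

lemma translate_stable:
  assumes l: "l > 0" and t: "t > 0" and f: "stable l f"
  shows "stable (l + t) (translate t y f)"
  unfolding stable_def
proof (intro conjI allI impI)
  show "translate t y f \<in> borel_measurable borel" by (rule translate_measurable[OF t stable_measurable[OF f]])
  show "translate t y f (r + 1) = m r 1 (translate t y f r) e" if r: "l + t \<le> r" for r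
  proof -
    have pos: "r - t > 0" "l \<le> r - t" using l r by simp_all
    have eq: "r + 1 - t = (r - t) + 1" by simp
    have "translate t y f (r + 1) = m t ((r - t) + 1) y (m (r - t) 1 (f (r - t)) e)"
      using t pos(1) unfolding translate_def eq stable_shift[OF f pos(2)] by simp
    also have "\<dots> = m (t + (r - t)) 1 (m t (r - t) y (f (r - t))) e"
      by (rule m_assoc[OF t pos(1), symmetric]) simp
    also have "\<dots> = m r 1 (translate t y f r) e" using pos(1) by (simp add: translate_def)
    finally show ?thesis .
  qed
  have "set_integrable lborel {l..<l + 1} (\<lambda>r. (norm y)\<^sup>2 * (norm (f r))\<^sup>2)"
    using f by (intro set_integrable_mult_right) (simp add: stable_def)
  also have "?this \<longleftrightarrow> set_integrable lborel {l..<l + 1} (\<lambda>r. (norm (translate t y f (r + t)))\<^sup>2)"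
    using l t by (intro set_integrable_cong refl) (simp add: translate_def norm_m power_mult_distrib)
  finally have int: "set_integrable lborel {l..<l + 1} (\<lambda>r. (norm (translate t y f (r + t)))\<^sup>2)" .
  have "l + t + 1 = (l + 1) + t" by simp
  then show "set_integrable lborel {l + t..<l + t + 1} (\<lambda>r. (norm (translate t y f r))\<^sup>2)"
    using int by (simp only: set_integral_translation(1))
qed

lemma translate_sections: "t > 0 \<Longrightarrow> f \<in> sections \<Longrightarrow> translate t y f \<in> sections"
  unfolding sections_def using translate_stable add_pos_pos by blast

lemma B_translate:
  assumes t: "t > 0" and f: "f \<in> sections" and g: "g \<in> sections"
  shows "B (translate t y f) (translate t z g) = cinner y z * B f g"
proof -
  obtain l where l: "l > 0" "stable l f" "stable l g" using sections_common[OF f g] by blast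
  have "B (translate t y f) (translate t z g) =
      set_lebesgue_integral lborel {l + t..<(l + 1) + t} (\<lambda>r. cinner (translate t y f r) (translate t z g r))"
    using B_eq[OF _ translate_stable[OF l(1) t l(2)] translate_stable[OF l(1) t l(3)]] l(1) t
    by (simp add: window_integral_def add.commute add.left_commute)
  also have "\<dots> = set_lebesgue_integral lborel {l..<l + 1} (\<lambda>r. cinner (translate t y f (r + t)) (translate t z g (r + t)))"
    by (rule set_integral_translation(2))
  also have "\<dots> = set_lebesgue_integral lborel {l..<l + 1} (\<lambda>r. cinner y z * cinner (f r) (g r))"
    using l(1) t by (intro set_lebesgue_integral_cong) (auto simp: translate_def cinner_m)
  also have "\<dots> = cinner y z * B f g"
    unfolding B_eq[OF l] window_integral_def by simp
  finally show ?thesis .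
qed

lemma translate_translate:
  assumes s: "s > 0" and t: "t > 0"
  shows "translate t x (translate s y f) = translate (s + t) (m t s x y) f"
proof (rule ext)
  fix r
  show "translate t x (translate s y f) r = translate (s + t) (m t s x y) f r"
  proof (cases "r > s + t")
    case True
    then have pos: "r - (s + t) > 0" by simp
    have "translate t x (translate s y f) r = m t (r - t) x (m s (r - (s + t)) y (f (r - (s + t))))"
      using True s t by (simp add: translate_def algebra_simps)
    also have "r - t = s + (r - (s + t))" by simp
    also have "m t (s + (r - (s + t))) x (m s (r - (s + t)) y (f (r - (s + t)))) =
        m (t + s) (r - (s + t)) (m t s x y) (f (r - (s + t)))"
      by (rule m_assoc[OF t s pos, symmetric])
    also have "\<dots> = translate (s + t) (m t s x y) f r" using True by (simp add: translate_def add.commute)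
    finally show ?thesis .
  next
    case False
    then show ?thesis using s t by (simp add: translate_def)
  qed
qed

text \<open>The coefficients are \<open>g n s = (b n)\<^sup>* f (t + s)\<close>, formed in \<open>E\<^sub>t \<otimes> E\<^sub>s\<close>. They are characterized by
  \<open>\<langle>z, g n s\<rangle> = \<langle>b n \<cdot> z, f (t + s)\<rangle>\<close>, from which measurability and, by associativity, stability follow.
  The partial sums at \<open>r\<close> are the slices of \<open>f r\<close>; they converge and are dominated by \<open>f\<close>.\<close>

lemma translate_total:
  assumes t: "t > 0" and f: "f \<in> sections" and b: "is_onb b"
  shows "\<exists>g. (\<forall>n. g n \<in> sections) \<and> (\<lambda>N. sq (f - (\<Sum>n<N. translate t (b n) (g n)))) \<longlonglongrightarrow> 0"
proof -
  obtain l where l: "l > 0" "stable l f" using f by (auto simp: sections_def)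
  define U where "U s = system_unitary m t s" for s
  have U: "unitary (U s)" if "s > 0" for s unfolding U_def by (rule system_unitary(1)[OF arveson t that])
  have Um: "U s *\<^sub>V (x \<otimes>\<^sub>H y) = m t s x y" if "s > 0" for s x y unfolding U_def by (rule system_unitary(2)[OF arveson t that])
  define g where "g n s = (if s > 0 then adj (creation (b n)) *\<^sub>V (adj (U s) *\<^sub>V f (t + s)) else 0)" for n s
  have gc: "cinner z (g n s) = cinner (m t s (b n) z) (f (t + s))" if "s > 0" for z n s
    using that by (simp add: g_def cinner_adj_right Um)
  have gnorm: "norm (g n s) \<le> norm (f (t + s))" if s: "s > 0" for n s
  proof -
    have "(norm (g n s))\<^sup>2 = cmod (cinner (g n s) (g n s))" by (simp add: cinner_self norm_power)
    also have "\<dots> \<le> norm (m t s (b n) (g n s)) * norm (f (t + s))" unfolding gc[OF s] by (rule norm_cinner_le)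
    also have "norm (m t s (b n) (g n s)) = norm (g n s)" by (simp add: norm_m[OF t s] onb_norm[OF b])
    finally have "norm (g n s) * norm (g n s) \<le> norm (g n s) * norm (f (t + s))" by (simp add: power2_eq_square)
    then show ?thesis by (cases "norm (g n s) = 0") (simp_all add: mult_le_cancel_left)
  qed
  have gm: "g n \<in> borel_measurable borel" for n
  proof -
    have ft: "(\<lambda>s. f (t + s)) \<in> borel_measurable borel"
      by (rule measurable_compose[OF _ stable_measurable[OF l(2)]]) simp
    have weak: "(\<lambda>s. cinner z (g n s)) \<in> borel_measurable borel" for z
    proof -
      have "(\<lambda>s. if t > 0 \<and> s > 0 then m t s (b n) z else 0) \<in> borel_measurable borel"
        by (rule borel_measurable_m) simp_all
      from borel_measurable_cinner[OF this ft]
      have "(\<lambda>s. cinner (if t > 0 \<and> s > 0 then m t s (b n) z else 0) (f (t + s))) \<in> borel_measurable borel" .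
      moreover have "(\<lambda>s. cinner (if t > 0 \<and> s > 0 then m t s (b n) z else 0) (f (t + s))) = (\<lambda>s. cinner z (g n s))"
        using t gc by (intro ext) (simp add: g_def)
      ultimately show ?thesis by simp
    qed
    \<comment> \<open>Coordinates along the basis are measurable, and a vector is the limit of its partial expansions.\<close>
    have "(\<lambda>s. \<Sum>i<N. cinner (b i) (g n s) *\<^sub>C b i) \<in> borel_measurable borel" for N
    proof (rule borel_measurable_sum)
      fix i
      have "continuous_on UNIV (\<lambda>c. c *\<^sub>C b i)"
        by (rule linear_continuous_on[OF bounded_bilinear.bounded_linear_left[OF bounded_bilinear_scaleC]])
      from borel_measurable_continuous_on[OF this weak]
      show "(\<lambda>s. cinner (b i) (g n s) *\<^sub>C b i) \<in> borel_measurable borel" .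
    qed
    moreover have "(\<lambda>N. \<Sum>i<N. cinner (b i) (g n s) *\<^sub>C b i) \<longlonglongrightarrow> g n s" for s
      using b by (simp add: is_onb_def sums_def)
    ultimately show ?thesis by (rule borel_measurable_LIMSEQ_metric)
  qed
  have gs: "stable l (g n)" for n
    unfolding stable_def
  proof (intro conjI allI impI gm)
    fix r assume r: "l \<le> r"
    then have rp: "r > 0" "r + 1 > 0" "t + r > 0" "l \<le> t + r" using l(1) t by simp_all
    show "g n (r + 1) = m r 1 (g n r) e"
    proof (rule m_ext[OF rp(1), of 1])
      fix x y
      have "cinner (m r 1 x y) (g n (r + 1)) = cinner (m t (r + 1) (b n) (m r 1 x y)) (f ((t + r) + 1))"
        by (simp add: gc[OF rp(2)] add.assoc)
      also have "\<dots> = cinner (m (t + r) 1 (m t r (b n) x) y) (m (t + r) 1 (f (t + r)) e)"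
        using m_assoc[OF t rp(1), of 1] by (simp add: stable_shift[OF l(2) rp(4)])
      also have "\<dots> = cinner (m t r (b n) x) (f (t + r)) * cinner y e"
        by (rule cinner_m[OF rp(3)]) simp
      also have "\<dots> = cinner (m r 1 x y) (m r 1 (g n r) e)"
        by (simp add: gc[OF rp(1), symmetric] cinner_m[OF rp(1)])
      finally show "cinner (m r 1 x y) (g n (r + 1)) = cinner (m r 1 x y) (m r 1 (g n r) e)" .
    qed simp
  next
    have "stable (l + t) f" by (rule stable_mono[OF l]) (use t in simp)
    then have "set_integrable lborel {l + t..<(l + 1) + t} (\<lambda>r. (norm (f r))\<^sup>2)"
      by (simp add: stable_def add.commute add.left_commute)
    then have int: "set_integrable lborel {l..<l + 1} (\<lambda>r. (norm (f (r + t)))\<^sup>2)"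
      unfolding set_integral_translation(1) .
    show "set_integrable lborel {l..<l + 1} (\<lambda>r. (norm (g n r))\<^sup>2)"
    proof (rule set_integrable_bound[OF int])
      have "(\<lambda>r. (norm (g n r))\<^sup>2) \<in> borel_measurable borel" using gm[of n] by measurable
      then show "set_borel_measurable lborel {l..<l + 1} (\<lambda>r. (norm (g n r))\<^sup>2)"
        unfolding set_borel_measurable_def by simp
      have "(norm (g n r))\<^sup>2 \<le> (norm (f (r + t)))\<^sup>2" if "r \<in> {l..<l + 1}" for r
        using gnorm[of r n] that l(1) by (intro power_mono) (simp_all add: add.commute)
      then show "AE r in lborel. r \<in> {l..<l + 1} \<longrightarrow> norm ((norm (g n r))\<^sup>2) \<le> norm ((norm (f (r + t)))\<^sup>2)"
        by (intro AE_I2 impI) simp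
    qed
  qed
  have slice_eq: "(\<Sum>n<N. translate t (b n) (g n)) r = U (r - t) *\<^sub>V (slice b N *\<^sub>V (adj (U (r - t)) *\<^sub>V f r))" if r: "r > t" for r N
    using r by (simp add: sum_fun_apply translate_def slice_apply cblinfun_sum Um g_def)
  have lt: "l + t > 0" using l(1) t by simp
  have "(\<lambda>N. sq (f - (\<Sum>n<N. translate t (b n) (g n)))) \<longlonglongrightarrow> 0"
  proof (rule sq_dominated_convergence[OF lt stable_mono[OF l], where C=0])
    show "stable (l + t) (\<Sum>n<N. translate t (b n) (g n))" for N
      by (intro stable_sum lt translate_stable l(1) t gs)
    fix r assume "l + t \<le> r"
    then have r: "r > t" "r - t > 0" using l(1) by simp_all
    have "(\<lambda>N. U (r - t) *\<^sub>V (slice b N *\<^sub>V (adj (U (r - t)) *\<^sub>V f r))) \<longlonglongrightarrow> U (r - t) *\<^sub>V (adj (U (r - t)) *\<^sub>V f r)"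
      by (intro tendsto_cblinfun slice_tendsto b)
    then show "(\<lambda>N. (\<Sum>n<N. translate t (b n) (g n)) r) \<longlonglongrightarrow> f r"
      unfolding slice_eq[OF r(1)] unitary_apply_adj[OF U[OF r(2)]] .
    fix N
    have "norm ((\<Sum>n<N. translate t (b n) (g n)) r) \<le> norm (f r)"
      unfolding slice_eq[OF r(1)] unitary_norm[OF U[OF r(2)]]
      using norm_slice_le[OF b, of N "adj (U (r - t)) *\<^sub>V f r"] by (simp add: unitary_norm[OF unitary_adj[OF U[OF r(2)]]])
    then show "norm ((\<Sum>n<N. translate t (b n) (g n)) r) \<le> 2 * norm (f r) + 0"
      using norm_ge_zero[of "f r"] by linarith
  qed (use t in simp)
  moreover have "g n \<in> sections" for n by (rule sectionsI[OF l(1) gs])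
  ultimately show ?thesis by (intro exI[of _ g] conjI allI)
qed

text \<open>The integrand depends on \<open>(t, r)\<close> in a jointly measurable way.\<close>

lemma measurable_B_translate:
  assumes f: "f \<in> borel_measurable borel" and g: "g \<in> borel_measurable borel"
  shows "(\<lambda>t. if t > 0 then B (translate t y f) g else 0) \<in> borel_measurable borel"
proof -
  define h where "h p = (if 0 < fst p then translate (fst p) y f (snd p) else 0)" for p :: "real \<times> real"
  have hm: "h \<in> borel_measurable (borel \<Otimes>\<^sub>M lborel)"
    unfolding h_def[abs_def] by (rule translate_measurable_joint[OF f])
  have gm: "(\<lambda>p. g (snd p)) \<in> borel_measurable (borel \<Otimes>\<^sub>M lborel :: (real \<times> real) measure)"
    by (rule measurable_compose[OF measurable_snd]) (simp add: g)
  have "(\<lambda>p. indicat_real {real n..<real n + 1} (snd p) *\<^sub>R cinner (h p) (g (snd p))) \<in> borel_measurable (borel \<Otimes>\<^sub>M lborel)" for n :: nat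
  proof (rule borel_measurable_scaleR[OF _ borel_measurable_cinner[OF hm gm]])
    show "(\<lambda>p. indicat_real {real n..<real n + 1} (snd p)) \<in> borel_measurable (borel \<Otimes>\<^sub>M lborel :: (real \<times> real) measure)"
      by (rule measurable_compose[OF measurable_snd]) simp
  qed
  then have "(\<lambda>t. \<integral>r. indicat_real {real n..<real n + 1} r *\<^sub>R cinner (h (t, r)) (g r) \<partial>lborel) \<in> borel_measurable borel" for n :: nat
    by (intro lborel.borel_measurable_lebesgue_integral) (simp add: case_prod_unfold)
  then have "(\<lambda>t. lim (\<lambda>n::nat. \<integral>r. indicat_real {real n..<real n + 1} r *\<^sub>R cinner (h (t, r)) (g r) \<partial>lborel)) \<in> borel_measurable borel"
    by (rule borel_measurable_lim_metric)
  then have "(\<lambda>t. if t > 0 then lim (\<lambda>n::nat. \<integral>r. indicat_real {real n..<real n + 1} r *\<^sub>R cinner (h (t, r)) (g r) \<partial>lborel) else 0)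
      \<in> borel_measurable borel"
    by (intro measurable_If borel_measurable_const) simp_all
  moreover have "(\<lambda>t. if t > 0 then lim (\<lambda>n::nat. \<integral>r. indicat_real {real n..<real n + 1} r *\<^sub>R cinner (h (t, r)) (g r) \<partial>lborel) else 0) =
      (\<lambda>t. if t > 0 then B (translate t y f) g else 0)"
    by (rule ext) (simp add: B_def window_integral_def set_lebesgue_integral_def h_def)
  ultimately show ?thesis by simp
qed

section \<open>The dilation on the space of stable sections\<close>

text \<open>In the following \<open>\<Phi>\<close> realizes the space of stable sections densely in \<open>'h\<close>.\<close>

context
  fixes \<Phi> :: "(real \<Rightarrow> 'a) \<Rightarrow> 'h::separable_infinite_chilbert"
  assumes \<Phi>: "\<And>f g. f \<in> sections \<Longrightarrow> g \<in> sections \<Longrightarrow> cinner (\<Phi> f) (\<Phi> g) = B f g"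
    and dense: "closure (\<Phi> ` sections) = UNIV"
begin

lemma \<Phi>_ext:
  assumes "\<And>g. g \<in> sections \<Longrightarrow> cinner (\<Phi> g) x = cinner (\<Phi> g) y"
  shows "x = y"
  by (rule total_cinner_ext[OF dense_imp_total[OF dense]]) (use assms in auto)

lemma \<Phi>_add: "f \<in> sections \<Longrightarrow> g \<in> sections \<Longrightarrow> \<Phi> (f + g) = \<Phi> f + \<Phi> g"
  by (rule \<Phi>_ext) (simp add: \<Phi> cinner_add_right add_right)

lemma \<Phi>_zero: "\<Phi> 0 = 0"
  by (rule \<Phi>_ext) (simp add: \<Phi>)

lemma \<Phi>_sum: "(\<And>i. i \<in> A \<Longrightarrow> f i \<in> sections) \<Longrightarrow> \<Phi> (\<Sum>i\<in>A. f i) = (\<Sum>i\<in>A. \<Phi> (f i))"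
  by (induction A rule: infinite_finite_induct) (simp_all add: \<Phi>_zero \<Phi>_add mem_sum)

lemma norm_\<Phi>_diff:
  assumes "f \<in> sections" "g \<in> sections"
  shows "(norm (\<Phi> f - \<Phi> g))\<^sup>2 = sq (f - g)"
proof -
  have "\<Phi> ((f - g) + g) = \<Phi> (f - g) + \<Phi> g" by (rule \<Phi>_add) (simp_all add: assms)
  then have "\<Phi> f - \<Phi> g = \<Phi> (f - g)" by (simp add: algebra_simps)
  moreover have "cinner (\<Phi> (f - g)) (\<Phi> (f - g)) = complex_of_real (sq (f - g))"
    using assms by (simp add: \<Phi> self_eq)
  ultimately show ?thesis unfolding cinner_self of_real_eq_iff by simp
qed

text \<open>Replaces functions that are not stable sections by zero, so that total families can be indexed by a
  type.\<close>

definition sect :: "(real \<Rightarrow> 'a) \<Rightarrow> (real \<Rightarrow> 'a)"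
  where "sect f = (if f \<in> sections then f else 0)"

lemma sect_mem [simp]: "sect f \<in> sections"
  by (simp add: sect_def)

lemma tensor_sections_total:
  "closure (cspan (range (\<lambda>(y :: 'a, f). y \<otimes>\<^sub>H \<Phi> (sect f)))) = UNIV"
proof (rule closure_cspan_subset[OF _ tensor_total])
  let ?E = "range (\<lambda>(y :: 'a, f). y \<otimes>\<^sub>H \<Phi> (sect f))"
  have "y \<otimes>\<^sub>H h \<in> closure (cspan ?E)" for y h
  proof -
    have "h \<in> closure (\<Phi> ` sections)" using dense by simp
    then obtain X where X: "\<forall>n. X n \<in> \<Phi> ` sections" "X \<longlonglongrightarrow> h" unfolding closure_sequential by blast
    have "(\<lambda>n. creation y *\<^sub>V X n) \<longlonglongrightarrow> creation y *\<^sub>V h" by (rule tendsto_cblinfun[OF X(2)])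
    then have "(\<lambda>n. y \<otimes>\<^sub>H X n) \<longlonglongrightarrow> y \<otimes>\<^sub>H h" by simp
    moreover have "y \<otimes>\<^sub>H X n \<in> cspan ?E" for n
    proof -
      obtain f where f: "f \<in> sections" "X n = \<Phi> f" using X(1) by blast
      then have "y \<otimes>\<^sub>H X n = (\<lambda>(y, f). y \<otimes>\<^sub>H \<Phi> (sect f)) (y, f)" by (simp add: sect_def)
      then have "y \<otimes>\<^sub>H X n \<in> ?E" by (rule range_eqI)
      then show ?thesis by (rule complex_vector.span_base)
    qed
    ultimately show ?thesis
      unfolding closure_sequential by (intro exI[of _ "\<lambda>n. y \<otimes>\<^sub>H X n"] conjI allI)
  qed
  then show "range (\<lambda>(x, y). x \<otimes>\<^sub>H y) \<subseteq> closure (cspan ?E)" by auto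
qed

lemma translated_sections_total:
  assumes t: "t > 0"
  shows "closure (cspan (range (\<lambda>(y, f). \<Phi> (translate t y (sect f))))) = UNIV"
proof (rule closure_cspan_subset[OF _ dense_imp_total[OF dense]])
  let ?E = "range (\<lambda>(y, f). \<Phi> (translate t y (sect f)))"
  obtain b :: "nat \<Rightarrow> 'a" where b: "is_onb b" using onb_exists ..
  have "\<Phi> f \<in> closure (cspan ?E)" if f: "f \<in> sections" for f
  proof -
    obtain g where g: "\<forall>n. g n \<in> sections" "(\<lambda>N. sq (f - (\<Sum>n<N. translate t (b n) (g n)))) \<longlonglongrightarrow> 0"
      using translate_total[OF t f b] by blast
    have tg: "translate t (b n) (g n) \<in> sections" for n using g(1) by (intro translate_sections t) simp
    have sm: "(\<Sum>n<N. translate t (b n) (g n)) \<in> sections" for N by (intro mem_sum tg)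
    have "(\<lambda>N. sqrt ((norm (\<Phi> f - \<Phi> (\<Sum>n<N. translate t (b n) (g n))))\<^sup>2)) \<longlonglongrightarrow> sqrt 0"
      unfolding norm_\<Phi>_diff[OF f sm] by (intro tendsto_real_sqrt g(2))
    then have "(\<lambda>N. \<Phi> f - \<Phi> (\<Sum>n<N. translate t (b n) (g n))) \<longlonglongrightarrow> 0" by (simp add: tendsto_norm_zero_iff)
    then have "(\<lambda>N. \<Phi> f - (\<Phi> f - \<Phi> (\<Sum>n<N. translate t (b n) (g n)))) \<longlonglongrightarrow> \<Phi> f - 0" by (intro tendsto_intros)
    then have lim: "(\<lambda>N. \<Phi> (\<Sum>n<N. translate t (b n) (g n))) \<longlonglongrightarrow> \<Phi> f" by simp
    have mem: "\<Phi> (\<Sum>n<N. translate t (b n) (g n)) \<in> cspan ?E" for N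
      unfolding \<Phi>_sum[OF tg]
    proof (rule complex_vector.span_sum)
      fix n
      have "\<Phi> (translate t (b n) (g n)) = (\<lambda>(y, f). \<Phi> (translate t y (sect f))) (b n, g n)"
        using g(1) by (simp add: sect_def)
      then have "\<Phi> (translate t (b n) (g n)) \<in> ?E" by (rule range_eqI)
      then show "\<Phi> (translate t (b n) (g n)) \<in> cspan ?E" by (rule complex_vector.span_base)
    qed
    show ?thesis
      unfolding closure_sequential
      by (intro exI[of _ "\<lambda>N. \<Phi> (\<Sum>n<N. translate t (b n) (g n))"] conjI allI mem lim)
  qed
  then show "\<Phi> ` sections \<subseteq> closure (cspan ?E)" by blast
qed

text \<open>By \<open>B_translate\<close> the families \<open>y \<otimes> \<Phi> f\<close> and \<open>\<Phi> (translate t y f)\<close> have the same Gram matrix, and both are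
  total.\<close>

lemma dilation_step:
  assumes t: "t > 0"
  shows "\<exists>T :: ('a, 'h) htensor \<Rightarrow>\<^sub>C\<^sub>L 'h. unitary T \<and> (\<forall>y. \<forall>f\<in>sections. T *\<^sub>V (y \<otimes>\<^sub>H \<Phi> f) = \<Phi> (translate t y f))"
proof -
  have "\<exists>T :: ('a, 'h) htensor \<Rightarrow>\<^sub>C\<^sub>L 'h. unitary T \<and>
      (\<forall>i. T *\<^sub>V (\<lambda>(y, f). y \<otimes>\<^sub>H \<Phi> (sect f)) i = (\<lambda>(y, f). \<Phi> (translate t y (sect f))) i)"
  proof (rule unitary_extension[OF tensor_sections_total translated_sections_total[OF t]])
    fix i j :: "'a \<times> (real \<Rightarrow> 'a)"
    show "cinner ((\<lambda>(y, f). \<Phi> (translate t y (sect f))) i) ((\<lambda>(y, f). \<Phi> (translate t y (sect f))) j) =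
        cinner ((\<lambda>(y, f). y \<otimes>\<^sub>H \<Phi> (sect f)) i) ((\<lambda>(y, f). y \<otimes>\<^sub>H \<Phi> (sect f)) j)"
      by (simp add: case_prod_unfold cinner_tensor \<Phi> translate_sections t B_translate)
  qed
  then obtain T :: "('a, 'h) htensor \<Rightarrow>\<^sub>C\<^sub>L 'h" where T: "unitary T"
    "\<forall>i. T *\<^sub>V (\<lambda>(y, f). y \<otimes>\<^sub>H \<Phi> (sect f)) i = (\<lambda>(y, f). \<Phi> (translate t y (sect f))) i" by blast
  have "T *\<^sub>V (y \<otimes>\<^sub>H \<Phi> f) = \<Phi> (translate t y f)" if "f \<in> sections" for y f
    using T(2)[rule_format, of "(y, f)"] that by (simp add: sect_def)
  with T(1) show ?thesis by blast
qed

text \<open>The dilation equation holds on \<open>x \<otimes> y \<otimes> \<Phi> f\<close> by \<open>translate_translate\<close> and extends by density, and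
  so does measurability, from \<open>measurable_B_translate\<close>.\<close>

lemma dilation_exists: "\<exists>w :: real \<Rightarrow> ('a, 'h) htensor \<Rightarrow>\<^sub>C\<^sub>L 'h. measurable_right_dilation m w"
proof -
  have "\<forall>t. \<exists>T :: ('a, 'h) htensor \<Rightarrow>\<^sub>C\<^sub>L 'h. t > 0 \<longrightarrow>
      unitary T \<and> (\<forall>y. \<forall>f\<in>sections. T *\<^sub>V (y \<otimes>\<^sub>H \<Phi> f) = \<Phi> (translate t y f))"
    using dilation_step by blast
  then obtain w :: "real \<Rightarrow> ('a, 'h) htensor \<Rightarrow>\<^sub>C\<^sub>L 'h" where "\<forall>t>0.
      unitary (w t) \<and> (\<forall>y. \<forall>f\<in>sections. w t *\<^sub>V (y \<otimes>\<^sub>H \<Phi> f) = \<Phi> (translate t y f))"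
    by (rule choice[THEN exE]) blast
  then have uw: "\<And>t. t > 0 \<Longrightarrow> unitary (w t)"
    and w: "\<And>t y f. t > 0 \<Longrightarrow> f \<in> sections \<Longrightarrow> w t *\<^sub>V (y \<otimes>\<^sub>H \<Phi> f) = \<Phi> (translate t y f)" by simp_all
  let ?M = "\<lambda>u x. (\<lambda>t. if t > 0 then cinner (w t *\<^sub>V u) x else 0) \<in> borel_measurable borel"
  have "right_dilation m w"
    unfolding right_dilation_def
  proof (intro conjI allI impI)
    obtain b :: "nat \<Rightarrow> 'h" where "is_onb b" using onb_exists ..
    from onb_norm[OF this, of 0] have "b 0 \<noteq> 0" by auto
    then show "(UNIV :: 'h set) \<noteq> {0}" by blast
    show "unitary (w t)" if "t > 0" for t by (rule uw[OF that])
    fix s t :: real assume s: "s > 0" and t: "t > 0"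
    let ?L = "w t o\<^sub>C\<^sub>L (id_cblinfun \<otimes>\<^sub>O w s) o\<^sub>C\<^sub>L tensor_assoc"
    let ?R = "w (s + t) o\<^sub>C\<^sub>L (system_unitary m t s \<otimes>\<^sub>O id_cblinfun)"
    show "?L = ?R"
    proof (rule cblinfun_eq_total[OF tensor3_total])
      fix u assume "u \<in> range (\<lambda>(x, y, z). ((x::'a) \<otimes>\<^sub>H (y::'a)) \<otimes>\<^sub>H (z::'h))"
      then obtain x y h where u: "u = (x \<otimes>\<^sub>H y) \<otimes>\<^sub>H h" by auto
      have "?L o\<^sub>C\<^sub>L creation (x \<otimes>\<^sub>H y) = ?R o\<^sub>C\<^sub>L creation (x \<otimes>\<^sub>H y)"
      proof (rule cblinfun_eq_total[OF dense_imp_total[OF dense]])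
        fix z assume "z \<in> \<Phi> ` sections"
        then obtain f where f: "f \<in> sections" "z = \<Phi> f" by blast
        show "(?L o\<^sub>C\<^sub>L creation (x \<otimes>\<^sub>H y)) *\<^sub>V z = (?R o\<^sub>C\<^sub>L creation (x \<otimes>\<^sub>H y)) *\<^sub>V z"
          using s t f(1)
          by (simp add: f(2) tensor_assoc_tensor tensor_op_tensor system_unitary(2)[OF arveson t s] w
              translate_sections translate_translate[OF s t])
      qed
      then have "(?L o\<^sub>C\<^sub>L creation (x \<otimes>\<^sub>H y)) *\<^sub>V h = (?R o\<^sub>C\<^sub>L creation (x \<otimes>\<^sub>H y)) *\<^sub>V h" by (rule arg_cong)
      then show "?L *\<^sub>V u = ?R *\<^sub>V u" unfolding u by simp
    qed
  qed
  moreover have "?M u x" for u x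
  proof -
    have 1: "?M (y \<otimes>\<^sub>H \<Phi> f) (\<Phi> g)"
      if fg: "f \<in> sections" "g \<in> sections" for y f g
    proof -
      have mfg: "f \<in> borel_measurable borel" "g \<in> borel_measurable borel"
        using fg by (auto simp: sections_def stable_def)
      have "(\<lambda>t. if t > 0 then cinner (w t *\<^sub>V (y \<otimes>\<^sub>H \<Phi> f)) (\<Phi> g) else 0) =
          (\<lambda>t. if t > 0 then B (translate t y f) g else 0)"
        using fg by (intro ext) (simp add: w \<Phi> translate_sections)
      then show ?thesis using measurable_B_translate[OF mfg] by simp
    qed
    have 2: "?M (y \<otimes>\<^sub>H \<Phi> f) x"
      if f: "f \<in> sections" for y f
    proof -
      have "x \<in> closure (\<Phi> ` sections)" using dense by simp
      then obtain X where X: "\<forall>n. X n \<in> \<Phi> ` sections" "X \<longlonglongrightarrow> x" unfolding closure_sequential by blast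
      show ?thesis
      proof (rule borel_measurable_LIMSEQ_metric)
        fix n
        obtain g where g: "g \<in> sections" "X n = \<Phi> g" using X(1) by blast
        show "?M (y \<otimes>\<^sub>H \<Phi> f) (X n)"
          unfolding g(2) by (rule 1[OF f g(1)])
      next
        fix t :: real
        show "(\<lambda>n. if t > 0 then cinner (w t *\<^sub>V (y \<otimes>\<^sub>H \<Phi> f)) (X n) else 0) \<longlonglongrightarrow>
            (if t > 0 then cinner (w t *\<^sub>V (y \<otimes>\<^sub>H \<Phi> f)) x else 0)"
          by (simp add: tendsto_cinner[OF tendsto_const X(2)])
      qed
    qed
    show ?thesis
    proof (rule total_induct[OF tensor_sections_total,
          where P="\<lambda>u. ?M u x"])
      show "closed {u. ?M u x}"
        unfolding closed_sequential_limits
      proof (intro allI impI)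
        fix X :: "nat \<Rightarrow> ('a, 'h) htensor" and u
        assume X: "(\<forall>n. X n \<in> {u. ?M u x}) \<and> X \<longlonglongrightarrow> u"
        have "?M u x"
        proof (rule borel_measurable_LIMSEQ_metric)
          show "?M (X n) x" for n using X by simp
          fix t :: real
          have "(\<lambda>n. cinner (w t *\<^sub>V X n) x) \<longlonglongrightarrow> cinner (w t *\<^sub>V u) x"
            by (intro tendsto_cinner tendsto_cblinfun tendsto_const) (use X in simp)
          then show "(\<lambda>n. if t > 0 then cinner (w t *\<^sub>V X n) x else 0) \<longlonglongrightarrow> (if t > 0 then cinner (w t *\<^sub>V u) x else 0)"
            by simp
        qed
        then show "u \<in> {u. ?M u x}" by simp
      qed
    next
      have "(\<lambda>t. if t > 0 then cinner (w t *\<^sub>V 0) x else 0) = (\<lambda>_. 0)" by (rule ext) simp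
      then show "?M 0 x" by simp
    next
      fix u v
      assume "?M u x"
        "?M v x"
      then have "(\<lambda>t. (if t > 0 then cinner (w t *\<^sub>V u) x else 0) + (if t > 0 then cinner (w t *\<^sub>V v) x else 0)) \<in> borel_measurable borel"
        by (rule borel_measurable_add)
      also have "(\<lambda>t. (if t > 0 then cinner (w t *\<^sub>V u) x else 0) + (if t > 0 then cinner (w t *\<^sub>V v) x else 0)) =
          (\<lambda>t. if t > 0 then cinner (w t *\<^sub>V (u + v)) x else 0)"
        by (rule ext) (simp add: cblinfun_add cinner_add_left)
      finally show "?M (u + v) x" .
    next
      fix c u
      assume "?M u x"
      then have "(\<lambda>t. cnj c * (if t > 0 then cinner (w t *\<^sub>V u) x else 0)) \<in> borel_measurable borel"
        by (intro borel_measurable_times borel_measurable_const)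
      also have "(\<lambda>t. cnj c * (if t > 0 then cinner (w t *\<^sub>V u) x else 0)) = (\<lambda>t. if t > 0 then cinner (w t *\<^sub>V (c *\<^sub>C u)) x else 0)"
        by (rule ext) (simp add: cblinfun_scaleC cinner_scaleC_left)
      finally show "?M (c *\<^sub>C u) x" .
    next
      fix u assume "u \<in> range (\<lambda>(y :: 'a, f). y \<otimes>\<^sub>H \<Phi> (sect f))"
      then obtain y f where u: "u = y \<otimes>\<^sub>H \<Phi> (sect f)" by auto
      show "?M u x"
        unfolding u by (rule 2[OF sect_mem])
    qed
  qed
  ultimately have "measurable_right_dilation m w" by unfold_locales (rule arveson)
  then show ?thesis by blast
qed

end

end

text \<open>The unit vector that defines stability is arbitrary; the first vector of an orthonormal basis serves.\<close>

theorem measurable_right_dilation_exists: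
  fixes m :: "real \<Rightarrow> real \<Rightarrow> 'a \<Rightarrow> 'a \<Rightarrow> 'a::separable_infinite_chilbert"
  assumes "arveson_system m"
  shows "\<exists>w :: real \<Rightarrow> ('a, 'h::separable_infinite_chilbert) htensor \<Rightarrow>\<^sub>C\<^sub>L 'h. measurable_right_dilation m w"
proof -
  obtain b :: "nat \<Rightarrow> 'a" where b: "is_onb b" using onb_exists ..
  interpret arveson_unit m "b 0" by standard (use assms onb_norm[OF b] in simp_all)
  obtain \<Phi> :: "(real \<Rightarrow> 'a) \<Rightarrow> 'h" where
    "(\<forall>f\<in>sections. \<forall>g\<in>sections. cinner (\<Phi> f) (\<Phi> g) = B f g) \<and> closure (\<Phi> ` sections) = UNIV"
    using sections_realization ..
  then show ?thesis by (intro dilation_exists[of \<Phi>]) simp_all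
qed

section \<open>Bhat systems by reversing the multiplication\<close>

lemma arveson_system_opposite:
  assumes "arveson_system m"
  shows "arveson_system (\<lambda>s t x y. m t s y x)"
  unfolding arveson_system_def
proof (intro conjI allI impI)
  have "(\<lambda>((s, x), (t, y)). (s + t, m s t x y)) \<in> bundle_borel \<Otimes>\<^sub>M bundle_borel \<rightarrow>\<^sub>M bundle_borel"
    using assms by (simp add: arveson_system_def)
  from measurable_compose[OF measurable_pair_swap' this]
  show "(\<lambda>((s, x), (t, y)). (s + t, m t s y x)) \<in> bundle_borel \<Otimes>\<^sub>M bundle_borel \<rightarrow>\<^sub>M bundle_borel"
    by (simp add: case_prod_unfold add.commute)
next
  fix r s t :: real and x y z
  assume pos: "r > 0" "s > 0" "t > 0"
  have "m (t + s) r (m t s z y) x = m t (s + r) z (m s r y x)"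
    using assms pos by (simp add: arveson_system_def)
  then show "m t (r + s) z (m s r y x) = m (s + t) r (m t s z y) x" by (simp add: add.commute)
next
  fix s t :: real
  assume pos: "s > 0" "t > 0"
  obtain T :: "('a, 'a) htensor \<Rightarrow>\<^sub>C\<^sub>L ('a, 'a) htensor" where T: "unitary T" "\<And>x y. T *\<^sub>V (y \<otimes>\<^sub>H x) = x \<otimes>\<^sub>H y"
    using tensor_flip_exists[where 'a='a and 'b='a] by blast
  show "\<exists>u. unitary u \<and> (\<forall>x y. u *\<^sub>V (x \<otimes>\<^sub>H y) = m t s y x)"
    by (rule exI[of _ "system_unitary m t s o\<^sub>C\<^sub>L T"])
       (simp add: unitary_compose[OF system_unitary(1)[OF assms pos(2,1)] T(1)] T(2) system_unitary(2)[OF assms pos(2,1)])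
qed

text \<open>Composing the right dilation of the reversed system with the flip \<open>T\<close> of the tensor factors gives the
  left dilation, and \<open>(1 \<otimes> a) T = T (a \<otimes> 1)\<close> shows that the semigroup is the same.\<close>

lemma has_Bhat_system_opposite:
  fixes m :: "real \<Rightarrow> real \<Rightarrow> 'a \<Rightarrow> 'a \<Rightarrow> 'a::separable_infinite_chilbert"
    and w :: "real \<Rightarrow> ('a, 'h::separable_infinite_chilbert) htensor \<Rightarrow>\<^sub>C\<^sub>L 'h"
  assumes m: "arveson_system m" and w: "measurable_right_dilation (\<lambda>s t x y. m t s y x) w"
  shows "has_Bhat_system (measurable_right_dilation.\<theta> w) m"
proof -
  interpret op: measurable_right_dilation "\<lambda>s t x y. m t s y x" w by (rule w)
  obtain T :: "('h, 'a) htensor \<Rightarrow>\<^sub>C\<^sub>L ('a, 'h) htensor" where T: "unitary T" "\<And>x y. T *\<^sub>V (y \<otimes>\<^sub>H x) = x \<otimes>\<^sub>H y"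
    using tensor_flip_exists[where 'a='a and 'b='h] by blast
  define v where "v t = w t o\<^sub>C\<^sub>L T" for t
  have v: "v t *\<^sub>V (h \<otimes>\<^sub>H x) = w t *\<^sub>V (x \<otimes>\<^sub>H h)" for t h x by (simp add: v_def T(2))
  have "left_dilation m v"
    unfolding left_dilation_def
  proof (intro conjI allI impI)
    show "(UNIV :: 'h set) \<noteq> {0}" using op.dilation by (simp add: right_dilation_def)
    show "unitary (v t)" if "t > 0" for t
      unfolding v_def by (rule unitary_compose[OF op.unitary_w[OF that] T(1)])
    fix s t :: real assume s: "s > 0" and t: "t > 0"
    show "v t o\<^sub>C\<^sub>L (v s \<otimes>\<^sub>O id_cblinfun) = v (s + t) o\<^sub>C\<^sub>L (id_cblinfun \<otimes>\<^sub>O system_unitary m s t) o\<^sub>C\<^sub>L tensor_assoc"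
    proof (rule cblinfun_eq_total[OF tensor3_total])
      fix u assume "u \<in> range (\<lambda>(x, y, z). ((x::'h) \<otimes>\<^sub>H (y::'a)) \<otimes>\<^sub>H (z::'a))"
      then obtain h x y where u: "u = (h \<otimes>\<^sub>H x) \<otimes>\<^sub>H y" by auto
      show "(v t o\<^sub>C\<^sub>L (v s \<otimes>\<^sub>O id_cblinfun)) *\<^sub>V u =
          (v (s + t) o\<^sub>C\<^sub>L (id_cblinfun \<otimes>\<^sub>O system_unitary m s t) o\<^sub>C\<^sub>L tensor_assoc) *\<^sub>V u"
        by (simp add: u tensor_op_tensor v tensor_assoc_tensor system_unitary(2)[OF m s t] op.dilation_mult[OF s t])
    qed
  qed
  moreover have "op.\<theta> t a = v t o\<^sub>C\<^sub>L (a \<otimes>\<^sub>O id_cblinfun) o\<^sub>C\<^sub>L adj (v t)" if t: "t > 0" for t a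
  proof -
    have TT: "(id_cblinfun \<otimes>\<^sub>O a) o\<^sub>C\<^sub>L T = T o\<^sub>C\<^sub>L (a \<otimes>\<^sub>O id_cblinfun)"
      by (rule cblinfun_eq_tensor) (simp add: tensor_op_tensor T(2))
    show ?thesis
    proof (rule cblinfun_eqI)
      fix x
      have "((id_cblinfun \<otimes>\<^sub>O a) o\<^sub>C\<^sub>L T) *\<^sub>V (adj T *\<^sub>V (adj (w t) *\<^sub>V x)) =
          (T o\<^sub>C\<^sub>L (a \<otimes>\<^sub>O id_cblinfun)) *\<^sub>V (adj T *\<^sub>V (adj (w t) *\<^sub>V x))" by (simp only: TT)
      then show "op.\<theta> t a *\<^sub>V x = (v t o\<^sub>C\<^sub>L (a \<otimes>\<^sub>O id_cblinfun) o\<^sub>C\<^sub>L adj (v t)) *\<^sub>V x"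
        using t by (simp add: op.\<theta>_def amplify_apply v_def adj_compose unitary_apply_adj[OF T(1)])
    qed
  qed
  ultimately show ?thesis unfolding has_Bhat_system_def by (intro exI[of _ v] conjI allI impI)
qed

theorem theorem4p2:
  fixes m :: "real \<Rightarrow> real \<Rightarrow> 'a \<Rightarrow> 'a \<Rightarrow> 'a::separable_infinite_chilbert"
  assumes "arveson_system m"
  shows "(\<exists>\<theta> :: real \<Rightarrow> ('h::separable_infinite_chilbert \<Rightarrow>\<^sub>C\<^sub>L 'h) \<Rightarrow> ('h \<Rightarrow>\<^sub>C\<^sub>L 'h).
            E0_semigroup \<theta> \<and> strongly_continuous \<theta> \<and> has_Bhat_system \<theta> m) \<and>
         (\<exists>\<theta> :: real \<Rightarrow> ('h \<Rightarrow>\<^sub>C\<^sub>L 'h) \<Rightarrow> ('h \<Rightarrow>\<^sub>C\<^sub>L 'h).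
            E0_semigroup \<theta> \<and> strongly_continuous \<theta> \<and> has_Arveson_system \<theta> m)"
proof
  obtain w :: "real \<Rightarrow> ('a, 'h) htensor \<Rightarrow>\<^sub>C\<^sub>L 'h" where w: "measurable_right_dilation (\<lambda>s t x y. m t s y x) w"
    using measurable_right_dilation_exists[OF arveson_system_opposite[OF assms]] ..
  interpret op: measurable_right_dilation "\<lambda>s t x y. m t s y x" w by (rule w)
  show "\<exists>\<theta> :: real \<Rightarrow> ('h \<Rightarrow>\<^sub>C\<^sub>L 'h) \<Rightarrow> ('h \<Rightarrow>\<^sub>C\<^sub>L 'h).
      E0_semigroup \<theta> \<and> strongly_continuous \<theta> \<and> has_Bhat_system \<theta> m"
    using op.E0_semigroup_\<theta> op.strongly_continuous_\<theta> has_Bhat_system_opposite[OF assms w] by blast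
next
  obtain w :: "real \<Rightarrow> ('a, 'h) htensor \<Rightarrow>\<^sub>C\<^sub>L 'h" where w: "measurable_right_dilation m w"
    using measurable_right_dilation_exists[OF assms] ..
  interpret measurable_right_dilation m w by (rule w)
  show "\<exists>\<theta> :: real \<Rightarrow> ('h \<Rightarrow>\<^sub>C\<^sub>L 'h) \<Rightarrow> ('h \<Rightarrow>\<^sub>C\<^sub>L 'h).
      E0_semigroup \<theta> \<and> strongly_continuous \<theta> \<and> has_Arveson_system \<theta> m"
    using E0_semigroup_\<theta> strongly_continuous_\<theta> has_Arveson_system_\<theta> by blast
qed

end
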